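(* Let $\mathbb{F}$ be an algebraically closed field of characteristic different from $2$. Let $b$ be a non-degenerate symmetric bilinear form on a finite-dimensional vector space $V$ over $\mathbb{F}$, and let $u$ be a $b$-skew-selfadjoint endomorphism of $V$. Then there exist $b$-skew-selfadjoint endomorphisms $a_1,a_2$ of $V$ with $a_1^2=a_2^2=0$ and $u=a_1+a_2$ if and only if the following conditions hold: (i) for all $\lambda\in\mathbb{F}\setminus\{0\}$ and all $k\ge1$, the Jordan number $n_{t-\lambda,k}(u)$ is even; (ii) for all $k\ge0$, if $\sum_{i>k}n_{t,2i+1}(u)$ is odd then $n_{t,2k+1}(u)>0$.
   Context: $u$ is $b$-skew-selfadjoint if $b(u(x),y)=-b(x,u(y))$ for all $x,y$. For $\lambda\in\mathbb{F}$ and $k\ge1$, $n_{t-\lambda,k}(u)$ denotes the number of Jordan cells of size exactly $k$ of $u$ for the eigenvalue $\lambda$ (so $n_{t,k}(u)$ is for the eigenvalue $0$). *)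

theory Defs
  imports
    "HOL-Computational_Algebra.Polynomial"
    "Jordan_Normal_Form.Jordan_Normal_Form"
begin

definition bilinear_form ::
  "('a::field \<Rightarrow> 'v::ab_group_add \<Rightarrow> 'v) \<Rightarrow> ('v \<Rightarrow> 'v \<Rightarrow> 'a) \<Rightarrow> bool" where
  "bilinear_form scale b \<longleftrightarrow>
     (\<forall>x. Vector_Spaces.linear scale (*) (\<lambda>y. b x y)) \<and>
     (\<forall>y. Vector_Spaces.linear scale (*) (\<lambda>x. b x y))"

definition symmetric_form :: "('v \<Rightarrow> 'v \<Rightarrow> 'a) \<Rightarrow> bool" where
  "symmetric_form b \<longleftrightarrow> (\<forall>x y. b x y = b y x)"

text \<open>Only the left radical is required to vanish; for the symmetric forms considered here it
  equals the right radical.\<close>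

definition nondegenerate_form :: "('v::zero \<Rightarrow> 'v \<Rightarrow> 'a::zero) \<Rightarrow> bool" where
  "nondegenerate_form b \<longleftrightarrow> (\<forall>x. (\<forall>y. b x y = 0) \<longrightarrow> x = 0)"

definition skew_selfadjoint ::
  "('a::field \<Rightarrow> 'v::ab_group_add \<Rightarrow> 'v) \<Rightarrow> ('v \<Rightarrow> 'v \<Rightarrow> 'a) \<Rightarrow> ('v \<Rightarrow> 'v) \<Rightarrow> bool" where
  "skew_selfadjoint scale b u \<longleftrightarrow>
     Vector_Spaces.linear scale scale u \<and> (\<forall>x y. b (u x) y = - b x (u y))"

definition ordered_basis ::
  "('a::field \<Rightarrow> 'v::ab_group_add \<Rightarrow> 'v) \<Rightarrow> 'v list \<Rightarrow> bool" where
  "ordered_basis scale bs \<longleftrightarrow>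
     distinct bs \<and> \<not> module.dependent scale (set bs) \<and> module.span scale (set bs) = UNIV"

text \<open>Column \<open>j\<close> consists of the coordinates of the image of the \<open>j\<close>-th basis vector.\<close>

definition matrix_of_endo ::
  "('a::field \<Rightarrow> 'v::ab_group_add \<Rightarrow> 'v) \<Rightarrow> 'v list \<Rightarrow> ('v \<Rightarrow> 'v) \<Rightarrow> 'a mat" where
  "matrix_of_endo scale bs u =
     mat (length bs) (length bs)
       (\<lambda>(i, j). module.representation scale (set bs) (u (bs ! j)) (bs ! i))"

text \<open>The list \<open>cs\<close> enumerates the Jordan cells of \<open>u\<close>, a pair \<open>(k, l)\<close> standing for a cell of
  size \<open>k\<close> for the eigenvalue \<open>l\<close>.\<close>

definition jordan_cells ::
  "('a::field \<Rightarrow> 'v::ab_group_add \<Rightarrow> 'v) \<Rightarrow> ('v \<Rightarrow> 'v) \<Rightarrow> (nat \<times> 'a) list \<Rightarrow> bool" where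
  "jordan_cells scale u cs \<longleftrightarrow>
     (\<exists>bs. ordered_basis scale bs \<and> jordan_nf (matrix_of_endo scale bs u) cs)"

text \<open>The choice of \<open>cs\<close> is immaterial: the Jordan normal form is unique up to the order of the
  cells, and it exists for endomorphisms of finite-dimensional spaces over algebraically closed
  fields.\<close>

definition jordan_number ::
  "('a::field \<Rightarrow> 'v::ab_group_add \<Rightarrow> 'v) \<Rightarrow> ('v \<Rightarrow> 'v) \<Rightarrow> 'a \<Rightarrow> nat \<Rightarrow> nat" where
  "jordan_number scale u l k = count_list (SOME cs. jordan_cells scale u cs) (k, l)"

end

theory Submission
  imports Defs
    "Jordan_Normal_Form.Jordan_Normal_Form_Existence"
    "Jordan_Normal_Form.Jordan_Normal_Form_Uniqueness"
begin

text \<open>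
  Write \<open>b\<close> for the form and let \<open>N l k\<close> be the number of cells of size \<open>k\<close> for the eigenvalue \<open>l\<close>.

  \<^bold>\<open>Necessity.\<close> If \<open>u = a\<^sub>1 + a\<^sub>2\<close> with skew square-zero summands, then \<open>u\<^sup>2 = a\<^sub>1 a\<^sub>2 + a\<^sub>2 a\<^sub>1\<close> commutes with
  both summands, and everything becomes a count of dimensions modulo 2: a skew endomorphism \<open>f\<close> has
  even rank, because \<open>b (f x) y\<close> is an alternating form (\<open>even_rank_skew\<close>). For \<open>l \<noteq> 0\<close> the kernel \<open>W\<close> of
  \<open>(u\<^sup>2 - l\<^sup>2)\<^sup>k\<close> is the direct sum of its intersections with the images of \<open>a\<^sub>1\<close> and \<open>a\<^sub>2\<close>; these have even
  dimension and are exchanged by \<open>u\<close>, so 4 divides \<open>dim W\<close>, which is twice the dimension of the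
  kernel of \<open>(u - l)\<^sup>k\<close> (\<open>even_kernel_dim_power\<close>). For the eigenvalue 0 the core is
  \<open>odd_dim_common_kernel\<close>: on a nondegenerate space of odd dimension the common kernel of the two
  summands is not totally isotropic. Applied to the image of \<open>u\<^sup>2\<^sup>k\<close> with the form induced by
  \<open>b (x, u\<^sup>2\<^sup>k y)\<close>, it gives a vector of \<open>ker u\<close> that lies in the image of \<open>u\<^sup>2\<^sup>k\<close> but not in the image
  of the next power, hence a cell of size \<open>2 k + 1\<close>.

  \<^bold>\<open>Sufficiency.\<close> Under the two conditions the cells fall into four kinds of groups: four cells of one
  size \<open>k\<close>, two for \<open>l\<close> and two for \<open>- l\<close>; two equal cells for 0; two cells of odd sizes \<open>s + 2\<close> and \<open>s\<close> for 0; a single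
  cell of size 1 for 0 (\<open>admissible_decompose\<close>). On each group a form and a decomposition are written down
  in the Jordan basis (\<open>skew_splittable_groups\<close>). Together they yield some nondegenerate symmetric form
  \<open>\<beta>\<close> for which \<open>u\<close> is skew and splits. It is related to \<open>b\<close> by \<open>\<beta> x y = b x (g y)\<close> for an
  invertible \<open>g\<close> that commutes with \<open>u\<close>, and over an algebraically closed field of characteristic
  other than 2 some polynomial \<open>h\<close> in \<open>g\<close> is a square root of \<open>g\<close>; then \<open>\<beta> x y = b (h x) (h y)\<close>, so conjugation
  by \<open>h\<close> carries the summands over to \<open>b\<close> (\<open>transport_skew\<close>, \<open>split_if_skew_splittable\<close>).
\<close>

section \<open>Orthogonals and ranks on subspaces\<close>

context finite_dimensional_vector_space
begin

interpretation endo: finite_dimensional_vector_space_pair scale Basis scale Basis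
  by unfold_locales

abbreviation endomorphism :: "('b \<Rightarrow> 'b) \<Rightarrow> bool" where
  "endomorphism \<equiv> Vector_Spaces.linear scale scale"

lemma endomorphism_iff:
  "endomorphism f \<longleftrightarrow> (\<forall>x y. f (x + y) = f x + f y) \<and> (\<forall>c x. f (scale c x) = scale c (f x))"
  using vector_space_axioms by (simp add: Vector_Spaces.linear_iff)

lemma endomorphism_compose: "endomorphism f \<Longrightarrow> endomorphism g \<Longrightarrow> endomorphism (\<lambda>x. f (g x))"
  by (simp add: endomorphism_iff)

lemma endomorphism_funpow: "endomorphism f \<Longrightarrow> endomorphism (f ^^ k)"
  by (induction k) (simp_all add: endomorphism_iff)

lemma endomorphism_shift: "endomorphism f \<Longrightarrow> endomorphism (\<lambda>x. f x - scale c x)"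
  by (simp add: endomorphism_iff scale_right_distrib scale_right_diff_distrib mult.commute)

lemma subspace_kernel_on:
  assumes "subspace U" "endomorphism f"
  shows "subspace {x \<in> U. f x = 0}"
  using assms endo.linear_0[OF assms(2)]
  by (auto simp: subspace_def endomorphism_iff)

lemma subspace_image: "subspace U \<Longrightarrow> endomorphism f \<Longrightarrow> subspace (f ` U)"
  by (rule endo.linear_subspace_image)

text \<open>A linear section of \<open>f\<close> over \<open>f ` U\<close> splits \<open>U\<close> into the kernel and a copy of the image.\<close>

lemma rank_nullity_on:
  assumes U: "subspace U" and f: "endomorphism f"
  shows "dim {x \<in> U. f x = 0} + dim (f ` U) = dim U"
proof -
  obtain g where "g ` UNIV \<subseteq> U \<and> endomorphism g \<and> (\<forall>v\<in>f ` U. f (g v) = v)"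
    using endo.linear_exists_right_inverse_on[OF f U] by (elim exE) (rule that)
  then have g: "g ` UNIV \<subseteq> U" "endomorphism g" "\<And>v. v \<in> f ` U \<Longrightarrow> f (g v) = v"
    by auto
  let ?K = "{x \<in> U. f x = 0}" and ?C = "g ` f ` U"
  have sK: "subspace ?K" by (rule subspace_kernel_on[OF U f])
  have sI: "subspace (f ` U)" by (rule subspace_image[OF U f])
  have sC: "subspace ?C" by (rule subspace_image[OF sI g(2)])
  have inj: "inj_on g (span (f ` U))"
    using g(3) by (metis inj_onI span_eq_iff sI)
  have dC: "dim ?C = dim (f ` U)"
    by (rule endo.dim_image_eq[OF g(2) inj])
  have int: "?K \<inter> ?C = {0}"
  proof -
    have "x = 0" if "x \<in> ?K" "x \<in> ?C" for x
      using that g(3) endo.linear_0[OF g(2)] by auto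
    moreover have "0 \<in> ?K" "0 \<in> ?C"
      using subspace_0[OF sK] subspace_0[OF sC] by auto
    ultimately show ?thesis by blast
  qed
  have sum: "{x + y |x y. x \<in> ?K \<and> y \<in> ?C} = U"
  proof (intro equalityI subsetI)
    fix x assume "x \<in> {x + y |x y. x \<in> ?K \<and> y \<in> ?C}"
    then show "x \<in> U" using subspace_add[OF U] g(1) by (auto simp: image_subset_iff)
  next
    fix x assume x: "x \<in> U"
    then have "g (f x) \<in> U" "f (g (f x)) = f x" using g by auto
    then have "x - g (f x) \<in> ?K" "g (f x) \<in> ?C"
      using x subspace_diff[OF U] endo.linear_diff[OF f] by auto
    then show "x \<in> {x + y |x y. x \<in> ?K \<and> y \<in> ?C}"
      by (metis (mono_tags, lifting) diff_add_cancel mem_Collect_eq)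
  qed
  show ?thesis
    using dim_sums_Int[OF sK sC] unfolding int sum dC by simp
qed

text \<open>Functionals appear here as partial applications of bilinear forms, so linearity is asked for
  pointwise. A vector on which the functional does not vanish spans a complement.\<close>

lemma dim_hyperplane_on:
  assumes U: "subspace U"
    and add: "\<And>x y. f (x + y) = f x + f y" and sc: "\<And>c x. f (scale c x) = c * f x"
    and w: "w \<in> U" "f w \<noteq> 0"
  shows "dim {x \<in> U. f x = 0} + 1 = dim U"
proof -
  let ?H = "{x \<in> U. f x = 0}"
  have f0: "f 0 = 0" using sc[of 0 0] by simp
  have sH: "subspace ?H"
    using U by (auto simp: subspace_def add sc f0)
  have sS: "subspace (span {w})" by simp
  have int: "?H \<inter> span {w} = {0}"
    using w f0 subspace_0[OF U] by (auto simp: span_singleton sc)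
  have sum: "{x + y |x y. x \<in> ?H \<and> y \<in> span {w}} = U"
  proof (intro equalityI subsetI)
    fix x assume "x \<in> {x + y |x y. x \<in> ?H \<and> y \<in> span {w}}"
    then show "x \<in> U" using subspace_add[OF U] subspace_scale[OF U] w(1) by (auto simp: span_singleton)
  next
    fix x assume x: "x \<in> U"
    let ?y = "scale (f x / f w) w"
    have "f (x - ?y) + f ?y = f x" using add[of "x - ?y" ?y] by simp
    then have "f (x - ?y) = 0" using w(2) by (simp add: sc)
    then have "x - ?y \<in> ?H" "?y \<in> span {w}"
      using x subspace_diff[OF U] subspace_scale[OF U] w(1) by (auto simp: span_singleton)
    then show "x \<in> {x + y |x y. x \<in> ?H \<and> y \<in> span {w}}"
      by (metis (mono_tags, lifting) diff_add_cancel mem_Collect_eq)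
  qed
  have "w \<noteq> 0" using w(2) f0 by auto
  then show ?thesis
    using dim_sums_Int[OF sH sS] unfolding int sum by simp
qed

lemma bilinear_form_iff:
  "bilinear_form scale \<beta> \<longleftrightarrow> (\<forall>x y z. \<beta> (x + y) z = \<beta> x z + \<beta> y z) \<and> (\<forall>c x z. \<beta> (scale c x) z = c * \<beta> x z)
     \<and> (\<forall>x y z. \<beta> z (x + y) = \<beta> z x + \<beta> z y) \<and> (\<forall>c x z. \<beta> z (scale c x) = c * \<beta> z x)"
proof -
  have "vector_space ((*) :: 'a \<Rightarrow> 'a \<Rightarrow> 'a)"
    by unfold_locales (simp_all add: algebra_simps)
  then show ?thesis
    unfolding bilinear_form_def Vector_Spaces.linear_iff using vector_space_axioms by auto
qed

lemma bilinear_formD: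
  assumes "bilinear_form scale \<beta>"
  shows "\<beta> (x + y) z = \<beta> x z + \<beta> y z" "\<beta> (scale c x) z = c * \<beta> x z"
    "\<beta> z (x + y) = \<beta> z x + \<beta> z y" "\<beta> z (scale c x) = c * \<beta> z x"
    "\<beta> 0 z = 0" "\<beta> z 0 = 0" "\<beta> (- x) z = - \<beta> x z" "\<beta> z (- x) = - \<beta> z x"
    "\<beta> (x - y) z = \<beta> x z - \<beta> y z" "\<beta> z (x - y) = \<beta> z x - \<beta> z y"
proof -
  show *: "\<beta> (x + y) z = \<beta> x z + \<beta> y z" "\<beta> (scale c x) z = c * \<beta> x z"
    "\<beta> z (x + y) = \<beta> z x + \<beta> z y" "\<beta> z (scale c x) = c * \<beta> z x" for x y z c
    using assms by (simp_all add: bilinear_form_iff)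
  show "\<beta> 0 z = 0" "\<beta> z 0 = 0" using *(2)[of 0 0 z] *(4)[of z 0 0] by simp_all
  show **: "\<beta> (- x) z = - \<beta> x z" "\<beta> z (- x) = - \<beta> z x" for x z
    using *(2)[of "-1" x z] *(4)[of z "-1" x] by simp_all
  show "\<beta> (x - y) z = \<beta> x z - \<beta> y z" "\<beta> z (x - y) = \<beta> z x - \<beta> z y"
    using *(1)[of x "-y" z] *(3)[of z x "-y"] ** by simp_all
qed

text \<open>Forms are studied on a subspace of the ambient space because the induced form on the image of
  \<open>u\<^sup>2\<^sup>k\<close> has no useful meaning outside this image.\<close>

definition perp :: "('b \<Rightarrow> 'b \<Rightarrow> 'a) \<Rightarrow> 'b set \<Rightarrow> 'b set \<Rightarrow> 'b set" where
  "perp \<beta> U T = {x \<in> U. \<forall>y\<in>T. \<beta> x y = 0}"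

definition nondegenerate_on :: "('b \<Rightarrow> 'b \<Rightarrow> 'a) \<Rightarrow> 'b set \<Rightarrow> bool" where
  "nondegenerate_on \<beta> U \<longleftrightarrow> perp \<beta> U U \<subseteq> {0}"

lemma subspace_perp: "bilinear_form scale \<beta> \<Longrightarrow> subspace U \<Longrightarrow> subspace (perp \<beta> U T)"
  unfolding subspace_def perp_def by (auto simp: bilinear_formD)

lemma perp_span: 
  assumes "bilinear_form scale \<beta>" shows "perp \<beta> U (span T) = perp \<beta> U T"
proof -
  have "\<beta> x y = 0" if x: "\<forall>y\<in>T. \<beta> x y = 0" and y: "y \<in> span T" for x y
    using y by (induction rule: span_induct_alt) (auto simp: bilinear_formD[OF assms] x)
  then show ?thesis unfolding perp_def using span_superset by blast
qed

text \<open>Each further vector of \<open>C\<close> cuts out at most a hyperplane.\<close>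

lemma dim_perp_finite_ge:
  assumes \<beta>: "bilinear_form scale \<beta>" and U: "subspace U" and C: "finite C"
  shows "dim U \<le> dim (perp \<beta> U C) + card C"
  using C
proof (induction C)
  case empty
  then show ?case by (simp add: perp_def)
next
  case (insert c C)
  have s: "subspace (perp \<beta> U C)" by (rule subspace_perp[OF \<beta> U])
  have eq: "perp \<beta> U (insert c C) = {x \<in> perp \<beta> U C. \<beta> x c = 0}"
    by (auto simp: perp_def)
  have "dim (perp \<beta> U C) \<le> dim (perp \<beta> U (insert c C)) + 1"
  proof (cases "\<exists>w\<in>perp \<beta> U C. \<beta> w c \<noteq> 0")
    case True
    then obtain w where "w \<in> perp \<beta> U C" "\<beta> w c \<noteq> 0" by blast
    from dim_hyperplane_on[of _ "\<lambda>x. \<beta> x c", OF s _ _ this] show ?thesis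
      unfolding eq by (simp add: bilinear_formD[OF \<beta>])
  next
    case False
    then have "perp \<beta> U (insert c C) = perp \<beta> U C" unfolding eq by auto
    then show ?thesis by simp
  qed
  then show ?case using insert by simp
qed

text \<open>Extend a basis of \<open>T\<close> to a basis of \<open>U\<close>. Going through the whole basis, the orthogonals decrease from
  \<open>U\<close> to 0 in \<open>dim U\<close> steps, each of which lowers the dimension by at most one; hence each lowers it by
  exactly one.\<close>

lemma dim_perp:
  assumes \<beta>: "bilinear_form scale \<beta>" and nd: "nondegenerate_on \<beta> U" and U: "subspace U"
    and T: "subspace T" "T \<subseteq> U"
  shows "dim (perp \<beta> U T) + dim T = dim U"
proof -
  obtain B where B: "B \<subseteq> T" "independent B" "T \<subseteq> span B" "card B = dim T"
    using basis_exists by blast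
  then obtain D where D: "B \<subseteq> D" "D \<subseteq> U" "independent D" "U \<subseteq> span D"
    using maximal_independent_subset_extend[of B U] T(2) by (metis subset_trans)
  have fin: "finite D" using finiteI_independent D by blast
  have cD: "card D = dim U" using D by (simp add: basis_card_eq_dim)
  have TB: "span B = T" using B T by (metis span_subspace)
  have UD: "span D = U" using D U by (metis span_subspace)
  have pT: "perp \<beta> U T = perp \<beta> U B" using perp_span[OF \<beta>, of U B] TB by simp
  have "perp \<beta> (perp \<beta> U B) (D - B) \<subseteq> perp \<beta> U D"
    using D(1) by (auto simp: perp_def)
  also have "\<dots> = perp \<beta> U U" using perp_span[OF \<beta>, of U D] UD by simp
  also have "\<dots> \<subseteq> {0}" using nd by (simp add: nondegenerate_on_def)
  finally have "dim (perp \<beta> (perp \<beta> U B) (D - B)) = 0" by simp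
  then have "dim (perp \<beta> U B) \<le> card (D - B)"
    using dim_perp_finite_ge[OF \<beta> subspace_perp[OF \<beta> U], of "D - B" B] fin by (metis add_0 finite_Diff)
  also have "\<dots> = dim U - dim T"
    using card_Diff_subset[of B D] finite_subset[OF D(1) fin] D(1) cD B(4) by simp
  finally have 1: "dim (perp \<beta> U B) \<le> dim U - dim T" .
  have 2: "dim U \<le> dim (perp \<beta> U B) + dim T"
    using dim_perp_finite_ge[OF \<beta> U, of B] B(4) finite_subset[OF D(1) fin] by simp
  have "dim T \<le> dim U" using T(2) by (rule dim_subset)
  then show ?thesis using 1 2 pT by simp
qed

text \<open>If \<open>\<gamma> x y \<noteq> 0\<close>, then the orthogonal of \<open>{x, y}\<close> in \<open>U\<close> has codimension 2 and the same radical as \<open>U\<close>,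
  so splitting off such planes proves the claim by induction.\<close>

lemma even_rank_alternating:
  assumes \<gamma>: "bilinear_form scale \<gamma>" and alt: "\<And>x. x \<in> U \<Longrightarrow> \<gamma> x x = 0" and U: "subspace U"
  shows "even (dim U - dim (perp \<gamma> U U))"
  using alt U
proof (induction "dim U" arbitrary: U rule: less_induct)
  case less
  have skew: "\<gamma> y x = - \<gamma> x y" if "x \<in> U" "y \<in> U" for x y
  proof -
    have "\<gamma> (x + y) (x + y) = 0" using less(2) subspace_add[OF less(3)] that by blast
    then show ?thesis using less(2) that
      by (simp add: bilinear_formD[OF \<gamma>] add_eq_0_iff2) 
  qed
  show ?case
  proof (cases "\<exists>x\<in>U. \<exists>y\<in>U. \<gamma> x y \<noteq> 0")
    case False
    then have "perp \<gamma> U U = U" by (auto simp: perp_def)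
    then show ?thesis by simp
  next
    case True
    then obtain x y where xy: "x \<in> U" "y \<in> U" "\<gamma> x y \<noteq> 0" by blast
    have yx: "\<gamma> y x = - \<gamma> x y" using skew xy by blast
    let ?A = "{w \<in> U. \<gamma> w x = 0}" and ?W = "perp \<gamma> U {x, y}"
    have W: "?W = {w \<in> ?A. \<gamma> w y = 0}" by (auto simp: perp_def)
    have sA: "subspace ?A" using subspace_perp[OF \<gamma> less(3), of "{x}"] by (simp add: perp_def)
    have sW: "subspace ?W" by (rule subspace_perp[OF \<gamma> less(3)])
    have "dim ?A + 1 = dim U"
      by (rule dim_hyperplane_on[of _ "\<lambda>w. \<gamma> w x" y]) (use less(3) xy yx in \<open>auto simp: bilinear_formD[OF \<gamma>]\<close>)
    moreover have "dim ?W + 1 = dim ?A" unfolding W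
      by (rule dim_hyperplane_on[of _ "\<lambda>w. \<gamma> w y" x])
         (use sA xy less(2) in \<open>auto simp: bilinear_formD[OF \<gamma>]\<close>)
    ultimately have dW: "dim ?W + 2 = dim U" by simp
    have "perp \<gamma> ?W ?W = perp \<gamma> U U"
    proof (intro equalityI subsetI)
      fix w assume "w \<in> perp \<gamma> U U"
      then show "w \<in> perp \<gamma> ?W ?W" using xy by (auto simp: perp_def)
    next
      fix w assume w: "w \<in> perp \<gamma> ?W ?W"
      have wU: "w \<in> U" and wx: "\<gamma> w x = 0" and wy: "\<gamma> w y = 0" using w by (auto simp: perp_def)
      have "\<gamma> w v = 0" if v: "v \<in> U" for v
      proof -
        \<comment> \<open>the component of \<open>v\<close> orthogonal to \<open>x\<close> and \<open>y\<close>\<close>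
        define v' where "v' = v - scale (\<gamma> v y / \<gamma> x y) x - scale (\<gamma> v x / \<gamma> y x) y"
        have "v' \<in> U" unfolding v'_def
          using v xy subspace_diff[OF less(3)] subspace_scale[OF less(3)] by blast
        moreover have "\<gamma> v' x = 0" "\<gamma> v' y = 0" unfolding v'_def
          using less(2) xy yx by (simp_all add: bilinear_formD[OF \<gamma>])
        ultimately have "v' \<in> ?W" by (simp add: perp_def)
        then have "\<gamma> w v' = 0" using w by (simp add: perp_def)
        then show ?thesis unfolding v'_def by (simp add: bilinear_formD[OF \<gamma>] wx wy)
      qed
      then show "w \<in> perp \<gamma> U U" using wU by (simp add: perp_def)
    qed
    moreover have "even (dim ?W - dim (perp \<gamma> ?W ?W))"
      using less(1)[of ?W] dW sW less(2) by (auto simp: perp_def)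
    moreover have "dim (perp \<gamma> ?W ?W) \<le> dim ?W"
      by (rule dim_subset) (auto simp: perp_def)
    ultimately show ?thesis using dW
      by (metis (no_types, lifting) Nat.add_diff_assoc2 even_add even_numeral)
  qed
qed

text \<open>The form \<open>\<beta> (f x) y\<close> is alternating and its radical is the kernel of \<open>f\<close>.\<close>

lemma even_rank_skew:
  assumes \<beta>: "bilinear_form scale \<beta>" and nd: "nondegenerate_on \<beta> U" and U: "subspace U"
    and f: "endomorphism f" "f ` U \<subseteq> U"
    and skew: "\<And>x y. x \<in> U \<Longrightarrow> y \<in> U \<Longrightarrow> \<beta> (f x) y = - \<beta> x (f y)"
    and sym: "\<And>x y. x \<in> U \<Longrightarrow> y \<in> U \<Longrightarrow> \<beta> x y = \<beta> y x"
    and char2: "(2 :: 'a) \<noteq> 0"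
  shows "even (dim (f ` U))"
proof -
  have fl: "f (x + y) = f x + f y" "f (scale c x) = scale c (f x)" for x y c
    using f(1) by (simp_all add: endomorphism_iff)
  have \<gamma>: "bilinear_form scale (\<lambda>x y. \<beta> (f x) y)"
    using \<beta> unfolding bilinear_form_iff by (simp add: fl)
  have alt: "\<beta> (f x) x = 0" if x: "x \<in> U" for x
  proof -
    have "\<beta> (f x) x = - \<beta> (f x) x" using skew[OF x x] sym[of x "f x"] x f(2) by auto
    then have "2 * \<beta> (f x) x = 0" by (metis add.right_inverse mult_2)
    then show ?thesis using char2 by simp
  qed
  have "perp (\<lambda>x y. \<beta> (f x) y) U U = {x \<in> U. f x = 0}"
  proof -
    have "f x = 0" if "x \<in> U" "\<forall>y\<in>U. \<beta> (f x) y = 0" for x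
      using that nd f(2) unfolding nondegenerate_on_def perp_def by auto
    then show ?thesis by (auto simp: perp_def bilinear_formD[OF \<beta>])
  qed
  then have "even (dim U - dim {x \<in> U. f x = 0})"
    using even_rank_alternating[OF \<gamma> alt U] by simp
  moreover have "dim U - dim {x \<in> U. f x = 0} = dim (f ` U)"
    using rank_nullity_on[OF U f(1)] by simp
  ultimately show ?thesis by simp
qed

end

section \<open>Adjoint kernels and generalized eigenspaces\<close>

lemma funpow_commute:
  assumes "\<And>x. f (g x) = g (f x)"
  shows "(f ^^ k) (g x) = g ((f ^^ k) x)"
  by (induction k) (simp_all add: assms)

lemma funpow_comp_commute:
  assumes "\<And>x. f (g x) = g (f x)"
  shows "((\<lambda>x. f (g x)) ^^ k) x = (f ^^ k) ((g ^^ k) x)"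
  by (induction k) (simp_all add: funpow_commute[of f g, OF assms])

context finite_dimensional_vector_space
begin

interpretation endo: finite_dimensional_vector_space_pair scale Basis scale Basis
  by unfold_locales

definition kernel_dim_power :: "('b \<Rightarrow> 'b) \<Rightarrow> 'a \<Rightarrow> nat \<Rightarrow> nat" where
  "kernel_dim_power u l k = dim {x. ((\<lambda>x. u x - scale l x) ^^ k) x = 0}"

lemma rank_nullity:
  assumes "endomorphism f"
  shows "dim {x. f x = 0} + dim (range f) = dimension"
  using rank_nullity_on[OF subspace_UNIV assms] by (simp add: dim_UNIV dimension_def)

lemma subspace_kernel: "endomorphism f \<Longrightarrow> subspace {x. f x = 0}"
  using subspace_kernel_on[OF subspace_UNIV] by simp

text \<open>The kernel of \<open>g\<close> is the orthogonal of the image of \<open>f\<close>. The factor \<open>c\<close> absorbs the signs that arise from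
  powers of skew maps.\<close>

lemma dim_kernel_adjoint:
  assumes b: "bilinear_form scale b" "nondegenerate_on b UNIV" "\<And>x y. b x y = b y x"
    and f: "endomorphism f" and g: "endomorphism g"
    and adj: "\<And>x y. b (f x) y = c * b x (g y)" and c: "c \<noteq> 0"
  shows "dim {x. f x = 0} = dim {x. g x = 0}"
proof -
  have "perp b UNIV (range f) = {x. g x = 0}"
  proof -
    have "g x = 0" if "\<forall>y. b x (f y) = 0" for x
    proof -
      have "b (g x) y = 0" for y
        using that adj[of y x] b(3)[of x "f y"] b(3)[of y "g x"] c by simp
      then show ?thesis using b(2) by (auto simp: nondegenerate_on_def perp_def)
    qed
    moreover have "b x (f y) = 0" if "g x = 0" for x y
      using adj[of y x] b(3)[of x "f y"] that by (simp add: bilinear_formD[OF b(1)])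
    ultimately show ?thesis by (auto simp: perp_def)
  qed
  then have "dim {x. g x = 0} + dim (range f) = dim (UNIV :: 'b set)"
    using dim_perp[OF b(1,2) subspace_UNIV endo.linear_subspace_image[OF f subspace_UNIV]] by simp
  then show ?thesis using rank_nullity[OF f] by (simp add: dimension_def)
qed

lemma skew_funpow:
  fixes b :: "'b \<Rightarrow> 'b \<Rightarrow> 'a"
  assumes "\<And>x y. b (f x) y = c * b x (g y)"
  shows "b ((f ^^ k) x) y = c ^ k * b x ((g ^^ k) y)"
  by (induction k arbitrary: x y) (simp_all add: assms funpow_swap1[of g] mult.assoc)

text \<open>Up to sign, \<open>(u - l)\<^sup>k\<close> and \<open>(u + l)\<^sup>k\<close> are adjoint.\<close>

lemma kernel_dim_power_uminus:
  assumes b: "bilinear_form scale b" "nondegenerate_on b UNIV" "\<And>x y. b x y = b y x"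
    and u: "endomorphism u" and skew: "\<And>x y. b (u x) y = - b x (u y)"
  shows "kernel_dim_power u l k = kernel_dim_power u (- l) k"
  unfolding kernel_dim_power_def
proof (rule dim_kernel_adjoint[OF b])
  show "endomorphism ((\<lambda>x. u x - scale l x) ^^ k)" "endomorphism ((\<lambda>x. u x - scale (- l) x) ^^ k)"
    by (intro endomorphism_funpow endomorphism_shift u)+
  show "b (((\<lambda>x. u x - scale l x) ^^ k) x) y = (- 1) ^ k * b x (((\<lambda>x. u x - scale (- l) x) ^^ k) y)" for x y
    by (rule skew_funpow) (simp add: bilinear_formD[OF b(1)] skew)
qed simp

lemma even_rank_odd_power:
  assumes b: "bilinear_form scale b" "nondegenerate_on b UNIV" "\<And>x y. b x y = b y x"
    and u: "endomorphism u" and skew: "\<And>x y. b (u x) y = - b x (u y)"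
    and char2: "(2 :: 'a) \<noteq> 0" and k: "odd k"
  shows "even (dim (range (u ^^ k)))"
proof (rule even_rank_skew[OF b(1,2) subspace_UNIV endomorphism_funpow[OF u]])
  show "b ((u ^^ k) x) y = - b x ((u ^^ k) y)" for x y
    using skew_funpow[of b u "-1" u k x y] skew k by simp
qed (use b char2 in auto)

text \<open>Sylvester's inequality: \<open>g\<close> maps the kernel of the composition into the kernel of \<open>f\<close>.\<close>

lemma dim_kernel_comp_le:
  assumes f: "endomorphism f" and g: "endomorphism g"
  shows "dim {x. f (g x) = 0} \<le> dim {x. f x = 0} + dim {x. g x = 0}"
proof -
  let ?W = "{x. f (g x) = 0}"
  have s: "subspace ?W" by (rule subspace_kernel[OF endomorphism_compose[OF f g]])
  have "dim {x \<in> ?W. g x = 0} + dim (g ` ?W) = dim ?W"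
    by (rule rank_nullity_on[OF s g])
  moreover have "dim (g ` ?W) \<le> dim {x. f x = 0}"
    by (rule dim_subset) auto
  moreover have "dim {x \<in> ?W. g x = 0} \<le> dim {x. g x = 0}"
    by (rule dim_subset) auto
  ultimately show ?thesis by linarith
qed

text \<open>By induction \<open>u x = l x\<close>, and then \<open>(u - m)\<^sup>j\<close> multiplies \<open>x\<close> by \<open>(l - m)\<^sup>j\<close>.\<close>

lemma generalized_eigenspaces_disjoint:
  assumes u: "endomorphism u" and lm: "l \<noteq> m"
    and x: "((\<lambda>x. u x - scale l x) ^^ k) x = 0" "((\<lambda>x. u x - scale m x) ^^ j) x = 0"
  shows "x = 0"
  using x
proof (induction k arbitrary: x)
  case 0
  then show ?case by simp
next
  case (Suc k)
  have ul: "u (y + z) = u y + u z" "u (scale c y) = scale c (u y)" "u (y - z) = u y - u z" for y z c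
    using u endo.linear_diff[OF u] by (simp_all add: endomorphism_iff)
  let ?y = "u x - scale l x"
  have "((\<lambda>x. u x - scale m x) ^^ j) ?y = u (((\<lambda>x. u x - scale m x) ^^ j) x) - scale l (((\<lambda>x. u x - scale m x) ^^ j) x)"
    by (rule funpow_commute[where g = "\<lambda>x. u x - scale l x"])
       (simp add: ul scale_right_diff_distrib mult.commute algebra_simps)
  also have "\<dots> = 0" using Suc.prems(2) endo.linear_0[OF u] by simp
  finally have 1: "((\<lambda>x. u x - scale m x) ^^ j) ?y = 0" .
  have 2: "((\<lambda>x. u x - scale l x) ^^ k) ?y = 0"
    using Suc.prems(1) by (simp only: funpow_Suc_right o_apply)
  have "?y = 0" by (rule Suc.IH[OF 2 1])
  then have ux: "u x = scale l x" by simp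
  have "((\<lambda>x. u x - scale m x) ^^ j) x = scale ((l - m) ^ j) x" for j
    by (induction j) (simp_all add: ul ux algebra_simps)
  then have "scale ((l - m) ^ j) x = 0" using Suc.prems(2) by simp
  then show ?case using lm by simp
qed

text \<open>From the factorization \<open>u\<^sup>2 - l\<^sup>2 = (u - l) (u + l)\<close>: the two kernels on the right are independent, which
  bounds the dimension on the left from below, and Sylvester's inequality bounds it from above.\<close>

lemma dim_kernel_square_shift:
  assumes u: "endomorphism u" and l: "l \<noteq> - l"
  shows "kernel_dim_power (\<lambda>x. u (u x)) (l * l) k = kernel_dim_power u l k + kernel_dim_power u (- l) k"
proof -
  have ul: "u (y + z) = u y + u z" "u (scale c y) = scale c (u y)" "u (y - z) = u y - u z" for y z c
    using u endo.linear_diff[OF u] by (simp_all add: endomorphism_iff)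
  let ?p = "\<lambda>x. u x - scale l x" and ?q = "\<lambda>x. u x - scale (- l) x"
  have comm: "?p (?q x) = ?q (?p x)" for x
    by (simp add: ul scale_right_distrib scale_right_diff_distrib algebra_simps)
  have "(\<lambda>x. u (u x) - scale (l * l) x) = (\<lambda>x. ?p (?q x))"
    by (simp add: ul scale_right_distrib scale_right_diff_distrib algebra_simps)
  then have fac: "((\<lambda>x. u (u x) - scale (l * l) x) ^^ k) x = (?p ^^ k) ((?q ^^ k) x)" for x
    using funpow_comp_commute[of ?p ?q k x, OF comm] by simp
  have fac': "(?p ^^ k) ((?q ^^ k) x) = (?q ^^ k) ((?p ^^ k) x)" for x
    using funpow_comp_commute[of ?p ?q k x, OF comm] funpow_comp_commute[of ?q ?p k x, OF comm[symmetric]] comm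
    by (simp add: fun_eq_iff)
  have ep: "endomorphism (?p ^^ k)" and eq: "endomorphism (?q ^^ k)"
    by (intro endomorphism_funpow endomorphism_shift u)+
  let ?P = "{x. (?p ^^ k) x = 0}" and ?Q = "{x. (?q ^^ k) x = 0}" and ?W = "{x. (?p ^^ k) ((?q ^^ k) x) = 0}"
  have sP: "subspace ?P" and sQ: "subspace ?Q" by (rule subspace_kernel[OF ep], rule subspace_kernel[OF eq])
  have sW: "subspace ?W" by (rule subspace_kernel[OF endomorphism_compose[OF ep eq]])
  have "?P \<inter> ?Q = {0}"
    using generalized_eigenspaces_disjoint[OF u l] subspace_0[OF sP] subspace_0[OF sQ] by blast
  then have eq1: "dim {x + y |x y. x \<in> ?P \<and> y \<in> ?Q} = dim ?P + dim ?Q"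
    using dim_sums_Int[OF sP sQ] by simp
  have sub: "{x + y |x y. x \<in> ?P \<and> y \<in> ?Q} \<subseteq> ?W"
  proof -
    have "?Q \<subseteq> ?W" using endo.linear_0[OF ep] by auto
    moreover have "?P \<subseteq> ?W" unfolding fac' using endo.linear_0[OF eq] by auto
    ultimately show ?thesis using subspace_add[OF sW] by blast
  qed
  from sub have "dim ?P + dim ?Q \<le> dim ?W"
    using dim_subset[OF sub] eq1 by simp
  moreover have "dim ?W \<le> dim ?P + dim ?Q" by (rule dim_kernel_comp_le[OF ep eq])
  ultimately have "dim ?W = dim ?P + dim ?Q" by linarith
  moreover have "kernel_dim_power (\<lambda>x. u (u x)) (l * l) k = dim ?W"
    unfolding kernel_dim_power_def by (simp only: fac)
  ultimately show ?thesis unfolding kernel_dim_power_def by (simp only:)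
qed

end

section \<open>Parity constraints on sums of two square-zero skew maps\<close>

locale square_zero_sum = finite_dimensional_vector_space scale Basis
  for scale :: "'a::field \<Rightarrow> 'v::ab_group_add \<Rightarrow> 'v" and Basis +
  fixes b :: "'v \<Rightarrow> 'v \<Rightarrow> 'a" and u a\<^sub>1 a\<^sub>2 :: "'v \<Rightarrow> 'v"
  assumes b: "bilinear_form scale b" "nondegenerate_on b UNIV" "b x y = b y x"
    and char2: "(2 :: 'a) \<noteq> 0"
    and endo: "endomorphism a\<^sub>1" "endomorphism a\<^sub>2"
    and skew: "b (a\<^sub>1 x) y = - b x (a\<^sub>1 y)" "b (a\<^sub>2 x) y = - b x (a\<^sub>2 y)"
    and square_zero: "a\<^sub>1 (a\<^sub>1 x) = 0" "a\<^sub>2 (a\<^sub>2 x) = 0"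
    and sum: "u x = a\<^sub>1 x + a\<^sub>2 x"
begin

interpretation endo: finite_dimensional_vector_space_pair scale Basis scale Basis
  by unfold_locales

lemma summands_linear: "a\<^sub>1 (x + y) = a\<^sub>1 x + a\<^sub>1 y" "a\<^sub>1 (scale c x) = scale c (a\<^sub>1 x)"  "a\<^sub>1 (x - y) = a\<^sub>1 x - a\<^sub>1 y"
  "a\<^sub>2 (x + y) = a\<^sub>2 x + a\<^sub>2 y" "a\<^sub>2 (scale c x) = scale c (a\<^sub>2 x)" "a\<^sub>2 (x - y) = a\<^sub>2 x - a\<^sub>2 y" "a\<^sub>1 0 = 0" "a\<^sub>2 0 = 0"
  using endo endo.linear_diff[OF endo(1)] endo.linear_diff[OF endo(2)] endo.linear_0[OF endo(1)] endo.linear_0[OF endo(2)]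
  by (simp_all add: endomorphism_iff)

lemma u_endo: "endomorphism u"
  by (simp add: endomorphism_iff sum summands_linear scale_right_distrib add.assoc add.left_commute)

lemma u_skew: "b (u x) y = - b x (u y)"
  by (simp add: sum bilinear_formD[OF b(1)] skew)

lemma square_eq_anticommutator: "u (u x) = a\<^sub>1 (a\<^sub>2 x) + a\<^sub>2 (a\<^sub>1 x)"
  by (simp add: sum summands_linear square_zero)

lemma square_commute: "a\<^sub>1 (u (u x)) = u (u (a\<^sub>1 x))" "a\<^sub>2 (u (u x)) = u (u (a\<^sub>2 x))"
  by (simp_all add: square_eq_anticommutator summands_linear square_zero)

text \<open>Let \<open>W\<close> be the kernel of \<open>f = (u\<^sup>2 - l\<^sup>2)\<^sup>k\<close>. Since \<open>u\<^sup>2\<close> is bijective on \<open>W\<close>, every element of \<open>W\<close> has the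
  form \<open>a\<^sub>1 a\<^sub>2 y + a\<^sub>2 a\<^sub>1 y\<close>, which makes \<open>W\<close> the direct sum of \<open>S\<^sub>1\<close> and \<open>S\<^sub>2\<close>, its intersections with the
  images of \<open>a\<^sub>1\<close> and \<open>a\<^sub>2\<close>. The map \<open>u\<close> embeds each of them into the other, so they have equal dimension, and this dimension
  is even. Hence 4 divides \<open>dim W\<close>, which is twice the dimension in question because the kernels for \<open>l\<close> and \<open>- l\<close> have
  equal dimension.\<close>

lemma even_kernel_dim_power:
  assumes l: "l \<noteq> 0"
  shows "even (kernel_dim_power u l k)"
proof -
  let ?z = "\<lambda>x. u (u x) - scale (l * l) x"
  define f where "f = ?z ^^ k"
  have ze: "endomorphism ?z" by (rule endomorphism_shift[OF endomorphism_compose[OF u_endo u_endo]])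
  have fe: "endomorphism f" unfolding f_def by (rule endomorphism_funpow[OF ze])
  have fl: "f (x + y) = f x + f y" "f 0 = 0" for x y
    using fe endo.linear_0[OF fe] by (auto simp: endomorphism_iff)
  have fa: "f (a\<^sub>1 x) = a\<^sub>1 (f x)" "f (a\<^sub>2 x) = a\<^sub>2 (f x)" for x
    unfolding f_def by (rule funpow_commute, simp add: square_commute summands_linear)+
  have fu: "f (u x) = u (f x)" for x by (simp add: sum fl fa)
  have fself: "b (f x) y = b x (f y)" for x y
    using skew_funpow[of b ?z 1 ?z k x y] unfolding f_def
    by (simp add: bilinear_formD[OF b(1)] u_skew)
  define W where "W = {x. f x = 0}"
  have sW: "subspace W" unfolding W_def by (rule subspace_kernel[OF fe])
  \<comment> \<open>Both \<open>a\<close> and \<open>f a\<close> are skew, hence of even rank, and the set in question is the kernel of \<open>f\<close> on the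
    image of \<open>a\<close>.\<close>
  have even_part: "even (dim {x \<in> range a. f x = 0})"
    if a: "endomorphism a" "\<And>x y. b (a x) y = - b x (a y)" "\<And>x. f (a x) = a (f x)" for a
  proof -
    have "even (dim (range a))"
      by (rule even_rank_skew[OF b(1,2) subspace_UNIV a(1) _ a(2) b(3) char2]) simp
    moreover have "even (dim (range (\<lambda>x. f (a x))))"
      by (rule even_rank_skew[OF b(1,2) subspace_UNIV endomorphism_compose[OF fe a(1)] _ _ b(3) char2])
         (simp_all only: fself a(2,3) subset_UNIV)
    moreover have "dim {x \<in> range a. f x = 0} + dim (range (\<lambda>x. f (a x))) = dim (range a)"
      using rank_nullity_on[OF endo.linear_subspace_image[OF a(1) subspace_UNIV] fe]
      by (simp add: image_image)
    ultimately show ?thesis by (metis even_add)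
  qed
  define S\<^sub>1 where "S\<^sub>1 = {x \<in> range a\<^sub>1. f x = 0}"
  define S\<^sub>2 where "S\<^sub>2 = {x \<in> range a\<^sub>2. f x = 0}"
  have e1: "even (dim S\<^sub>1)" unfolding S\<^sub>1_def by (rule even_part[OF endo(1) skew(1) fa(1)])
  have s1: "subspace S\<^sub>1" and s2: "subspace S\<^sub>2" unfolding S\<^sub>1_def S\<^sub>2_def
    by (intro subspace_kernel_on endo.linear_subspace_image subspace_UNIV endo fe)+
  have ker0: "x = 0" if "f x = 0" "u (u x) = 0" for x
  proof -
    have "((\<lambda>x. (\<lambda>x. u (u x)) x - scale 0 x) ^^ 1) x = 0" using that by simp
    moreover have "((\<lambda>x. (\<lambda>x. u (u x)) x - scale (l * l) x) ^^ k) x = 0" using that by (simp add: f_def)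
    moreover have "(0::'a) \<noteq> l * l" using l by simp
    ultimately show ?thesis
      using generalized_eigenspaces_disjoint[OF endomorphism_compose[OF u_endo u_endo], of 0 "l * l" 1 x k] by simp
  qed
  have inj: "inj_on (\<lambda>x. u (u x)) W"
  proof (rule inj_onI)
    fix x y assume "x \<in> W" "y \<in> W" "u (u x) = u (u y)"
    then have "f (x - y) = 0" "u (u (x - y)) = 0"
      using endo.linear_diff[OF fe] endo.linear_diff[OF u_endo] by (simp_all add: W_def)
    then show "x = y" using ker0 by fastforce
  qed
  have WW: "(\<lambda>x. u (u x)) ` W = W"
  proof (rule subspace_dim_equal)
    show "subspace ((\<lambda>x. u (u x)) ` W)"
      by (rule subspace_image[OF sW endomorphism_compose[OF u_endo u_endo]])
    show "(\<lambda>x. u (u x)) ` W \<subseteq> W" by (auto simp: W_def fu endo.linear_0[OF u_endo])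
    have "dim ((\<lambda>x. u (u x)) ` W) = dim W"
      using endo.dim_image_eq[OF endomorphism_compose[OF u_endo u_endo], of W] inj
      by (metis sW span_eq_iff)
    then show "dim W \<le> dim ((\<lambda>x. u (u x)) ` W)" by simp
  qed (rule sW)
  have "W = {x + y |x y. x \<in> S\<^sub>1 \<and> y \<in> S\<^sub>2}"
  proof (intro equalityI subsetI)
    fix x assume "x \<in> W"
    then obtain y where y: "y \<in> W" "x = u (u y)" using WW by auto
    then have "a\<^sub>1 (a\<^sub>2 y) \<in> S\<^sub>1" "a\<^sub>2 (a\<^sub>1 y) \<in> S\<^sub>2" by (auto simp: S\<^sub>1_def S\<^sub>2_def W_def fa summands_linear)
    then show "x \<in> {x + y |x y. x \<in> S\<^sub>1 \<and> y \<in> S\<^sub>2}" using y(2) square_eq_anticommutator by blast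
  next
    fix x assume "x \<in> {x + y |x y. x \<in> S\<^sub>1 \<and> y \<in> S\<^sub>2}"
    then obtain p q where "x = p + q" "p \<in> S\<^sub>1" "q \<in> S\<^sub>2" by blast
    then have "f x = 0" by (simp add: S\<^sub>1_def S\<^sub>2_def fl)
    then show "x \<in> W" by (simp add: W_def)
  qed
  moreover have "S\<^sub>1 \<inter> S\<^sub>2 = {0}"
  proof -
    have "x = 0" if x: "x \<in> S\<^sub>1" "x \<in> S\<^sub>2" for x
    proof -
      have "a\<^sub>1 x = 0" "f x = 0" using x(1) by (auto simp: S\<^sub>1_def square_zero)
      moreover have "a\<^sub>2 x = 0" using x(2) by (auto simp: S\<^sub>2_def square_zero)
      ultimately show ?thesis using ker0[of x] by (simp add: square_eq_anticommutator summands_linear)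
    qed
    then show ?thesis using subspace_0[OF s1] subspace_0[OF s2] by blast
  qed
  ultimately have dW: "dim W = dim S\<^sub>1 + dim S\<^sub>2"
    using dim_sums_Int[OF s1 s2] by simp
  have uinj: "inj_on u W" using inj by (auto simp: inj_on_def)
  have sub: "S\<^sub>1 \<subseteq> W" "S\<^sub>2 \<subseteq> W" by (auto simp: S\<^sub>1_def S\<^sub>2_def W_def)
  have swap: "u ` S\<^sub>1 \<subseteq> S\<^sub>2" "u ` S\<^sub>2 \<subseteq> S\<^sub>1"
  proof -
    have "u x \<in> S\<^sub>2" if "x \<in> S\<^sub>1" for x
    proof -
      have "u x = a\<^sub>2 x" using that by (auto simp: S\<^sub>1_def sum square_zero)
      then show ?thesis using that by (auto simp: S\<^sub>1_def S\<^sub>2_def fa summands_linear)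
    qed
    moreover have "u x \<in> S\<^sub>1" if "x \<in> S\<^sub>2" for x
    proof -
      have "u x = a\<^sub>1 x" using that by (auto simp: S\<^sub>2_def sum square_zero)
      then show ?thesis using that by (auto simp: S\<^sub>1_def S\<^sub>2_def fa summands_linear)
    qed
    ultimately show "u ` S\<^sub>1 \<subseteq> S\<^sub>2" "u ` S\<^sub>2 \<subseteq> S\<^sub>1" by auto
  qed
  have "dim (u ` S\<^sub>1) = dim S\<^sub>1" "dim (u ` S\<^sub>2) = dim S\<^sub>2"
    using endo.dim_image_eq[OF u_endo, of S\<^sub>1] endo.dim_image_eq[OF u_endo, of S\<^sub>2]
      inj_on_subset[OF uinj sub(1)] inj_on_subset[OF uinj sub(2)] s1 s2 by (simp_all add: span_eq_iff[THEN iffD2])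
  then have "dim S\<^sub>1 = dim S\<^sub>2" using dim_subset[OF swap(1)] dim_subset[OF swap(2)] by simp
  moreover obtain m where "dim S\<^sub>1 = 2 * m" using e1 by (elim evenE)
  ultimately have four: "dim W = 4 * m" using dW by simp
  have "l \<noteq> - l"
  proof
    assume "l = - l"
    then have "2 * l = 0" by (metis add.right_inverse mult_2)
    then show False using l char2 by simp
  qed
  then have "dim W = kernel_dim_power u l k + kernel_dim_power u (- l) k"
    using dim_kernel_square_shift[OF u_endo, of l k] by (simp add: W_def f_def kernel_dim_power_def)
  also have "\<dots> = 2 * kernel_dim_power u l k"
    using kernel_dim_power_uminus[OF b(1,2) _ u_endo u_skew, of l k] b(3) by simp
  finally have "kernel_dim_power u l k = 2 * m" using four by simp
  then show ?thesis by simp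
qed

end

context finite_dimensional_vector_space
begin

interpretation endo: finite_dimensional_vector_space_pair scale Basis scale Basis
  by unfold_locales

text \<open>Let \<open>K\<^sub>i\<close> and \<open>I\<^sub>i\<close> be the kernel and the image of \<open>a\<^sub>i\<close> on \<open>U\<close>; they are orthogonals of each other, and
  \<open>N = K\<^sub>1 \<inter> K\<^sub>2\<close> has orthogonal \<open>I\<^sub>1 + I\<^sub>2\<close>. If \<open>\<beta>\<close> vanished on \<open>N\<close>, then \<open>N\<close> would lie in \<open>I\<^sub>1 + I\<^sub>2\<close>; for
  \<open>p \<in> I\<^sub>1\<close> and \<open>q \<in> I\<^sub>2\<close> with \<open>p + q \<in> N\<close> each of \<open>p\<close>, \<open>q\<close> is killed by both maps, so
  \<open>N = (I\<^sub>1 \<inter> K\<^sub>2) + (I\<^sub>2 \<inter> K\<^sub>1)\<close>. Comparing dimensions, with all orthogonals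
  computed by \<open>dim_perp\<close>, expresses \<open>dim U\<close> through doubled terms only: it would be even.\<close>

lemma odd_dim_common_kernel:
  assumes \<beta>: "bilinear_form scale \<beta>" "nondegenerate_on \<beta> U" "\<And>x y. x \<in> U \<Longrightarrow> y \<in> U \<Longrightarrow> \<beta> x y = \<beta> y x"
    and U: "subspace U"
    and endo: "endomorphism a\<^sub>1" "endomorphism a\<^sub>2" and stable: "a\<^sub>1 ` U \<subseteq> U" "a\<^sub>2 ` U \<subseteq> U"
    and skew: "\<And>x y. x \<in> U \<Longrightarrow> y \<in> U \<Longrightarrow> \<beta> (a\<^sub>1 x) y = - \<beta> x (a\<^sub>1 y)"
      "\<And>x y. x \<in> U \<Longrightarrow> y \<in> U \<Longrightarrow> \<beta> (a\<^sub>2 x) y = - \<beta> x (a\<^sub>2 y)"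
    and sq: "\<And>x. a\<^sub>1 (a\<^sub>1 x) = 0" "\<And>x. a\<^sub>2 (a\<^sub>2 x) = 0"
    and odd: "odd (dim U)"
  shows "\<exists>x\<in>U. \<exists>y\<in>U. a\<^sub>1 x = 0 \<and> a\<^sub>2 x = 0 \<and> a\<^sub>1 y = 0 \<and> a\<^sub>2 y = 0 \<and> \<beta> x y \<noteq> 0"
proof (rule ccontr)
  assume contra: "\<not> ?thesis"
  define K where "K a = {x \<in> U. a x = 0}" for a :: "'b \<Rightarrow> 'b"
  define I where "I a = a ` U" for a :: "'b \<Rightarrow> 'b"
  define plus where "plus S T = {x + y |x y. x \<in> S \<and> y \<in> T}" for S T :: "'b set"
  have perpI: "perp \<beta> U (I a) = K a" and perpK: "perp \<beta> U (K a) = I a" and IK: "I a \<subseteq> K a"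
    and IU: "I a \<subseteq> U" and sK: "subspace (K a)" and sI: "subspace (I a)"
    if a: "endomorphism a" "a ` U \<subseteq> U" "\<And>x y. x \<in> U \<Longrightarrow> y \<in> U \<Longrightarrow> \<beta> (a x) y = - \<beta> x (a y)"
      "\<And>x. a (a x) = 0" for a
  proof -
    show sK: "subspace (K a)" unfolding K_def by (rule subspace_kernel_on[OF U a(1)])
    show sI: "subspace (I a)" unfolding I_def by (rule subspace_image[OF U a(1)])
    show IU: "I a \<subseteq> U" using a(2) by (simp add: I_def)
    show IK: "I a \<subseteq> K a" using a(2,4) by (auto simp: I_def K_def)
    have rn: "dim (K a) + dim (I a) = dim U"
      unfolding K_def I_def by (rule rank_nullity_on[OF U a(1)])
    show "perp \<beta> U (I a) = K a"
    proof -
      have "a x = 0" if x: "x \<in> U" "\<forall>y\<in>U. \<beta> x (a y) = 0" for x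
      proof -
        have "a x \<in> perp \<beta> U U" using x a(2,3) by (auto simp: perp_def)
        then show ?thesis using \<beta>(2) by (auto simp: nondegenerate_on_def)
      qed
      moreover have "\<beta> x (a y) = 0" if "x \<in> U" "a x = 0" "y \<in> U" for x y
        using a(3)[of x y] that by (simp add: bilinear_formD[OF \<beta>(1)])
      ultimately show ?thesis unfolding perp_def K_def I_def by blast
    qed
    have "I a \<subseteq> perp \<beta> U (K a)"
      using a(2,3) by (auto simp: perp_def K_def I_def bilinear_formD[OF \<beta>(1)])
    moreover have "dim (perp \<beta> U (K a)) + dim (K a) = dim U"
      by (rule dim_perp[OF \<beta>(1,2) U sK]) (auto simp: K_def)
    ultimately show "perp \<beta> U (K a) = I a"
      using subspace_dim_equal[OF sI subspace_perp[OF \<beta>(1) U], of "K a"] rn by simp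
  qed
  note f1 = perpI[OF endo(1) stable(1) skew(1) sq(1)] perpK[OF endo(1) stable(1) skew(1) sq(1)]
    IK[OF endo(1) stable(1) skew(1) sq(1)] IU[OF endo(1) stable(1) skew(1) sq(1)]
    sK[OF endo(1) stable(1) skew(1) sq(1)] sI[OF endo(1) stable(1) skew(1) sq(1)]
  note f2 = perpI[OF endo(2) stable(2) skew(2) sq(2)] perpK[OF endo(2) stable(2) skew(2) sq(2)]
    IK[OF endo(2) stable(2) skew(2) sq(2)] IU[OF endo(2) stable(2) skew(2) sq(2)]
    sK[OF endo(2) stable(2) skew(2) sq(2)] sI[OF endo(2) stable(2) skew(2) sq(2)]
  have KU: "K a \<subseteq> U" for a by (auto simp: K_def)
  have perp_plus: "perp \<beta> U (plus S T) = perp \<beta> U S \<inter> perp \<beta> U T" if "subspace S" "subspace T" for S T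
  proof -
    have "S \<subseteq> plus S T" "T \<subseteq> plus S T"
      unfolding plus_def using subspace_0[OF that(1)] subspace_0[OF that(2)] by force+
    then show ?thesis by (fastforce simp: perp_def plus_def bilinear_formD[OF \<beta>(1)])
  qed
  have sub_plus: "subspace (plus S T)" if "subspace S" "subspace T" for S T
    unfolding plus_def by (rule subspace_sums[OF that])
  have plusU: "plus S T \<subseteq> U" if "S \<subseteq> U" "T \<subseteq> U" for S T
    unfolding plus_def using that subspace_add[OF U] by blast
  have dim_plus: "dim (plus S T) + dim (S \<inter> T) = dim S + dim T" if "subspace S" "subspace T" for S T
    unfolding plus_def by (rule dim_sums_Int[OF that])
  define N where "N = K a\<^sub>1 \<inter> K a\<^sub>2"
  let ?I1 = "I a\<^sub>1" and ?I2 = "I a\<^sub>2" and ?K1 = "K a\<^sub>1" and ?K2 = "K a\<^sub>2"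
  have sN: "subspace N" unfolding N_def by (rule subspace_inter[OF f1(5) f2(5)])
  have NU: "N \<subseteq> U" using KU by (auto simp: N_def)
  have pI: "perp \<beta> U (plus ?I1 ?I2) = N"
    using perp_plus[OF f1(6) f2(6)] f1(1) f2(1) by (simp add: N_def)
  have dN: "dim N + dim (plus ?I1 ?I2) = dim U"
    using dim_perp[OF \<beta>(1,2) U sub_plus[OF f1(6) f2(6)] plusU[OF f1(4) f2(4)]] pI by simp
  have "plus ?I1 ?I2 \<subseteq> perp \<beta> U N"
  proof
    fix x assume x: "x \<in> plus ?I1 ?I2"
    then have xU: "x \<in> U" using plusU[OF f1(4) f2(4)] by blast
    have "\<beta> x y = 0" if "y \<in> N" for y
      using that x pI \<beta>(3)[OF xU, of y] NU by (auto simp: perp_def)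
    then show "x \<in> perp \<beta> U N" using xU by (simp add: perp_def)
  qed
  moreover have "dim (perp \<beta> U N) + dim N = dim U" by (rule dim_perp[OF \<beta>(1,2) U sN NU])
  ultimately have pN: "perp \<beta> U N = plus ?I1 ?I2"
    using subspace_dim_equal[OF sub_plus[OF f1(6) f2(6)] subspace_perp[OF \<beta>(1) U], of N] dN by simp
  have "N \<subseteq> perp \<beta> U N"
    using contra by (auto simp: perp_def N_def K_def)
  then have Nsub: "N \<subseteq> plus ?I1 ?I2" using pN by simp
  have N_eq: "N = plus (?I1 \<inter> ?K2) (?I2 \<inter> ?K1)"
  proof (intro equalityI subsetI)
    fix x assume x: "x \<in> N"
    then obtain p q where pq: "p \<in> ?I1" "q \<in> ?I2" "x = p + q" using Nsub by (auto simp: plus_def)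
    have ap: "a\<^sub>1 p = 0" "a\<^sub>2 q = 0" "p \<in> U" "q \<in> U"
      using pq f1(3) f2(3) by (auto simp: K_def)
    have "a\<^sub>1 x = 0" "a\<^sub>2 x = 0" using x by (auto simp: N_def K_def)
    then have "a\<^sub>1 q = 0" "a\<^sub>2 p = 0"
      using pq(3) ap endo by (simp_all add: endomorphism_iff)
    then show "x \<in> plus (?I1 \<inter> ?K2) (?I2 \<inter> ?K1)"
      using pq ap unfolding plus_def K_def by blast
  next
    fix x assume "x \<in> plus (?I1 \<inter> ?K2) (?I2 \<inter> ?K1)"
    then show "x \<in> N" using f1(3) f2(3) subspace_add[OF f1(5)] subspace_add[OF f2(5)]
      unfolding plus_def N_def by blast
  qed
  have "(?I1 \<inter> ?K2) \<inter> (?I2 \<inter> ?K1) = ?I1 \<inter> ?I2" using f1(3) f2(3) by blast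
  then have d1: "dim N + dim (?I1 \<inter> ?I2) = dim (?I1 \<inter> ?K2) + dim (?I2 \<inter> ?K1)"
    using dim_plus[OF subspace_inter[OF f1(6) f2(5)] subspace_inter[OF f2(6) f1(5)]] N_eq by simp
  have d2: "dim (plus ?I1 ?I2) + dim (?I1 \<inter> ?I2) = dim ?I1 + dim ?I2"
    by (rule dim_plus[OF f1(6) f2(6)])
  have d3: "dim (?I1 \<inter> ?K2) + dim (plus ?K1 ?I2) = dim U"
    using dim_perp[OF \<beta>(1,2) U sub_plus[OF f1(5) f2(6)] plusU[OF KU f2(4)]]
      perp_plus[OF f1(5) f2(6)] f1(2) f2(1) by simp
  have d4: "dim (plus ?K1 ?I2) + dim (?K1 \<inter> ?I2) = dim ?K1 + dim ?I2"
    by (rule dim_plus[OF f1(5) f2(6)])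
  have d5: "dim ?K1 + dim ?I1 = dim U"
    unfolding K_def I_def by (rule rank_nullity_on[OF U endo(1)])
  have "?K1 \<inter> ?I2 = ?I2 \<inter> ?K1" by blast
  then have "dim U + 2 * dim (?I1 \<inter> ?I2) = 2 * (dim ?I1 + dim (?I2 \<inter> ?K1))"
    using d1 d2 d3 d4 d5 dN by simp
  then have "even (dim U + 2 * dim (?I1 \<inter> ?I2))" by (simp only: dvd_triv_left)
  then have "even (dim U)" by simp
  then show False using odd by simp
qed

end

context square_zero_sum
begin

interpretation endo: finite_dimensional_vector_space_pair scale Basis scale Basis
  by unfold_locales

text \<open>The hypothesis says that \<open>u\<close> has no cell of size \<open>2 k + 1\<close> for the eigenvalue 0. On the image \<open>U\<close> of
  \<open>f = u\<^sup>2\<^sup>k\<close> the rule that sends \<open>f x\<close>, \<open>f y\<close> to \<open>b x (f y)\<close> is a nondegenerate symmetric form for which the two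
  summands are skew. If \<open>U\<close> had odd dimension, there would be \<open>x, y \<in> U \<inter> ker u\<close> not orthogonal for this form;
  but by hypothesis \<open>x = u w\<close> for some \<open>w \<in> U\<close>, which makes \<open>x\<close> orthogonal to \<open>ker u\<close>.\<close>

lemma even_rank_even_power:
  assumes stable: "dim {x \<in> range (u ^^ (2 * k)). u x = 0} = dim {x \<in> range (u ^^ (2 * k + 1)). u x = 0}"
  shows "even (dim (range (u ^^ (2 * k))))"
proof (rule ccontr)
  assume odd: "odd (dim (range (u ^^ (2 * k))))"
  define f where "f = u ^^ (2 * k)"
  define U where "U = range f"
  have f_alt: "f = (\<lambda>x. u (u x)) ^^ k"
  proof -
    have "(u ^^ 2) = (\<lambda>x. u (u x))" by (simp add: numeral_2_eq_2 fun_eq_iff)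
    then show ?thesis unfolding f_def by (simp add: funpow_mult[symmetric])
  qed
  have fe: "endomorphism f" unfolding f_def by (rule endomorphism_funpow[OF u_endo])
  have fa: "f (a\<^sub>1 x) = a\<^sub>1 (f x)" "f (a\<^sub>2 x) = a\<^sub>2 (f x)" for x
    unfolding f_alt by (rule funpow_commute, simp add: square_commute)+
  have fself: "b (f x) y = b x (f y)" for x y
    using skew_funpow[of b u "-1" u "2 * k" x y] u_skew unfolding f_def by simp
  have sU: "subspace U" unfolding U_def by (rule subspace_image[OF subspace_UNIV fe])
  obtain g where "range g \<subseteq> UNIV \<and> endomorphism g \<and> (\<forall>v\<in>range f. f (g v) = v)"
    using endo.linear_exists_right_inverse_on[OF fe subspace_UNIV] by (elim exE) (rule that)
  then have g: "endomorphism g" "\<And>v. v \<in> U \<Longrightarrow> f (g v) = v"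
    unfolding U_def by auto
  \<comment> \<open>A linear section \<open>g\<close> of \<open>f\<close> turns the induced form into a bilinear form on the whole space.\<close>
  define \<beta> where "\<beta> p q = b (g p) q" for p q
  have \<beta>: "bilinear_form scale \<beta>"
    using b(1) g(1) unfolding bilinear_form_iff \<beta>_def endomorphism_iff by simp
  have \<beta>f: "\<beta> p (f y) = b p y" if "p \<in> U" for p y
    using fself[of "g p" y] g(2)[OF that] by (simp add: \<beta>_def)
  have stab: "a\<^sub>1 ` U \<subseteq> U" "a\<^sub>2 ` U \<subseteq> U" unfolding U_def by (auto simp: fa[symmetric])
  have nd: "nondegenerate_on \<beta> U"
  proof -
    have "p = 0" if "p \<in> U" "\<forall>q\<in>U. \<beta> p q = 0" for p
    proof -
      have "b p y = 0" for y using that \<beta>f[of p y] by (simp add: U_def)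
      then show ?thesis using b(2) by (auto simp: nondegenerate_on_def perp_def)
    qed
    then show ?thesis by (auto simp: nondegenerate_on_def perp_def)
  qed
  have sym: "\<beta> p q = \<beta> q p" if pq: "p \<in> U" "q \<in> U" for p q
  proof -
    obtain x y where "p = f x" "q = f y" using pq by (auto simp: U_def)
    then show ?thesis using \<beta>f[of p y] \<beta>f[of q x] pq fself b(3) by metis
  qed
  have sk: "\<beta> (a p) q = - \<beta> p (a q)" if pq: "p \<in> U" "q \<in> U" and a: "a p \<in> U" "\<And>x. f (a x) = a (f x)"
      "\<And>x y. b (a x) y = - b x (a y)" for a p q
  proof -
    obtain y where y: "q = f y" using pq by (auto simp: U_def)
    show ?thesis using \<beta>f[OF a(1), of y] \<beta>f[OF pq(1), of "a y"] a(2,3) y by simp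
  qed
  obtain x y where xy: "x \<in> U" "y \<in> U" "a\<^sub>1 x = 0" "a\<^sub>2 x = 0" "a\<^sub>1 y = 0" "a\<^sub>2 y = 0" "\<beta> x y \<noteq> 0"
  proof -
    have "\<exists>x\<in>U. \<exists>y\<in>U. a\<^sub>1 x = 0 \<and> a\<^sub>2 x = 0 \<and> a\<^sub>1 y = 0 \<and> a\<^sub>2 y = 0 \<and> \<beta> x y \<noteq> 0"
    proof (rule odd_dim_common_kernel[OF \<beta> nd sym sU endo stab _ _ square_zero])
      show "\<beta> (a\<^sub>1 x) y = - \<beta> x (a\<^sub>1 y)" if "x \<in> U" "y \<in> U" for x y
        using sk[of x y a\<^sub>1] that stab(1) fa(1) skew(1) by blast
      show "\<beta> (a\<^sub>2 x) y = - \<beta> x (a\<^sub>2 y)" if "x \<in> U" "y \<in> U" for x y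
        using sk[of x y a\<^sub>2] that stab(2) fa(2) skew(2) by blast
    qed (use odd in \<open>simp_all add: U_def f_def\<close>)
    then show ?thesis using that by blast
  qed
  have ux: "u x = 0" "u y = 0" using xy by (simp_all add: sum)
  have e: "range (u ^^ (2 * k + 1)) = u ` U" by (simp add: U_def f_def image_image)
  have "{x \<in> u ` U. u x = 0} \<subseteq> {x \<in> U. u x = 0}"
    using stab subspace_add[OF sU] by (auto simp: sum)
  moreover have "subspace {x \<in> u ` U. u x = 0}" "subspace {x \<in> U. u x = 0}"
    by (intro subspace_kernel_on subspace_image sU u_endo)+
  ultimately have "{x \<in> u ` U. u x = 0} = {x \<in> U. u x = 0}"
    using subspace_dim_equal stable[unfolded e] unfolding U_def f_def by simp
  then obtain w where w: "w \<in> U" "x = u w" using ux xy by blast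
  have "\<beta> (a\<^sub>1 w) y = 0" "\<beta> (a\<^sub>2 w) y = 0"
    using sk[of w y a\<^sub>1] sk[of w y a\<^sub>2] w(1) xy stab fa skew
    by (auto simp: bilinear_formD[OF \<beta>])
  then have "\<beta> x y = 0" using w(2) by (simp add: sum bilinear_formD[OF \<beta>])
  then show False using xy by simp
qed

end

section \<open>Polynomials in an endomorphism\<close>

context finite_dimensional_vector_space
begin

interpretation endo: finite_dimensional_vector_space_pair scale Basis scale Basis
  by unfold_locales

definition eval_poly :: "('b \<Rightarrow> 'b) \<Rightarrow> 'a poly \<Rightarrow> 'b \<Rightarrow> 'b" where
  "eval_poly f p x = (\<Sum>i\<le>degree p. scale (coeff p i) ((f ^^ i) x))"

lemma eval_poly_bound: "degree p \<le> n \<Longrightarrow> eval_poly f p x = (\<Sum>i\<le>n. scale (coeff p i) ((f ^^ i) x))"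
  unfolding eval_poly_def by (rule sum.mono_neutral_left) (auto simp: coeff_eq_0)

lemma eval_poly_0 [simp]: "eval_poly f 0 x = 0"
  by (simp add: eval_poly_def)

lemma eval_poly_1 [simp]: "eval_poly f 1 x = x"
  by (simp add: eval_poly_def)

lemma eval_poly_add: "eval_poly f (p + q) x = eval_poly f p x + eval_poly f q x"
proof -
  let ?n = "max (degree p) (degree q)"
  have "degree (p + q) \<le> ?n" by (rule degree_add_le_max)
  then show ?thesis
    by (simp add: eval_poly_bound[of _ ?n] scale_left_distrib sum.distrib)
qed

lemma eval_poly_smult: "eval_poly f (Polynomial.smult c p) x = scale c (eval_poly f p x)"
  by (simp add: eval_poly_bound[of "Polynomial.smult c p" "degree p"] eval_poly_def degree_smult_le scale_sum_right)

lemma eval_poly_uminus: "eval_poly f (- p) x = - eval_poly f p x"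
  using eval_poly_smult[of f "-1" p x] by simp

lemma eval_poly_diff: "eval_poly f (p - q) x = eval_poly f p x - eval_poly f q x"
  using eval_poly_add[of f p "- q" x] by (simp add: eval_poly_uminus)

lemma eval_poly_sum: "eval_poly f (sum p A) x = (\<Sum>i\<in>A. eval_poly f (p i) x)"
  by (induction A rule: infinite_finite_induct) (simp_all add: eval_poly_add)

lemma eval_poly_pCons:
  assumes "endomorphism f"
  shows "eval_poly f (pCons a p) x = scale a x + f (eval_poly f p x)"
proof -
  have "eval_poly f (pCons a p) x = (\<Sum>i\<le>Suc (degree p). scale (coeff (pCons a p) i) ((f ^^ i) x))"
    by (rule eval_poly_bound) (rule degree_pCons_le)
  also have "\<dots> = scale a x + (\<Sum>i\<le>degree p. f (scale (coeff p i) ((f ^^ i) x)))"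
    unfolding sum.atMost_Suc_shift using assms by (simp add: endomorphism_iff)
  also have "(\<Sum>i\<le>degree p. f (scale (coeff p i) ((f ^^ i) x))) = f (eval_poly f p x)"
    unfolding eval_poly_def by (rule endo.linear_sum[OF assms, symmetric])
  finally show ?thesis .
qed

lemma eval_poly_mult:
  assumes "endomorphism f"
  shows "eval_poly f (p * q) x = eval_poly f p (eval_poly f q x)"
proof (induction p)
  case (pCons a p)
  then show ?case
    by (simp add: mult_pCons_left eval_poly_add eval_poly_smult eval_poly_pCons[OF assms])
qed simp

lemma eval_poly_X: "eval_poly f [:0, 1:] x = f x"
  by (simp add: eval_poly_def)

lemma eval_poly_linear_factor: "eval_poly f [:- c, 1:] x = f x - scale c x"
  by (simp add: eval_poly_def)

lemma eval_poly_monom: "eval_poly f (monom c i) x = scale c ((f ^^ i) x)"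
proof -
  have "eval_poly f (monom c i) x = (\<Sum>j\<le>i. scale (coeff (monom c i) j) ((f ^^ j) x))"
    by (rule eval_poly_bound) (rule degree_monom_le)
  also have "\<dots> = (\<Sum>j\<le>i. if j = i then scale c ((f ^^ i) x) else 0)"
    by (rule sum.cong) (auto simp: coeff_monom)
  finally show ?thesis by simp
qed

lemma endomorphism_eval_poly:
  assumes "endomorphism f"
  shows "endomorphism (eval_poly f p)"
  using endomorphism_funpow[OF assms] unfolding eval_poly_def endomorphism_iff
  by (simp add: scale_right_distrib sum.distrib scale_sum_right mult.commute)

text \<open>The vectors \<open>f\<^sup>i x\<close> for \<open>i \<le> dimension\<close> are too many to be independent.\<close>

lemma exists_annihilating_poly_vector:
  assumes f: "endomorphism f"
  shows "\<exists>p. p \<noteq> 0 \<and> eval_poly f p x = 0"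
proof (cases "inj_on (\<lambda>i. (f ^^ i) x) {..dimension}")
  case True
  let ?S = "(\<lambda>i. (f ^^ i) x) ` {..dimension}"
  have "dim ?S < card ?S"
    using card_image[OF True] dim_subset_UNIV[of ?S] by simp
  then have "dependent ?S" by (intro dependent_biggerset_general) simp
  then obtain c where c: "\<exists>v\<in>?S. c v \<noteq> 0" "(\<Sum>v\<in>?S. scale (c v) v) = 0"
    using dependent_finite[of ?S] by auto
  let ?p = "\<Sum>i\<le>dimension. monom (c ((f ^^ i) x)) i"
  have "eval_poly f ?p x = (\<Sum>i\<le>dimension. scale (c ((f ^^ i) x)) ((f ^^ i) x))"
    by (simp add: eval_poly_sum eval_poly_monom)
  also have "\<dots> = 0"
    using c(2) unfolding sum.reindex[OF True] by simp
  finally have "eval_poly f ?p x = 0" .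
  moreover obtain i where i: "i \<le> dimension" "c ((f ^^ i) x) \<noteq> 0" using c(1) by auto
  have "coeff ?p i = c ((f ^^ i) x)"
    using i(1) by (simp add: coeff_sum coeff_monom sum.delta)
  then have "?p \<noteq> 0" using i(2) by auto
  ultimately show ?thesis by blast
next
  case False
  then obtain i j where ij: "i \<noteq> j" "(f ^^ i) x = (f ^^ j) x" by (auto simp: inj_on_def)
  let ?p = "monom 1 i - monom 1 j :: 'a poly"
  have "coeff ?p i = 1" using ij(1) by (simp add: coeff_monom)
  then have "?p \<noteq> 0" by (metis coeff_0 zero_neq_one)
  moreover have "eval_poly f ?p x = 0" using ij(2) by (simp add: eval_poly_diff eval_poly_monom)
  ultimately show ?thesis by blast
qed

text \<open>The product of annihilating polynomials for the vectors of a basis works.\<close>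

lemma exists_annihilating_poly:
  assumes f: "endomorphism f"
  shows "\<exists>p. p \<noteq> 0 \<and> (\<forall>x. eval_poly f p x = 0)"
proof -
  have "\<exists>p. p \<noteq> 0 \<and> (\<forall>x\<in>C. eval_poly f p x = 0)" if "finite C" for C
    using that
  proof (induction C)
    case empty
    show ?case by (intro exI[of _ 1]) simp
  next
    case (insert c C)
    then obtain p where p: "p \<noteq> 0" "\<forall>x\<in>C. eval_poly f p x = 0" by blast
    obtain q where q: "q \<noteq> 0" "eval_poly f q c = 0"
      using exists_annihilating_poly_vector[OF f] by blast
    have z: "eval_poly f r 0 = 0" for r by (rule endo.linear_0[OF endomorphism_eval_poly[OF f]])
    have "eval_poly f (p * q) x = 0" if "x \<in> insert c C" for x
    proof (cases "x = c")
      case True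
      then show ?thesis using q(2) z by (simp add: eval_poly_mult[OF f])
    next
      case False
      then have "eval_poly f (q * p) x = 0" using that p(2) z by (simp add: eval_poly_mult[OF f])
      then show ?thesis by (simp add: mult.commute)
    qed
    moreover have "p * q \<noteq> 0" using p(1) q(1) by simp
    ultimately show ?case by blast
  qed
  then obtain p where p: "p \<noteq> 0" "\<forall>x\<in>Basis. eval_poly f p x = 0"
    using finite_Basis by blast
  have "eval_poly f p x = 0" for x
    using endo.linear_eq_0_on_span[OF endomorphism_eval_poly[OF f], of Basis p x] p(2) span_Basis by simp
  then show ?thesis using p(1) by blast
qed

section \<open>Coordinates and the Jordan cells of an endomorphism\<close>

definition coordinates :: "'b list \<Rightarrow> 'b \<Rightarrow> 'a vec" where
  "coordinates bs x = vec (length bs) (\<lambda>i. representation (set bs) x (bs ! i))"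

definition of_coordinates :: "'b list \<Rightarrow> 'a vec \<Rightarrow> 'b" where
  "of_coordinates bs v = (\<Sum>i<length bs. scale (v $ i) (bs ! i))"

context
  fixes bs
  assumes bs: "ordered_basis scale bs"
begin

lemma basis_facts: "distinct bs" "independent (set bs)" "span (set bs) = UNIV"
  using bs by (simp_all add: ordered_basis_def)

lemma coordinates_carrier [simp]: "coordinates bs x \<in> carrier_vec (length bs)"
  by (simp add: coordinates_def)

lemma coordinates_add: "coordinates bs (x + y) = coordinates bs x + coordinates bs y"
  using basis_facts by (intro eq_vecI) (simp_all add: coordinates_def representation_add)

lemma coordinates_scale: "coordinates bs (scale c x) = c \<cdot>\<^sub>v coordinates bs x"
  using basis_facts by (intro eq_vecI) (simp_all add: coordinates_def representation_scale)

lemma coordinates_index_sum: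
  assumes "i < length bs"
  shows "coordinates bs (\<Sum>c\<in>C. scale (g c) (h c)) $ i = (\<Sum>c\<in>C. g c * coordinates bs (h c) $ i)"
  using assms basis_facts by (simp add: coordinates_def representation_sum representation_scale)

lemma of_coordinates_coordinates [simp]: "of_coordinates bs (coordinates bs x) = x"
proof -
  have "x = (\<Sum>b\<in>set bs. scale (representation (set bs) x b) b)"
    by (rule sum_representation_eq[symmetric]) (use basis_facts in auto)
  also have "\<dots> = (\<Sum>i<length bs. scale (representation (set bs) x (bs ! i)) (bs ! i))"
    by (rule sum.reindex_bij_betw[symmetric], rule bij_betw_nth) (use basis_facts in auto)
  also have "\<dots> = of_coordinates bs (coordinates bs x)"
    unfolding of_coordinates_def coordinates_def by (rule sum.cong) auto
  finally show ?thesis by simp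
qed

lemma coordinates_nth: "i < length bs \<Longrightarrow> j < length bs \<Longrightarrow> coordinates bs (bs ! j) $ i = (if i = j then 1 else 0)"
  using basis_facts by (simp add: coordinates_def representation_basis nth_eq_iff_index_eq)

lemma coordinates_of_coordinates [simp]:
  assumes v: "v \<in> carrier_vec (length bs)"
  shows "coordinates bs (of_coordinates bs v) = v"
proof (rule eq_vecI)
  fix i assume i: "i < dim_vec v"
  then have "coordinates bs (of_coordinates bs v) $ i = (\<Sum>j<length bs. v $ j * coordinates bs (bs ! j) $ i)"
    unfolding of_coordinates_def using v by (intro coordinates_index_sum) simp
  also have "\<dots> = (\<Sum>j<length bs. if j = i then v $ i else 0)"
    using i v by (intro sum.cong) (auto simp: coordinates_nth)
  also have "\<dots> = v $ i" using i v by simp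
  finally show "coordinates bs (of_coordinates bs v) $ i = v $ i" .
qed (use v in \<open>simp add: coordinates_def\<close>)

lemma coordinates_inject: "coordinates bs x = coordinates bs y \<longleftrightarrow> x = y"
  by (metis of_coordinates_coordinates)

lemma coordinates_zero: "coordinates bs 0 = 0\<^sub>v (length bs)"
  using coordinates_scale[of 0 0] by (intro eq_vecI) (simp_all add: coordinates_def representation_zero)

lemma matrix_of_endo_carrier [simp]: "matrix_of_endo scale bs u \<in> carrier_mat (length bs) (length bs)"
  by (simp add: matrix_of_endo_def)

lemma coordinates_endo:
  assumes u: "endomorphism u"
  shows "coordinates bs (u x) = matrix_of_endo scale bs u *\<^sub>v coordinates bs x"
proof (rule eq_vecI)
  fix i assume "i < dim_vec (matrix_of_endo scale bs u *\<^sub>v coordinates bs x)"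
  then have i: "i < length bs" by (simp add: matrix_of_endo_def)
  have "x = of_coordinates bs (coordinates bs x)" by simp
  then have "u x = u (\<Sum>j<length bs. scale (coordinates bs x $ j) (bs ! j))"
    unfolding of_coordinates_def by simp
  also have "\<dots> = (\<Sum>j<length bs. scale (coordinates bs x $ j) (u (bs ! j)))"
    using u by (simp add: endo.linear_sum[OF u] endomorphism_iff)
  finally have "coordinates bs (u x) $ i = (\<Sum>j<length bs. coordinates bs x $ j * coordinates bs (u (bs ! j)) $ i)"
    using coordinates_index_sum[OF i] by simp
  also have "\<dots> = (matrix_of_endo scale bs u *\<^sub>v coordinates bs x) $ i"
    using i by (auto simp: matrix_of_endo_def coordinates_def scalar_prod_def lessThan_atLeast0 mult.commute intro!: sum.cong)
  finally show "coordinates bs (u x) $ i = (matrix_of_endo scale bs u *\<^sub>v coordinates bs x) $ i" .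
qed (simp add: matrix_of_endo_def coordinates_def)

lemma coordinates_shift_power:
  assumes u: "endomorphism u"
  shows "coordinates bs (((\<lambda>x. u x - scale l x) ^^ k) x)
    = (char_matrix (matrix_of_endo scale bs u) l ^\<^sub>m k) *\<^sub>v coordinates bs x"
proof (induction k arbitrary: x)
  case 0
  have "dim_row (char_matrix (matrix_of_endo scale bs u) l) = length bs"
    by (simp add: char_matrix_def matrix_of_endo_def)
  then show ?case by simp
next
  case (Suc k)
  let ?A = "matrix_of_endo scale bs u" and ?n = "length bs"
  let ?C = "char_matrix ?A l"
  have C: "?C \<in> carrier_mat ?n ?n" by (simp add: char_matrix_def matrix_of_endo_def)
  have "coordinates bs (u x - scale l x) = ?C *\<^sub>v coordinates bs x"
  proof -
    have "u x - scale l x = u x + scale (- l) x" by simp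
    then have "coordinates bs (u x - scale l x) = ?A *\<^sub>v coordinates bs x + (- l) \<cdot>\<^sub>v coordinates bs x"
      by (simp only: coordinates_add coordinates_scale coordinates_endo[OF u])
    also have "\<dots> = ?C *\<^sub>v coordinates bs x"
      unfolding char_matrix_def
      by (rule eq_vecI) (auto simp: matrix_of_endo_def coordinates_def add_scalar_prod_distrib[of _ ?n] row_add)
    finally show ?thesis .
  qed
  then show ?case
    unfolding funpow_Suc_right o_apply Suc
    by (simp add: assoc_mult_mat_vec[OF pow_carrier_mat[OF C] C])
qed

text \<open>Coordinates carry a basis of the kernel of \<open>f\<close> to a basis of the space of coordinate vectors killed by \<open>M\<close>.\<close>

lemma kernel_dim_matrix:
  assumes M: "M \<in> carrier_mat (length bs) (length bs)"
    and f: "endomorphism f" and fM: "\<And>x. coordinates bs (f x) = M *\<^sub>v coordinates bs x"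
  shows "kernel_dim M = dim {x. f x = 0}"
proof -
  let ?n = "length bs" and ?K = "{x. f x = 0}"
  interpret K: kernel ?n ?n M by unfold_locales (rule M)
  obtain C where C: "C \<subseteq> ?K" "independent C" "?K \<subseteq> span C" "card C = dim ?K"
    using basis_exists by blast
  have fin: "finite C" by (rule finiteI_independent[OF C(2)])
  let ?B = "coordinates bs ` C"
  have inj: "inj_on (coordinates bs) C" by (simp add: inj_on_def coordinates_inject)
  have ker: "coordinates bs x \<in> mat_kernel M \<longleftrightarrow> f x = 0" for x
    using mat_kernel[OF M] fM[of x] coordinates_zero coordinates_inject[of "f x" 0] by auto
  have B: "?B \<subseteq> mat_kernel M" using C(1) ker by auto
  have lc: "K.lincomb a ?B = coordinates bs (\<Sum>c\<in>C. scale (a (coordinates bs c)) c)" for a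
  proof (rule eq_vecI)
    have "K.lincomb a ?B \<in> mat_kernel M" by (rule K.Ker.lincomb_closed[OF B]) auto
    then show dim: "dim_vec (K.lincomb a ?B) = dim_vec (coordinates bs (\<Sum>c\<in>C. scale (a (coordinates bs c)) c))"
      using mat_kernel[OF M] by (auto simp: coordinates_def)
    fix i assume "i < dim_vec (coordinates bs (\<Sum>c\<in>C. scale (a (coordinates bs c)) c))"
    then have i: "i < ?n" by (simp add: coordinates_def)
    show "K.lincomb a ?B $ i = coordinates bs (\<Sum>c\<in>C. scale (a (coordinates bs c)) c) $ i"
      unfolding K.lincomb_index[OF i B] coordinates_index_sum[OF i] sum.reindex[OF inj] by simp
  qed
  have "K.lin_indpt ?B"
  proof (rule K.Ker.finite_lin_indpt2)
    fix a assume "K.lincomb a ?B = 0\<^sub>v ?n"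
    then have "(\<Sum>c\<in>C. scale (a (coordinates bs c)) c) = 0"
      using lc[of a] coordinates_zero coordinates_inject by metis
    then show "\<forall>v\<in>?B. a v = 0"
      using C(2)[unfolded independent_explicit] by auto
  qed (use fin B in auto)
  moreover have "K.span ?B = mat_kernel M"
  proof
    show "K.span ?B \<subseteq> mat_kernel M"
      unfolding K.Ker.finite_span[OF finite_imageI[OF fin] B]
      using K.Ker.lincomb_closed[OF B] by auto
    show "mat_kernel M \<subseteq> K.span ?B"
    proof
      fix v assume v: "v \<in> mat_kernel M"
      then have vc: "v \<in> carrier_vec ?n" using mat_kernel[OF M] by auto
      define x where "x = of_coordinates bs v"
      have vx: "v = coordinates bs x" using vc by (simp add: x_def)
      then have "x \<in> span C" using v ker[of x] C(3) by auto
      then obtain g where g: "x = (\<Sum>c\<in>C. scale (g c) c)"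
        using span_finite[OF fin] by auto
      have "v = K.lincomb (\<lambda>w. g (of_coordinates bs w)) ?B" unfolding lc vx g by simp
      then show "v \<in> K.span ?B"
        unfolding K.Ker.finite_span[OF finite_imageI[OF fin] B] by auto
    qed
  qed
  ultimately have "K.basis ?B" unfolding K.Ker.basis_def using B by auto
  then have "K.dim = card ?B" by (rule K.Ker.dim_basis[OF finite_imageI[OF fin]])
  then show ?thesis using card_image[OF inj] C(4) by simp
qed

end

lemma kernel_dim_power_jordan_cells:
  assumes u: "endomorphism u" and cs: "jordan_cells scale u cs"
  shows "kernel_dim_power u l k = (\<Sum>n\<leftarrow>map fst [(n, e)\<leftarrow>cs. e = l]. min k n)"
proof -
  obtain bs where bs: "ordered_basis scale bs" "jordan_nf (matrix_of_endo scale bs u) cs"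
    using cs by (auto simp: jordan_cells_def)
  let ?C = "char_matrix (matrix_of_endo scale bs u) l"
  have C: "?C \<in> carrier_mat (length bs) (length bs)" by (simp add: char_matrix_def matrix_of_endo_def)
  have "kernel_dim (?C ^\<^sub>m k) = kernel_dim_power u l k"
    unfolding kernel_dim_power_def
    by (rule kernel_dim_matrix[OF bs(1) pow_carrier_mat[OF C] endomorphism_funpow[OF endomorphism_shift[OF u]]])
       (rule coordinates_shift_power[OF bs(1) u])
  then show ?thesis using dim_gen_eigenspace[OF bs(2), of l k] by (simp add: dim_gen_eigenspace_def)
qed

text \<open>Apply the linear factors to \<open>w\<close> one after the other: the last vector outside \<open>S\<close> is the required one.\<close>

lemma approximate_eigenvector:
  assumes u: "endomorphism u" and S: "w \<notin> S"
    and ev: "eval_poly u (\<Prod>x\<in>#A. [:- x, 1:]) w \<in> S"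
  shows "\<exists>v c. v \<notin> S \<and> u v - scale c v \<in> S"
  using ev
proof (induction A)
  case empty
  then show ?case using S by simp
next
  case (add c A)
  let ?w = "eval_poly u (\<Prod>x\<in>#A. [:- x, 1:]) w"
  have "u ?w - scale c ?w \<in> S"
    using add.prems eval_poly_mult[OF u, of "[:- c, 1:]" "\<Prod>x\<in>#A. [:- x, 1:]" w]
    by (simp add: eval_poly_linear_factor del: mult_pCons_left)
  then show ?case using add.IH by blast
qed

end

lemma alg_closed_splits:
  fixes p :: "'a::alg_closed_field poly"
  assumes "p \<noteq> 0"
  obtains A where "p = Polynomial.smult (lead_coeff p) (\<Prod>x\<in>#A. [:- x, 1:])"
  using alg_closed_imp_factorization[OF assms] by blast

locale alg_closed_vector_space = finite_dimensional_vector_space scale Basis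
  for scale :: "'a::alg_closed_field \<Rightarrow> 'v::ab_group_add \<Rightarrow> 'v" and Basis
begin

interpretation endo: finite_dimensional_vector_space_pair scale Basis scale Basis
  by unfold_locales

text \<open>A flag is enlarged by a vector that is an eigenvector modulo the span of the flag; it exists because an
  annihilating polynomial splits into linear factors.\<close>

lemma triangular_flag:
  assumes u: "endomorphism u" and m: "m \<le> dimension"
  shows "\<exists>bs. length bs = m \<and> distinct bs \<and> independent (set bs)
    \<and> (\<forall>j<m. u (bs ! j) \<in> span (set (take (Suc j) bs)))"
  using m
proof (induction m)
  case 0
  then show ?case by (intro exI[of _ "[]"]) (simp add: independent_empty)
next
  case (Suc m)
  then obtain bs where bs: "length bs = m" "distinct bs" "independent (set bs)"
    "\<And>j. j < m \<Longrightarrow> u (bs ! j) \<in> span (set (take (Suc j) bs))" by auto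
  let ?S = "span (set bs)"
  have "dim ?S = m" using bs by (simp add: dim_eq_card_independent distinct_card)
  then have "?S \<noteq> UNIV" using Suc.prems dim_UNIV dimension_def by (metis Suc_n_not_le_n)
  then obtain w where w: "w \<notin> ?S" by blast
  obtain p where p: "p \<noteq> 0" "eval_poly u p w = 0"
    using exists_annihilating_poly_vector[OF u] by blast
  obtain A where A: "p = Polynomial.smult (lead_coeff p) (\<Prod>x\<in>#A. [:- x, 1:])"
    by (rule alg_closed_splits[OF p(1)])
  have "scale (lead_coeff p) (eval_poly u (\<Prod>x\<in>#A. [:- x, 1:]) w) = 0"
    using p(2) A eval_poly_smult by metis
  then have "eval_poly u (\<Prod>x\<in>#A. [:- x, 1:]) w \<in> ?S"
    using p(1) span_zero by simp
  then obtain v c where v: "v \<notin> ?S" "u v - scale c v \<in> ?S"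
    using approximate_eigenvector[OF u w] by blast
  let ?bs = "bs @ [v]"
  have "v \<notin> set bs" using v(1) span_superset by blast
  moreover have "independent (set ?bs)" using independent_insertI[OF v(1) bs(3)] by simp
  moreover have "u (?bs ! j) \<in> span (set (take (Suc j) ?bs))" if j: "j < Suc m" for j
  proof (cases "j = m")
    case True
    have "u v - scale c v \<in> span (set ?bs)" using v(2) span_mono[of "set bs" "set ?bs"] by auto
    moreover have "scale c v \<in> span (set ?bs)" by (intro span_scale span_base) simp
    ultimately have "u v \<in> span (set ?bs)" using span_add by fastforce
    then show ?thesis using True bs(1) by (simp add: nth_append)
  next
    case False
    then show ?thesis using j bs(1) bs(4)[of j] by (simp add: nth_append)
  qed
  ultimately show ?case using bs(1,2) by (intro exI[of _ ?bs]) auto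
qed

text \<open>In a basis adapted to a triangular flag the matrix is upper triangular, and triangular matrices
  have a Jordan normal form over every field.\<close>

lemma jordan_cells_exist:
  assumes u: "endomorphism u"
  shows "\<exists>cs. jordan_cells scale u cs"
proof -
  obtain bs where bs: "length bs = dimension" "distinct bs" "independent (set bs)"
    "\<And>j. j < dimension \<Longrightarrow> u (bs ! j) \<in> span (set (take (Suc j) bs))"
    using triangular_flag[OF u order_refl] by blast
  have "card (set bs) = dim UNIV" using bs by (simp add: distinct_card dimension_def)
  then have span: "span (set bs) = UNIV"
    using card_ge_dim_independent[OF subset_UNIV bs(3)] by auto
  have ob: "ordered_basis scale bs" using bs span by (simp add: ordered_basis_def)
  let ?A = "matrix_of_endo scale bs u"
  have "upper_triangular ?A"
    unfolding upper_triangular_def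
  proof (intro allI impI)
    fix i j assume i: "i < dim_row ?A" and ji: "j < i"
    then have n: "i < length bs" "j < length bs" by (simp_all add: matrix_of_endo_def)
    let ?T = "set (take (Suc j) bs)"
    have "representation (set bs) (u (bs ! j)) = representation ?T (u (bs ! j))"
      using bs(4)[of j] n bs(1) by (intro representation_extend[OF bs(3)]) (auto dest: in_set_takeD)
    moreover have "bs ! i \<notin> ?T"
      using bs(2) n ji by (auto simp: in_set_conv_nth nth_eq_iff_index_eq)
    ultimately have "representation (set bs) (u (bs ! j)) (bs ! i) = 0"
      using representation_ne_zero by metis
    then show "?A $$ (i, j) = 0" using n by (simp add: matrix_of_endo_def)
  qed
  moreover have "?A \<in> carrier_mat (length bs) (length bs)" by (simp add: matrix_of_endo_def)
  ultimately show ?thesis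
    using triangular_to_jnf_vector ob unfolding jordan_cells_def by blast
qed

end

section \<open>Jordan numbers modulo 2\<close>

text \<open>The sum of odd Jordan numbers in the theorem, as the size of a part of the multiset of cells; in this
  form it is additive.\<close>

definition odd_tail :: "(nat \<times> 'a::zero) multiset \<Rightarrow> nat \<Rightarrow> nat" where
  "odd_tail M k = size {#x \<in># M. snd x = 0 \<and> odd (fst x) \<and> fst x > 2 * k + 1#}"

lemma odd_tail_eq_sum:
  "(\<Sum>i | i > k \<and> count M (2 * i + 1, 0) \<noteq> 0. count M (2 * i + 1, 0)) = odd_tail M k"
proof -
  let ?F = "{#x \<in># M. snd x = 0 \<and> odd (fst x) \<and> fst x > 2 * k + 1#}"
  let ?f = "\<lambda>i. (2 * i + 1, 0)" and ?I = "{i. i > k \<and> count M (2 * i + 1, 0) \<noteq> 0}"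
  have im: "set_mset ?F = ?f ` ?I"
  proof (intro equalityI subsetI)
    fix x assume x: "x \<in> set_mset ?F"
    then obtain i where "fst x = 2 * i + 1" by (auto elim: oddE)
    then have "x = (2 * i + 1, 0)" using x by (simp add: prod_eq_iff)
    then show "x \<in> ?f ` ?I" using x by auto
  qed auto
  have inj: "inj_on ?f ?I" by (auto simp: inj_on_def)
  have "odd_tail M k = (\<Sum>x\<in>set_mset ?F. count ?F x)"
    unfolding odd_tail_def by (simp add: size_multiset_overloaded_eq)
  also have "\<dots> = (\<Sum>i\<in>?I. count ?F (?f i))" unfolding im sum.reindex[OF inj] by simp
  also have "\<dots> = (\<Sum>i\<in>?I. count M (?f i))" by (rule sum.cong) auto
  finally show ?thesis by simp
qed

lemma even_size_filter_mset:
  assumes "\<And>x. P x \<Longrightarrow> even (count M x)"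
  shows "even (size (filter_mset P M))"
  unfolding size_multiset_overloaded_eq using assms by (intro dvd_sum) auto

context finite_dimensional_vector_space
begin

interpretation endo: finite_dimensional_vector_space_pair scale Basis scale Basis
  by unfold_locales

lemma sum_min_second_difference:
  fixes cs :: "(nat \<times> 'a) list" and l :: 'a
  defines "d \<equiv> \<lambda>k. \<Sum>n\<leftarrow>map fst [(n, e)\<leftarrow>cs. e = l]. min k n"
  shows "count (mset cs) (Suc k, l) + d (Suc (Suc k)) + d k = 2 * d (Suc k)"
  unfolding d_def by (induction cs) (auto simp: min_def)

lemma sum_min_first_difference:
  fixes cs :: "(nat \<times> 'a) list" and l :: 'a
  defines "d \<equiv> \<lambda>k. \<Sum>n\<leftarrow>map fst [(n, e)\<leftarrow>cs. e = l]. min k n"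
  shows "d (Suc k) = d k + size {#x \<in># mset cs. snd x = l \<and> fst x > k#}"
  unfolding d_def by (induction cs) (auto simp: min_def)

context
  fixes u cs
  assumes u: "endomorphism u" and cs: "jordan_cells scale u cs"
begin

text \<open>A cell of size \<open>n\<close> contributes \<open>min k n\<close> to the dimension of the kernel of the \<open>k\<close>-th power, and the second
  difference of this function of \<open>k\<close> detects \<open>k = n\<close>.\<close>

lemma count_cells_kernel_dim:
  "count (mset cs) (Suc k, l) + kernel_dim_power u l (Suc (Suc k)) + kernel_dim_power u l k
    = 2 * kernel_dim_power u l (Suc k)"
  unfolding kernel_dim_power_jordan_cells[OF u cs] by (rule sum_min_second_difference)

lemma rank_power_plus_kernel: "kernel_dim_power u 0 k + dim (range (u ^^ k)) = dimension"
  using rank_nullity[OF endomorphism_funpow[OF u, of k]] by (simp add: kernel_dim_power_def)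

lemma rank_power_tail:
  "dim (range (u ^^ k)) = dim (range (u ^^ Suc k)) + size {#x \<in># mset cs. snd x = 0 \<and> fst x > k#}"
proof -
  have "kernel_dim_power u 0 (Suc k) = kernel_dim_power u 0 k + size {#x \<in># mset cs. snd x = 0 \<and> fst x > k#}"
    unfolding kernel_dim_power_jordan_cells[OF u cs] by (rule sum_min_first_difference)
  then show ?thesis using rank_power_plus_kernel[of k] rank_power_plus_kernel[of "Suc k"] by linarith
qed

lemma count_cells_rank:
  "count (mset cs) (Suc k, 0) + 2 * dim (range (u ^^ Suc k)) = dim (range (u ^^ k)) + dim (range (u ^^ Suc (Suc k)))"
  using count_cells_kernel_dim[of k 0] rank_power_plus_kernel[of k] rank_power_plus_kernel[of "Suc k"]
    rank_power_plus_kernel[of "Suc (Suc k)"] by linarith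

lemma kernel_on_range_power:
  "dim {x \<in> range (u ^^ k). u x = 0} + dim (range (u ^^ Suc k)) = dim (range (u ^^ k))"
proof -
  have "u ` range (u ^^ k) = range (u ^^ Suc k)" by (simp add: image_image)
  then show ?thesis
    using rank_nullity_on[OF subspace_image[OF subspace_UNIV endomorphism_funpow[OF u, of k]] u] by simp
qed

lemma even_counts_if_even_kernel_dims:
  assumes "\<And>k. even (kernel_dim_power u l k)" "k \<ge> 1"
  shows "even (count (mset cs) (k, l))"
proof -
  obtain j where j: "k = Suc j" using assms(2) by (cases k) auto
  have "even (count (mset cs) (Suc j, l) + kernel_dim_power u l (Suc (Suc j)) + kernel_dim_power u l j)"
    unfolding count_cells_kernel_dim by simp
  then show ?thesis using assms(1) j by simp
qed

context
  fixes b
  assumes b: "bilinear_form scale b" "nondegenerate_on b UNIV" "\<And>x y. b x y = b y x"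
    and skew: "\<And>x y. b (u x) y = - b x (u y)" and char2: "(2 :: 'a) \<noteq> 0"
begin

lemma count_cells_uminus:
  assumes "k \<ge> 1"
  shows "count (mset cs) (k, - l) = count (mset cs) (k, l)"
proof -
  obtain j where j: "k = Suc j" using assms by (cases k) auto
  have d: "kernel_dim_power u (- l) k = kernel_dim_power u l k" for k
    using kernel_dim_power_uminus[OF b u skew, of l k] by simp
  show ?thesis
    using count_cells_kernel_dim[of j l] count_cells_kernel_dim[of j "- l"] unfolding d j by linarith
qed

text \<open>The number of cells of size \<open>2 i\<close> is congruent to a sum of two ranks of odd powers of \<open>u\<close>, which are skew.\<close>

lemma even_count_even_cells:
  assumes "i \<ge> 1"
  shows "even (count (mset cs) (2 * i, 0))"
proof -
  obtain j where j: "2 * i = Suc j" using assms by (cases "2 * i") auto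
  then have "odd j" by presburger
  then have "even (dim (range (u ^^ j)))" "even (dim (range (u ^^ Suc (Suc j))))"
    using even_rank_odd_power[OF b u skew char2, of j] even_rank_odd_power[OF b u skew char2, of "Suc (Suc j)"]
    by (simp_all del: funpow.simps)
  then have "even (count (mset cs) (Suc j, 0) + 2 * dim (range (u ^^ Suc j)))"
    unfolding count_cells_rank by simp
  then show ?thesis unfolding j by simp
qed

text \<open>The rank drops from \<open>u\<^sup>2\<^sup>k\<^sup>+\<^sup>1\<close>, a skew map, to \<open>u\<^sup>2\<^sup>k\<^sup>+\<^sup>2\<close> by the number of cells of size at least \<open>2 k + 2\<close> for the
  eigenvalue 0, and among these the cells of even size are even in number.\<close>

lemma even_odd_tail_iff: "even (odd_tail (mset cs) k) \<longleftrightarrow> even (dim (range (u ^^ (2 * k + 2))))"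
proof -
  let ?E = "{#x \<in># mset cs. snd x = 0 \<and> even (fst x) \<and> fst x > 2 * k + 1#}"
  let ?T = "{#x \<in># mset cs. snd x = 0 \<and> fst x > 2 * k + 1#}"
  have "even (size ?E)"
  proof (rule even_size_filter_mset)
    fix x :: "nat \<times> 'a" assume x: "snd x = 0 \<and> even (fst x) \<and> fst x > 2 * k + 1"
    then obtain i where i: "fst x = 2 * i" by (auto elim: evenE)
    then have "x = (2 * i, 0)" "i \<ge> 1" using x by (auto simp: prod_eq_iff)
    then show "even (count (mset cs) x)" using even_count_even_cells by simp
  qed
  moreover have "size ?T = size ?E + odd_tail (mset cs) k"
    unfolding odd_tail_def by (induction cs) auto
  ultimately have T: "even (size ?T) \<longleftrightarrow> even (odd_tail (mset cs) k)" by simp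
  have "even (dim (range (u ^^ (2 * k + 1))))"
    by (rule even_rank_odd_power[OF b u skew char2]) simp
  moreover have "dim (range (u ^^ (2 * k + 1))) = dim (range (u ^^ (2 * k + 2))) + size ?T"
    using rank_power_tail[of "2 * k + 1"] by (simp del: funpow.simps)
  ultimately have "even (dim (range (u ^^ (2 * k + 2))) + size ?T)" by (simp only:)
  then show ?thesis unfolding T[symmetric] by (simp del: funpow.simps)
qed

end

end

end

context square_zero_sum
begin

lemma even_nonzero_cells:
  assumes "jordan_cells scale u cs" "l \<noteq> 0" "k \<ge> 1"
  shows "even (count (mset cs) (k, l))"
  by (rule even_counts_if_even_kernel_dims[OF u_endo assms(1) even_kernel_dim_power[OF assms(2)] assms(3)])

text \<open>Without cells of size \<open>2 k + 1\<close> the ranks of \<open>u\<^sup>2\<^sup>k\<close> and \<open>u\<^sup>2\<^sup>k\<^sup>+\<^sup>2\<close> have the same parity, and the former is even.\<close>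

lemma odd_tail_imp_cell:
  assumes cs: "jordan_cells scale u cs" and odd: "odd (odd_tail (mset cs) k)"
  shows "count (mset cs) (2 * k + 1, 0) > 0"
proof (rule ccontr)
  assume "\<not> ?thesis"
  then have 0: "count (mset cs) (Suc (2 * k), 0) = 0" by simp
  let ?r = "\<lambda>k. dim (range (u ^^ k))"
  have eq: "2 * ?r (Suc (2 * k)) = ?r (2 * k) + ?r (Suc (Suc (2 * k)))"
    using count_cells_rank[OF u_endo cs, of "2 * k"] 0 by simp
  have "dim {x \<in> range (u ^^ (2 * k)). u x = 0} = dim {x \<in> range (u ^^ (2 * k + 1)). u x = 0}"
    using kernel_on_range_power[OF u_endo cs, of "2 * k"] kernel_on_range_power[OF u_endo cs, of "Suc (2 * k)"] eq
    by (simp del: funpow.simps)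
  then have "even (?r (2 * k))" by (rule even_rank_even_power)
  moreover have "even (?r (2 * k) + ?r (Suc (Suc (2 * k))))" unfolding eq[symmetric] by simp
  ultimately have "even (?r (2 * k + 2))" by (simp del: funpow.simps)
  then show False
    using even_odd_tail_iff[OF u_endo cs b(1,2) _ u_skew char2, of k] b(3) odd by blast
qed

end

section \<open>Matrices that split for some form\<close>

abbreviation direct_sum_mat :: "'a::zero mat \<Rightarrow> 'a mat \<Rightarrow> 'a mat" (infixr "\<oplus>\<^sub>m" 65) where
  "A \<oplus>\<^sub>m B \<equiv> four_block_mat A (0\<^sub>m (dim_row A) (dim_col B)) (0\<^sub>m (dim_row B) (dim_col A)) B"

lemma mult_block_mat:
  assumes "A1 \<in> carrier_mat n n" "B1 \<in> carrier_mat n m" "C1 \<in> carrier_mat m n" "D1 \<in> carrier_mat m m"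
    and "A2 \<in> carrier_mat n n" "B2 \<in> carrier_mat n m" "C2 \<in> carrier_mat m n" "D2 \<in> carrier_mat m m"
  shows "four_block_mat A1 B1 C1 D1 * four_block_mat A2 B2 C2 D2
    = four_block_mat (A1 * A2 + B1 * C2) (A1 * B2 + B1 * D2) (C1 * A2 + D1 * C2) (C1 * B2 + D1 * D2)"
  using assms by (rule mult_four_block_mat)

text \<open>A decomposition \<open>A = A\<^sub>1 + A\<^sub>2\<close> into square-zero matrices is encoded by \<open>Z = A\<^sub>1 - A\<^sub>2\<close>: the matrices \<open>(A + Z) / 2\<close> and
  \<open>(A - Z) / 2\<close> have square zero exactly if \<open>Z\<^sup>2 = - A\<^sup>2\<close> and \<open>Z\<close> anticommutes with \<open>A\<close>. The matrix \<open>S\<close> is the Gram matrix of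
  a symmetric form, nondegenerate because of the left inverse \<open>T\<close>, for which \<open>A\<close> and \<open>Z\<close> are skew.\<close>

definition skew_splittable :: "'a::field mat \<Rightarrow> bool" where
  "skew_splittable A \<longleftrightarrow> (\<exists>n S T Z. {A, S, T, Z} \<subseteq> carrier_mat n n \<and>
     transpose_mat S = S \<and> T * S = 1\<^sub>m n \<and>
     S * A + transpose_mat A * S = 0\<^sub>m n n \<and> S * Z + transpose_mat Z * S = 0\<^sub>m n n \<and>
     Z * Z + A * A = 0\<^sub>m n n \<and> A * Z + Z * A = 0\<^sub>m n n)"

lemma skew_splittable_direct_sum:
  assumes "skew_splittable A" "skew_splittable B"
  shows "skew_splittable (A \<oplus>\<^sub>m B)"
proof -
  obtain n S T Z where A: "{A, S, T, Z} \<subseteq> carrier_mat n n" and 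
    a: "transpose_mat S = S" "T * S = 1\<^sub>m n" "S * A + transpose_mat A * S = 0\<^sub>m n n"
    "S * Z + transpose_mat Z * S = 0\<^sub>m n n" "Z * Z + A * A = 0\<^sub>m n n" "A * Z + Z * A = 0\<^sub>m n n"
    using assms(1) unfolding skew_splittable_def by blast
  obtain m S' T' Z' where B: "{B, S', T', Z'} \<subseteq> carrier_mat m m" and
    b: "transpose_mat S' = S'" "T' * S' = 1\<^sub>m m" "S' * B + transpose_mat B * S' = 0\<^sub>m m m"
    "S' * Z' + transpose_mat Z' * S' = 0\<^sub>m m m" "Z' * Z' + B * B = 0\<^sub>m m m" "B * Z' + Z' * B = 0\<^sub>m m m"
    using assms(2) unfolding skew_splittable_def by blast
  have AC: "A \<in> carrier_mat n n" "S \<in> carrier_mat n n" "T \<in> carrier_mat n n" "Z \<in> carrier_mat n n" using A by auto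
  have BC: "B \<in> carrier_mat m m" "S' \<in> carrier_mat m m" "T' \<in> carrier_mat m m" "Z' \<in> carrier_mat m m" using B by auto
  have dims: "dim_row A = n" "dim_col A = n" "dim_row B = m" "dim_col B = m" using AC BC by auto
  let ?D = "\<lambda>X Y. four_block_mat X (0\<^sub>m n m) (0\<^sub>m m n) Y :: 'a mat"
  have mult: "?D X Y * ?D X' Y' = ?D (X * X') (Y * Y')"
    if "X \<in> carrier_mat n n" "X' \<in> carrier_mat n n" "Y \<in> carrier_mat m m" "Y' \<in> carrier_mat m m" for X X' Y Y'
    using that by (subst mult_block_mat[of _ n _ m]) auto
  have add: "?D X Y + ?D X' Y' = ?D (X + X') (Y + Y')"
    if "X \<in> carrier_mat n n" "X' \<in> carrier_mat n n" "Y \<in> carrier_mat m m" "Y' \<in> carrier_mat m m" for X X' Y Y'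
    using that by (subst add_four_block_mat[of _ n n _ m _ m]) auto
  have tr: "transpose_mat (?D X Y) = ?D (transpose_mat X) (transpose_mat Y)"
    if "X \<in> carrier_mat n n" "Y \<in> carrier_mat m m" for X Y
    using that by (subst transpose_four_block_mat[of _ n n _ m _ m]) auto
  show ?thesis
    unfolding skew_splittable_def dims
    by (rule exI[of _ "n + m"], rule exI[of _ "?D S S'"], rule exI[of _ "?D T T'"], rule exI[of _ "?D Z Z'"])
       (use AC BC in \<open>simp add: mult add tr a b\<close>)
qed

text \<open>On two copies of a space with a nondegenerate bilinear form \<open>W\<close>, pairing the first copy with the second through \<open>W\<close>
  gives a symmetric form. This reduces the search for a symmetric form to the search for an arbitrary form \<open>W\<close>.
  The sign \<open>c\<close> allows \<open>Z\<close> to act with opposite signs on the two copies.\<close>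

lemma skew_splittable_double:
  fixes A :: "'a::field mat"
  assumes C: "{A, Z, W, V} \<subseteq> carrier_mat n n"
    and inv: "V * W = 1\<^sub>m n" "W * V = 1\<^sub>m n"
    and skew: "W * A + transpose_mat A * W = 0\<^sub>m n n" "W * (c \<cdot>\<^sub>m Z) + transpose_mat Z * W = 0\<^sub>m n n"
    and sq: "Z * Z + A * A = 0\<^sub>m n n"
    and comm: "A * Z + Z * A = 0\<^sub>m n n"
    and c: "c * c = 1"
  shows "skew_splittable (A \<oplus>\<^sub>m A)"
proof -
  have AC [simp]: "A \<in> carrier_mat n n" "Z \<in> carrier_mat n n" "W \<in> carrier_mat n n" "V \<in> carrier_mat n n"
    using C by auto
  have sq': "(c \<cdot>\<^sub>m Z) * (c \<cdot>\<^sub>m Z) + A * A = 0\<^sub>m n n"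
  proof -
    have "(c \<cdot>\<^sub>m Z) * (c \<cdot>\<^sub>m Z) = c \<cdot>\<^sub>m (c \<cdot>\<^sub>m (Z * Z))"
      by (simp add: mult_smult_assoc_mat[of _ n n _ n] mult_smult_distrib[of _ n n _ n])
    also have "\<dots> = Z * Z"
      by (rule eq_matI) (simp_all add: mult.assoc[symmetric] c)
    finally have "(c \<cdot>\<^sub>m Z) * (c \<cdot>\<^sub>m Z) = Z * Z" .
    then show ?thesis using sq by simp
  qed
  have comm': "A * (c \<cdot>\<^sub>m Z) + (c \<cdot>\<^sub>m Z) * A = 0\<^sub>m n n"
  proof -
    have "A * (c \<cdot>\<^sub>m Z) + (c \<cdot>\<^sub>m Z) * A = c \<cdot>\<^sub>m (A * Z + Z * A)"
      using add_smult_distrib_left_mat[of "A * Z" n n "Z * A" c] mult_carrier_mat[of A n n Z n] mult_carrier_mat[of Z n n A n]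
      by (simp add: mult_smult_assoc_mat[of _ n n _ n] mult_smult_distrib[of _ n n _ n])
    then show ?thesis unfolding comm by auto
  qed
  have dims: "dim_row A = n" "dim_col A = n" using carrier_matD[OF AC(1)] by auto
  have inv': "transpose_mat V * transpose_mat W = 1\<^sub>m n"
    using inv(2) transpose_mult[of W n n V n] by simp
  have flip: "transpose_mat W * X + transpose_mat Y * transpose_mat W = 0\<^sub>m n n"
    if XY: "X \<in> carrier_mat n n" "Y \<in> carrier_mat n n" and 0: "W * Y + transpose_mat X * W = 0\<^sub>m n n" for X Y
  proof -
    have "transpose_mat (W * Y + transpose_mat X * W) = transpose_mat Y * transpose_mat W + transpose_mat W * X"
      using transpose_add[of "W * Y" n n "transpose_mat X * W"] transpose_mult[of W n n Y n]
        transpose_mult[of "transpose_mat X" n n W n] mult_carrier_mat[of W n n Y n]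
        mult_carrier_mat[of "transpose_mat X" n n W n] XY by simp
    moreover have "transpose_mat Y * transpose_mat W + transpose_mat W * X = transpose_mat W * X + transpose_mat Y * transpose_mat W"
      using XY by (intro comm_add_mat[of _ n n] mult_carrier_mat[of _ n n]) auto
    ultimately show ?thesis using 0 by simp
  qed
  let ?O = "0\<^sub>m n n :: 'a mat"
  let ?S = "four_block_mat ?O W (transpose_mat W) ?O"
  let ?T = "four_block_mat ?O (transpose_mat V) V ?O"
  let ?Z = "four_block_mat Z ?O ?O (c \<cdot>\<^sub>m Z)"
  note block = mult_block_mat[of _ n _ n] add_four_block_mat[of _ n n _ n _ n] transpose_four_block_mat[of _ n n _ n _ n]
  show ?thesis
    unfolding skew_splittable_def dims
    by (rule exI[of _ "n + n"], rule exI[of _ ?S], rule exI[of _ ?T], rule exI[of _ ?Z])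
       (simp add: block mult_carrier_mat[where n = n] left_mult_zero_mat[of _ n n] right_mult_zero_mat[of _ n n]
          inv inv' skew sq sq' comm comm' flip)
qed

section \<open>Models for groups of Jordan cells\<close>

text \<open>The form for which a nilpotent Jordan block is skew: it pairs the basis vectors of complementary index, with
  alternating signs.\<close>

definition alternating_antidiag :: "nat \<Rightarrow> 'a::comm_ring_1 mat" where
  "alternating_antidiag k = mat k k (\<lambda>(i, j). if i + j + 1 = k then (- 1) ^ j else 0)"

text \<open>Conjugation by this matrix changes the sign of the nilpotent part of a Jordan block and keeps its diagonal.\<close>

definition alternating_diag :: "nat \<Rightarrow> 'a::comm_ring_1 mat" where
  "alternating_diag k = mat k k (\<lambda>(i, j). if i = j then (- 1) ^ j else 0)"

lemma alternating_carrier [simp]: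
  "alternating_antidiag k \<in> carrier_mat k k" "alternating_diag k \<in> carrier_mat k k"
  by (simp_all add: alternating_antidiag_def alternating_diag_def)

lemma alternating_dim [simp]:
  "dim_row (alternating_antidiag k) = k" "dim_col (alternating_antidiag k) = k"
  "dim_row (alternating_diag k) = k" "dim_col (alternating_diag k) = k"
  by (simp_all add: alternating_antidiag_def alternating_diag_def)

lemma alternating_index [simp]:
  "i < k \<Longrightarrow> j < k \<Longrightarrow> alternating_antidiag k $$ (i, j) = (if i + j + 1 = k then (- 1) ^ j else 0)"
  "i < k \<Longrightarrow> j < k \<Longrightarrow> alternating_diag k $$ (i, j) = (if i = j then (- 1) ^ j else 0)"
  by (simp_all add: alternating_antidiag_def alternating_diag_def)

lemma sum_single:
  assumes "i < (k :: nat)" "\<And>j. j < k \<Longrightarrow> j \<noteq> i \<Longrightarrow> f j = 0"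
  shows "(\<Sum>j\<in>{0..<k}. f j) = (f i :: 'a::comm_monoid_add)"
proof -
  have "(\<Sum>j\<in>{0..<k}. f j) = (\<Sum>j\<in>{i}. f j)"
    by (rule sum.mono_neutral_right) (use assms in auto)
  then show ?thesis by simp
qed

lemma index_mult_sum:
  "A \<in> carrier_mat n k \<Longrightarrow> B \<in> carrier_mat k m \<Longrightarrow> i < n \<Longrightarrow> j < m \<Longrightarrow>
    (A * B) $$ (i, j) = (\<Sum>l\<in>{0..<k}. A $$ (i, l) * B $$ (l, j))"
  by (auto simp: scalar_prod_def)

lemma antidiag_mult_index:
  assumes "A \<in> carrier_mat k m" "i < k" "j < m"
  shows "(alternating_antidiag k * A) $$ (i, j) = (- 1) ^ (k - 1 - i) * A $$ (k - 1 - i, j)"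
proof -
  have "(alternating_antidiag k * A) $$ (i, j) = (\<Sum>l\<in>{0..<k}. alternating_antidiag k $$ (i, l) * A $$ (l, j))"
    using assms by (intro index_mult_sum) auto
  also have "\<dots> = alternating_antidiag k $$ (i, k - 1 - i) * A $$ (k - 1 - i, j)"
    using assms by (intro sum_single) (auto simp: alternating_antidiag_def)
  finally show ?thesis using assms by (simp add: alternating_antidiag_def)
qed

lemma mult_antidiag_index:
  assumes "A \<in> carrier_mat m k" "i < m" "j < k"
  shows "(A * alternating_antidiag k) $$ (i, j) = A $$ (i, k - 1 - j) * (- 1) ^ j"
proof -
  have "(A * alternating_antidiag k) $$ (i, j) = (\<Sum>l\<in>{0..<k}. A $$ (i, l) * alternating_antidiag k $$ (l, j))"
    using assms by (intro index_mult_sum) auto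
  also have "\<dots> = A $$ (i, k - 1 - j) * alternating_antidiag k $$ (k - 1 - j, j)"
    using assms by (intro sum_single) (auto simp: alternating_antidiag_def)
  finally show ?thesis using assms by (simp add: alternating_antidiag_def)
qed

lemma mult_diag_index:
  assumes "A \<in> carrier_mat m k" "i < m" "j < k"
  shows "(A * alternating_diag k) $$ (i, j) = A $$ (i, j) * (- 1) ^ j"
proof -
  have "(A * alternating_diag k) $$ (i, j) = (\<Sum>l\<in>{0..<k}. A $$ (i, l) * alternating_diag k $$ (l, j))"
    using assms by (intro index_mult_sum) auto
  also have "\<dots> = A $$ (i, j) * alternating_diag k $$ (j, j)"
    using assms by (intro sum_single) (auto simp: alternating_diag_def)
  finally show ?thesis using assms by (simp add: alternating_diag_def)
qed

lemma diag_mult_index: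
  assumes "A \<in> carrier_mat k m" "i < k" "j < m"
  shows "(alternating_diag k * A) $$ (i, j) = (- 1) ^ i * A $$ (i, j)"
proof -
  have "(alternating_diag k * A) $$ (i, j) = (\<Sum>l\<in>{0..<k}. alternating_diag k $$ (i, l) * A $$ (l, j))"
    using assms by (intro index_mult_sum) auto
  also have "\<dots> = alternating_diag k $$ (i, i) * A $$ (i, j)"
    using assms by (intro sum_single) (auto simp: alternating_diag_def)
  finally show ?thesis using assms by (simp add: alternating_diag_def)
qed

lemma antidiag_inverse:
  "alternating_antidiag k * transpose_mat (alternating_antidiag k) = (1\<^sub>m k :: 'a::comm_ring_1 mat)"
  "transpose_mat (alternating_antidiag k) * alternating_antidiag k = (1\<^sub>m k :: 'a::comm_ring_1 mat)"
proof -
  show "alternating_antidiag k * transpose_mat (alternating_antidiag k) = (1\<^sub>m k :: 'a::comm_ring_1 mat)"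
    by (rule eq_matI) (auto simp: antidiag_mult_index[of _ k k] minus_one_power_iff simp del: index_mult_mat(1))
  show "transpose_mat (alternating_antidiag k) * alternating_antidiag k = (1\<^sub>m k :: 'a::comm_ring_1 mat)"
    by (rule eq_matI) (auto simp: mult_antidiag_index[of _ k k] minus_one_power_iff simp del: index_mult_mat(1))
qed

lemma transpose_antidiag: "odd k \<Longrightarrow> transpose_mat (alternating_antidiag k) = alternating_antidiag k"
  by (rule eq_matI) (auto simp: alternating_antidiag_def minus_one_power_iff)

lemma diag_diag: "alternating_diag k * alternating_diag k = (1\<^sub>m k :: 'a::comm_ring_1 mat)"
  by (rule eq_matI) (auto simp: diag_mult_index[of _ k k] minus_one_power_iff simp del: index_mult_mat(1))

lemma diag_jordan_block:
  "alternating_diag k * jordan_block k (- l) = - (jordan_block k (l :: 'a::comm_ring_1) * alternating_diag k)"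
  by (rule eq_matI) (auto simp: diag_mult_index[of _ k k] mult_diag_index[of _ k k] simp del: index_mult_mat(1))

lemma antidiag_jordan_block:
  "alternating_antidiag k * jordan_block k (- l) + transpose_mat (jordan_block k l) * alternating_antidiag k = (0\<^sub>m k k :: 'a::comm_ring_1 mat)"
proof (rule eq_matI)
  fix i j assume "i < dim_row (0\<^sub>m k k :: 'a mat)" "j < dim_col (0\<^sub>m k k :: 'a mat)"
  then have ij: "i < k" "j < k" by auto
  have "j = k - Suc i \<longleftrightarrow> i = k - Suc j" "Suc (k - Suc i) = j \<longleftrightarrow> Suc (k - Suc j) = i" using ij by auto
  then show "(alternating_antidiag k * jordan_block k (- l) + transpose_mat (jordan_block k l) * alternating_antidiag k) $$ (i, j)
      = (0\<^sub>m k k :: 'a mat) $$ (i, j)"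
    using ij by (auto simp: antidiag_mult_index[of _ k k] mult_antidiag_index[of _ k k] minus_one_power_iff simp del: index_mult_mat(1))
qed auto

abbreviation twisted_block :: "nat \<Rightarrow> 'a::comm_ring_1 \<Rightarrow> 'a mat" where
  "twisted_block k l \<equiv> jordan_block k l * alternating_diag k"

lemma twisted_block_carrier [simp]: "twisted_block k l \<in> carrier_mat k k"
  by (rule mult_carrier_mat) auto

lemma jordan_twisted:
  fixes l :: "'a::comm_ring_1"
  shows "jordan_block k l * twisted_block k l + twisted_block k l * jordan_block k (- l) = 0\<^sub>m k k"
    "twisted_block k l * twisted_block k (- l) + jordan_block k l * jordan_block k l = 0\<^sub>m k k"
proof -
  let ?L = "jordan_block k l" and ?L' = "jordan_block k (- l)" and ?D = "alternating_diag k :: 'a mat"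
  have [simp]: "- X \<in> carrier_mat k k" if "X \<in> carrier_mat k k" for X :: "'a mat" using that by simp
  have "?L * ?D * ?L' = ?L * (?D * ?L')" by (rule assoc_mult_mat) auto
  also have "\<dots> = - (?L * (?L * ?D))" unfolding diag_jordan_block by (simp add: uminus_mult_right_mat)
  finally have 1: "?L * ?D * ?L' = - (?L * (?L * ?D))" .
  show "?L * (?L * ?D) + ?L * ?D * ?L' = 0\<^sub>m k k"
    unfolding 1 by (rule eq_matI) auto
  have "?L * ?D * (?L' * ?D) = ?L * ?D * ?L' * ?D"
    by (rule assoc_mult_mat[symmetric, of _ k k _ k _ k]) auto
  also have "\<dots> = - (?L * (?L * ?D) * ?D)" unfolding 1 by (rule uminus_mult_left_mat) auto
  also have "?L * (?L * ?D) * ?D = ?L * (?L * (?D * ?D))"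
    by (simp add: assoc_mult_mat[of _ k k _ k _ k])
  finally have 2: "?L * ?D * (?L' * ?D) = - (?L * ?L)"
    by (simp add: diag_diag)
  show "?L * ?D * (?L' * ?D) + ?L * ?L = 0\<^sub>m k k"
    unfolding 2 by (rule eq_matI) auto
qed

lemma antidiag_twisted:
  fixes l :: "'a::comm_ring_1"
  shows "alternating_antidiag k * ((- 1) ^ k \<cdot>\<^sub>m twisted_block k l) + transpose_mat (twisted_block k l) * alternating_antidiag k = 0\<^sub>m k k"
proof (rule eq_matI)
  fix i j assume "i < dim_row (0\<^sub>m k k :: 'a mat)" "j < dim_col (0\<^sub>m k k :: 'a mat)"
  then have ij: "i < k" "j < k" by auto
  have eq: "j = k - Suc i \<longleftrightarrow> i = k - Suc j" "Suc (k - Suc i) = j \<longleftrightarrow> Suc (k - Suc j) = i" using ij by auto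
  have tb: "twisted_block k l $$ (p, q) = jordan_block k l $$ (p, q) * (- 1) ^ q" if "p < k" "q < k" for p q
    using that by (intro mult_diag_index) auto
  have e1: "(alternating_antidiag k * ((- 1) ^ k \<cdot>\<^sub>m twisted_block k l)) $$ (i, j)
      = (- 1) ^ (k - 1 - i) * ((- 1) ^ k * twisted_block k l $$ (k - 1 - i, j))"
    using ij by (subst antidiag_mult_index[of _ k k]) (auto simp del: index_mult_mat(1))
  have e2: "(transpose_mat (twisted_block k l) * alternating_antidiag k) $$ (i, j)
      = twisted_block k l $$ (k - 1 - j, i) * (- 1) ^ j"
    using ij by (subst mult_antidiag_index[of _ k k]) (auto simp del: index_mult_mat(1))
  have "(alternating_antidiag k * ((- 1) ^ k \<cdot>\<^sub>m twisted_block k l)) $$ (i, j)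
      + (transpose_mat (twisted_block k l) * alternating_antidiag k) $$ (i, j) = 0"
    unfolding e1 e2 using ij eq by (auto simp: tb minus_one_power_iff simp del: index_mult_mat(1))
  then show "(alternating_antidiag k * ((- 1) ^ k \<cdot>\<^sub>m twisted_block k l) + transpose_mat (twisted_block k l) * alternating_antidiag k) $$ (i, j)
      = (0\<^sub>m k k :: 'a mat) $$ (i, j)"
    using ij by (simp del: index_mult_mat(1))
qed auto


lemma minus_one_power_square: "(- 1) ^ k * (- 1) ^ k = (1 :: 'a::comm_ring_1)"
  by (simp add: power_add[symmetric])

text \<open>For \<open>l = 0\<close> the block \<open>J\<close> and the alternating diagonal matrix anticommute, so their product can serve as \<open>Z\<close>.\<close>

lemma skew_splittable_zero_pair:
  "skew_splittable (jordan_block k (0 :: 'a::field) \<oplus>\<^sub>m jordan_block k 0)"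
  by (rule skew_splittable_double[where Z = "twisted_block k 0" and W = "alternating_antidiag k"
        and V = "transpose_mat (alternating_antidiag k)" and c = "(- 1) ^ k" and n = k])
     (use antidiag_jordan_block[of k "0 :: 'a"] jordan_twisted[of k "0 :: 'a"] in
       \<open>simp_all add: antidiag_inverse antidiag_twisted minus_one_power_square\<close>)

text \<open>On the sum of the blocks \<open>L\<close> for \<open>l\<close> and \<open>L'\<close> for \<open>- l\<close>, let \<open>D\<close> be the alternating diagonal matrix placed off the
  diagonal. It anticommutes with \<open>L \<oplus> L'\<close> because \<open>D L' = - L D\<close> on blocks, and \<open>Z\<close> is the product of the two. For
  the pairing of \<open>L\<close> with \<open>L'\<close> through \<open>alternating_antidiag\<close>, either the symmetry of the form or the skewness of \<open>Z\<close> fails, depending on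
  the parity of \<open>k\<close>; doubling repairs both.\<close>

lemma skew_splittable_quadruple:
  fixes l :: "'a::field"
  shows "skew_splittable ((jordan_block k l \<oplus>\<^sub>m jordan_block k (- l)) \<oplus>\<^sub>m (jordan_block k l \<oplus>\<^sub>m jordan_block k (- l)))"
proof -
  let ?O = "0\<^sub>m k k :: 'a mat" and ?W = "alternating_antidiag k :: 'a mat" and ?c = "(- 1) ^ k :: 'a"
  let ?Z = "four_block_mat ?O (twisted_block k l) (twisted_block k (- l)) ?O"
  note block = mult_block_mat[of _ k _ k] add_four_block_mat[of _ k k _ k _ k] transpose_four_block_mat[of _ k k _ k _ k]
  have smult: "?c \<cdot>\<^sub>m ?Z = four_block_mat ?O (?c \<cdot>\<^sub>m twisted_block k l) (?c \<cdot>\<^sub>m twisted_block k (- l)) ?O"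
    by (rule eq_matI) auto
  show ?thesis
    by (rule skew_splittable_double[where Z = ?Z and W = "four_block_mat ?O ?W ?W ?O"
          and V = "four_block_mat ?O (transpose_mat ?W) (transpose_mat ?W) ?O" and c = ?c and n = "k + k"])
       (use antidiag_jordan_block[of k l] jordan_twisted[of k l]
            antidiag_jordan_block[of k "- l"] jordan_twisted[of k "- l"] in
        \<open>simp_all add: smult block mult_carrier_mat[where n = k] antidiag_inverse antidiag_twisted minus_one_power_square\<close>)
qed

text \<open>Number the levels of the large cell, with basis vectors \<open>c\<^sub>i\<close>, from \<open>0\<close> to \<open>s + 1\<close>, and those of the small cell, with
  basis vectors \<open>d\<^sub>i\<close>, from \<open>1\<close> to \<open>s\<close>. The two ladder matrices describe the map \<open>Z\<close> that lowers the level by one, changes the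
  cell and multiplies by \<open>(- 1)\<^sup>i\<close> at level \<open>i\<close>. Matrix indices start at 0, so index \<open>j\<close> of the small cell is level \<open>j + 1\<close>.\<close>

definition ladder_up :: "nat \<Rightarrow> 'a::comm_ring_1 mat" where
  "ladder_up s = mat (s + 2) s (\<lambda>(i, j). if i = j then (- 1) ^ (j + 1) else 0)"

definition ladder_down :: "nat \<Rightarrow> 'a::comm_ring_1 mat" where
  "ladder_down s = mat s (s + 2) (\<lambda>(i, j). if j = i + 2 then (- 1) ^ j else 0)"

lemma ladder_carrier [simp]:
  "ladder_up s \<in> carrier_mat (s + 2) s" "ladder_down s \<in> carrier_mat s (s + 2)"
  "dim_row (ladder_up s) = s + 2" "dim_col (ladder_up s) = s"
  "dim_row (ladder_down s) = s" "dim_col (ladder_down s) = s + 2"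
  by (simp_all add: ladder_up_def ladder_down_def)

lemma shift_mult_index:
  fixes A :: "'a::comm_ring_1 mat"
  assumes "A \<in> carrier_mat k m" "i < k" "j < m"
  shows "(jordan_block k 0 * A) $$ (i, j) = (if i + 1 < k then A $$ (i + 1, j) else 0)"
proof -
  have *: "(jordan_block k 0 * A) $$ (i, j) = (\<Sum>l\<in>{0..<k}. jordan_block k 0 $$ (i, l) * A $$ (l, j))"
    using assms by (intro index_mult_sum) auto
  show ?thesis
  proof (cases "i + 1 < k")
    case True
    then have "(\<Sum>l\<in>{0..<k}. jordan_block k 0 $$ (i, l) * A $$ (l, j)) = jordan_block k 0 $$ (i, i + 1) * A $$ (i + 1, j)"
      using assms by (intro sum_single) auto
    then show ?thesis using * True assms by simp
  next
    case False
    then have "(\<Sum>l\<in>{0..<k}. jordan_block k 0 $$ (i, l) * A $$ (l, j)) = 0"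
      using assms by (intro sum.neutral) auto
    then show ?thesis using * False by simp
  qed
qed

lemma ladder_relations:
  fixes s :: nat
  defines "X \<equiv> ladder_up s :: 'a::comm_ring_1 mat" and "Y \<equiv> ladder_down s :: 'a mat"
    and "J \<equiv> jordan_block (s + 2) (0 :: 'a)" and "J' \<equiv> jordan_block s (0 :: 'a)"
  shows "X * Y + J * J = 0\<^sub>m (s + 2) (s + 2)" "Y * X + J' * J' = 0\<^sub>m s s"
    "J * X + X * J' = 0\<^sub>m (s + 2) s" "J' * Y + Y * J = 0\<^sub>m s (s + 2)"
proof -
  have C: "X \<in> carrier_mat (s + 2) s" "Y \<in> carrier_mat s (s + 2)" "J \<in> carrier_mat (s + 2) (s + 2)" "J' \<in> carrier_mat s s"
    by (simp_all only: X_def Y_def J_def J'_def ladder_carrier jordan_block_carrier)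
  have iX: "X $$ (i, j) = (if i = j then (- 1) ^ (j + 1) else 0)" if "i < s + 2" "j < s" for i j
    using that by (simp add: X_def ladder_up_def)
  have iY: "Y $$ (i, j) = (if j = i + 2 then (- 1) ^ j else 0)" if "i < s" "j < s + 2" for i j
    using that by (simp add: Y_def ladder_down_def)
  have XA: "(X * A) $$ (i, j) = (if i < s then (- 1) ^ (i + 1) * A $$ (i, j) else 0)"
    if "A \<in> carrier_mat s m" "i < s + 2" "j < m" for A m i j
  proof -
    have *: "(X * A) $$ (i, j) = (\<Sum>l\<in>{0..<s}. X $$ (i, l) * A $$ (l, j))"
      using that C by (intro index_mult_sum) auto
    show ?thesis
    proof (cases "i < s")
      case True
      then have "(\<Sum>l\<in>{0..<s}. X $$ (i, l) * A $$ (l, j)) = X $$ (i, i) * A $$ (i, j)"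
        by (intro sum_single) (auto simp: iX)
      then show ?thesis using * True by (simp add: iX)
    next
      case False
      then have "(\<Sum>l\<in>{0..<s}. X $$ (i, l) * A $$ (l, j)) = 0"
        using that by (intro sum.neutral) (auto simp: iX)
      then show ?thesis using * False by simp
    qed
  qed
  have YA: "(Y * A) $$ (i, j) = (- 1) ^ i * A $$ (i + 2, j)"
    if "A \<in> carrier_mat (s + 2) m" "i < s" "j < m" for A m i j
  proof -
    have "(Y * A) $$ (i, j) = (\<Sum>l\<in>{0..<s + 2}. Y $$ (i, l) * A $$ (l, j))"
      using that C by (intro index_mult_sum) auto
    also have "\<dots> = Y $$ (i, i + 2) * A $$ (i + 2, j)"
      using that by (intro sum_single) (auto simp: iY)
    finally show ?thesis using that by (simp add: iY)
  qed
  have Jm: "(J * A) $$ (i, j) = (if i + 1 < s + 2 then A $$ (i + 1, j) else 0)"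
    if "A \<in> carrier_mat (s + 2) m" "i < s + 2" "j < m" for A m i j
    unfolding J_def by (rule shift_mult_index[OF that])
  have J'm: "(J' * A) $$ (i, j) = (if i + 1 < s then A $$ (i + 1, j) else 0)"
    if "A \<in> carrier_mat s m" "i < s" "j < m" for A m i j
    unfolding J'_def by (rule shift_mult_index[OF that])
  have dims: "dim_row X = s + 2" "dim_col X = s" "dim_row Y = s" "dim_col Y = s + 2"
    "dim_row J = s + 2" "dim_col J = s + 2" "dim_row J' = s" "dim_col J' = s"
    using C by auto
  have iJ: "J $$ (i, j) = (if Suc i = j then 1 else 0)" if "i < s + 2" "j < s + 2" for i j
    using that by (simp add: J_def)
  have iJ': "J' $$ (i, j) = (if Suc i = j then 1 else 0)" if "i < s" "j < s" for i j
    using that by (simp add: J'_def)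
  show "X * Y + J * J = 0\<^sub>m (s + 2) (s + 2)"
    by (rule eq_matI)
       (auto simp: dims XA[OF C(2)] Jm[OF C(3)] iY iJ simp del: index_mult_mat(1))
  show "Y * X + J' * J' = 0\<^sub>m s s"
    by (rule eq_matI)
       (auto simp: dims YA[OF C(1)] J'm[OF C(4)] iX iJ' minus_one_power_iff simp del: index_mult_mat(1))
  show "J * X + X * J' = 0\<^sub>m (s + 2) s"
    by (rule eq_matI)
       (auto simp: dims XA[OF C(4)] Jm[OF C(1)] iX iJ' simp del: index_mult_mat(1))
  show "J' * Y + Y * J = 0\<^sub>m s (s + 2)"
    by (rule eq_matI)
       (auto simp: dims YA[OF C(3)] J'm[OF C(2)] iY iJ simp del: index_mult_mat(1))
qed

lemma ladder_skew:
  fixes s p :: nat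
  assumes s: "odd s" and p: "p = s + 2"
  shows "alternating_antidiag p * ladder_up s + transpose_mat (ladder_down s) * alternating_antidiag s
      = (0\<^sub>m p s :: 'a::comm_ring_1 mat)"
    "alternating_antidiag s * ladder_down s + transpose_mat (ladder_up s) * alternating_antidiag p
      = (0\<^sub>m s p :: 'a::comm_ring_1 mat)"
proof -
  note C = ladder_carrier[of s, folded p]
  have index: "ladder_up s $$ (i, j) = (if i = j then (- 1) ^ (j + 1) else 0 :: 'a)"
      "ladder_down s $$ (j, i) = (if i = j + 2 then (- 1) ^ i else 0 :: 'a)" if "i < p" "j < s" for i j
    using that by (simp_all add: ladder_up_def ladder_down_def p)
  have tr: "transpose_mat (ladder_down s) \<in> carrier_mat p s" "transpose_mat (ladder_up s) \<in> carrier_mat s p"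
    by (simp_all only: transpose_carrier_mat C)
  show "alternating_antidiag p * ladder_up s + transpose_mat (ladder_down s) * alternating_antidiag s
      = (0\<^sub>m p s :: 'a mat)"
  proof (rule eq_matI)
    fix i j assume "i < dim_row (0\<^sub>m p s :: 'a mat)" "j < dim_col (0\<^sub>m p s :: 'a mat)"
    then have ij: "i < p" "j < s" by auto
    have "(alternating_antidiag p * ladder_up s) $$ (i, j) = (- 1) ^ (p - 1 - i) * (ladder_up s $$ (p - 1 - i, j) :: 'a)"
      by (rule antidiag_mult_index[OF C(1) ij])
    moreover have "(transpose_mat (ladder_down s) * alternating_antidiag s) $$ (i, j) = (ladder_down s $$ (s - 1 - j, i) :: 'a) * (- 1) ^ j"
      using ij C by (subst mult_antidiag_index[OF tr(1) ij]) simp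
    moreover have "(- 1) ^ (p - 1 - i) * (ladder_up s $$ (p - 1 - i, j) :: 'a) + ladder_down s $$ (s - 1 - j, i) * (- 1) ^ j = 0"
      using ij s p by (simp add: index) (auto simp: minus_one_power_iff)
    ultimately show "(alternating_antidiag p * ladder_up s + transpose_mat (ladder_down s) * alternating_antidiag s) $$ (i, j)
        = (0\<^sub>m p s :: 'a mat) $$ (i, j)"
      using ij C by (simp del: index_mult_mat(1))
  qed (use C in auto)
  show "alternating_antidiag s * ladder_down s + transpose_mat (ladder_up s) * alternating_antidiag p
      = (0\<^sub>m s p :: 'a mat)"
  proof (rule eq_matI)
    fix i j assume "i < dim_row (0\<^sub>m s p :: 'a mat)" "j < dim_col (0\<^sub>m s p :: 'a mat)"
    then have ij: "i < s" "j < p" by auto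
    have "(alternating_antidiag s * ladder_down s) $$ (i, j) = (- 1) ^ (s - 1 - i) * (ladder_down s $$ (s - 1 - i, j) :: 'a)"
      by (rule antidiag_mult_index[OF C(2) ij])
    moreover have "(transpose_mat (ladder_up s) * alternating_antidiag p) $$ (i, j) = (ladder_up s $$ (p - 1 - j, i) :: 'a) * (- 1) ^ j"
      using ij C by (subst mult_antidiag_index[OF tr(2) ij]) simp
    moreover have "(- 1) ^ (s - 1 - i) * (ladder_down s $$ (s - 1 - i, j) :: 'a) + ladder_up s $$ (p - 1 - j, i) * (- 1) ^ j = 0"
      using ij s p by (simp add: index) (auto simp: minus_one_power_iff)
    ultimately show "(alternating_antidiag s * ladder_down s + transpose_mat (ladder_up s) * alternating_antidiag p) $$ (i, j)
        = (0\<^sub>m s p :: 'a mat) $$ (i, j)"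
      using ij C by (simp del: index_mult_mat(1))
  qed (use C in auto)
qed

text \<open>In terms of square-zero summands: starting from the top vector \<open>e\<close>, two chains of \<open>s + 1\<close> steps apply
  \<open>a\<^sub>1, a\<^sub>2, a\<^sub>1, \<dots>\<close> and \<open>a\<^sub>2, a\<^sub>1, a\<^sub>2, \<dots>\<close> respectively and meet in one vector at the bottom. The sums of the two chains form
  the cell of size \<open>s + 2\<close>, their differences the cell of size \<open>s\<close>.\<close>

lemma skew_splittable_step_two:
  assumes "odd s"
  shows "skew_splittable (jordan_block (s + 2) (0 :: 'a::field) \<oplus>\<^sub>m jordan_block s 0)"
proof -
  define p where "p = s + 2"
  let ?D = "\<lambda>X Y. four_block_mat X (0\<^sub>m p s) (0\<^sub>m s p) Y :: 'a mat"
  let ?W = "alternating_antidiag p :: 'a mat" and ?V = "alternating_antidiag s :: 'a mat"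
  let ?Z = "four_block_mat (0\<^sub>m p p) (ladder_up s) (ladder_down s) (0\<^sub>m s s) :: 'a mat"
  have odd: "odd p" using assms by (simp add: p_def)
  note C = ladder_carrier(1,2)[of s, folded p_def]
  note block = mult_block_mat[of _ p _ s] add_four_block_mat[of _ p p _ s _ s]
    transpose_four_block_mat[of _ p p _ s _ s]
  note carrier = mult_carrier_mat[where n = p] mult_carrier_mat[where n = s]
  note zero = left_mult_zero_mat[of _ p p] left_mult_zero_mat[of _ p s] left_mult_zero_mat[of _ s p] left_mult_zero_mat[of _ s s]
    right_mult_zero_mat[of _ p p] right_mult_zero_mat[of _ p s] right_mult_zero_mat[of _ s p] right_mult_zero_mat[of _ s s]
  have S: "transpose_mat ?W = ?W" "transpose_mat ?V = ?V"
    using transpose_antidiag[OF odd] transpose_antidiag[OF assms] by blast+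
  have inv: "?W * ?W = 1\<^sub>m p" "?V * ?V = 1\<^sub>m s"
    using antidiag_inverse(1)[of p, where 'a = 'a] antidiag_inverse(1)[of s, where 'a = 'a] unfolding S by blast+
  have skew: "?W * jordan_block p 0 + transpose_mat (jordan_block p 0) * ?W = 0\<^sub>m p p"
     "?V * jordan_block s 0 + transpose_mat (jordan_block s 0) * ?V = 0\<^sub>m s s"
    using antidiag_jordan_block[of p "0 :: 'a"] antidiag_jordan_block[of s "0 :: 'a"] by simp_all
  have "skew_splittable (?D (jordan_block p 0) (jordan_block s 0))"
    unfolding skew_splittable_def
    by (rule exI[of _ "p + s"], rule exI[of _ "?D ?W ?V"], rule exI[of _ "?D ?W ?V"], rule exI[of _ ?Z])
       (simp add: C block carrier zero S inv skew ladder_relations[of s, folded p_def] ladder_skew[OF assms p_def] del: ladder_carrier)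
  then show ?thesis unfolding p_def by simp
qed

lemma skew_splittable_single: "skew_splittable (jordan_block 1 (0 :: 'a::field))"
proof -
  have "jordan_block 1 (0 :: 'a) = 0\<^sub>m 1 1" by (rule eq_matI) auto
  then show ?thesis
    unfolding skew_splittable_def
    by (intro exI[of _ 1] exI[of _ "1\<^sub>m 1"] exI[of _ "0\<^sub>m 1 1"]) auto
qed

lemma skew_splittable_empty: "skew_splittable (0\<^sub>m 0 0 :: 'a::field mat)"
  unfolding skew_splittable_def
  by (rule exI[of _ 0], rule exI[of _ "0\<^sub>m 0 0"], rule exI[of _ "0\<^sub>m 0 0"], rule exI[of _ "0\<^sub>m 0 0"]) auto

section \<open>Grouping the Jordan cells\<close>

lemma similar_direct_sum_swap:
  assumes A: "A \<in> carrier_mat n n" and B: "B \<in> carrier_mat m m"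
  shows "similar_mat (A \<oplus>\<^sub>m B) (B \<oplus>\<^sub>m A :: 'a::comm_ring_1 mat)"
proof -
  let ?P = "four_block_mat (0\<^sub>m n m) (1\<^sub>m n) (1\<^sub>m m) (0\<^sub>m m n) :: 'a mat"
  let ?Q = "four_block_mat (0\<^sub>m m n) (1\<^sub>m m) (1\<^sub>m n) (0\<^sub>m n m) :: 'a mat"
  let ?AB = "four_block_mat A (0\<^sub>m n m) (0\<^sub>m m n) B" and ?BA = "four_block_mat B (0\<^sub>m m n) (0\<^sub>m n m) A"
  have zero: "X * 0\<^sub>m c d = 0\<^sub>m r d" "0\<^sub>m d r * X = 0\<^sub>m d c" if "X \<in> carrier_mat r c" for X :: "'a mat" and r c d
    using that by auto
  have PQ: "?P * ?Q = 1\<^sub>m (n + m)" "?Q * ?P = 1\<^sub>m (m + n)"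
    by (subst mult_four_block_mat[of _ n m _ n _ m _ _ n _ m], auto)
       (subst mult_four_block_mat[of _ m n _ m _ n _ _ m _ n], auto)
  have PB: "?P * ?BA = four_block_mat (0\<^sub>m n m) A B (0\<^sub>m m n)"
    using A B by (subst mult_four_block_mat[of _ n m _ n _ m _ _ m _ n])
      (auto simp: zero[OF A] zero[OF B])
  have "four_block_mat (0\<^sub>m n m) A B (0\<^sub>m m n) * ?Q = ?AB"
    using A B by (subst mult_four_block_mat[of _ n m _ n _ m _ _ n _ m])
      (auto simp: zero[OF A] zero[OF B])
  then have eq: "?AB = ?P * ?BA * ?Q" using PB by simp
  have "similar_mat_wit ?AB ?BA ?P ?Q"
    by (rule similar_mat_witI[of _ _ "n + m"])
       (use PQ eq A B in \<open>auto simp: add.commute[of m n]\<close>)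
  then show ?thesis using A B unfolding similar_mat_def by auto
qed

lemma jordan_matrix_append: "jordan_matrix (cs @ ds) = jordan_matrix cs \<oplus>\<^sub>m jordan_matrix ds"
  by (simp add: jordan_matrix_def diag_block_mat_append Let_def)

lemma jordan_matrix_single: "jordan_matrix [(k, l)] = jordan_block k l"
  by (rule eq_matI) (simp_all add: jordan_matrix_def Let_def)

lemma similar_direct_sum:
  assumes "similar_mat A A'" "similar_mat B B'"
  shows "similar_mat (A \<oplus>\<^sub>m B) (A' \<oplus>\<^sub>m B')"
proof -
  obtain n where n: "A \<in> carrier_mat n n" "A' \<in> carrier_mat n n"
    using similar_matD[OF assms(1)] by auto
  obtain m where m: "B \<in> carrier_mat m m" "B' \<in> carrier_mat m m"
    using similar_matD[OF assms(2)] by auto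
  show ?thesis using similar_mat_four_block_0_0[OF assms n(1) m(1)] n m by simp
qed

lemma similar_jordan_matrix_refl: "similar_mat (jordan_matrix cs) (jordan_matrix cs :: 'a::comm_ring_1 mat)"
  by (rule similar_mat_refl[OF jordan_matrix_carrier])

text \<open>Moving one block past the others is a similarity, by \<open>similar_direct_sum_swap\<close>.\<close>

lemma similar_jordan_matrix_mset:
  "mset cs = mset ds \<Longrightarrow> similar_mat (jordan_matrix cs) (jordan_matrix ds :: 'a::comm_ring_1 mat)"
proof (induction cs arbitrary: ds)
  case Nil
  then show ?case using similar_jordan_matrix_refl[of "[]"] by simp
next
  case (Cons x cs)
  then have "x \<in> set ds" by (metis list.set_intros(1) set_mset_mset)
  then obtain ys zs where ds: "ds = ys @ x # zs" by (auto dest: split_list)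
  let ?J = "jordan_matrix :: _ \<Rightarrow> 'a mat"
  have "similar_mat (?J cs) (?J (ys @ zs))" using Cons ds by simp
  then have "similar_mat (?J [x] \<oplus>\<^sub>m ?J cs) (?J [x] \<oplus>\<^sub>m ?J (ys @ zs))"
    by (rule similar_direct_sum[OF similar_jordan_matrix_refl])
  then have 1: "similar_mat (?J (x # cs)) (?J (([x] @ ys) @ zs))"
    unfolding jordan_matrix_append[symmetric] by simp
  have "similar_mat (?J [x] \<oplus>\<^sub>m ?J ys) (?J ys \<oplus>\<^sub>m ?J [x])"
    by (rule similar_direct_sum_swap[OF jordan_matrix_carrier jordan_matrix_carrier])
  then have "similar_mat (?J ([x] @ ys)) (?J (ys @ [x]))" unfolding jordan_matrix_append .
  then have 2: "similar_mat (?J (([x] @ ys) @ zs)) (?J ((ys @ [x]) @ zs))"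
    unfolding jordan_matrix_append[of "[x] @ ys" zs] jordan_matrix_append[of "ys @ [x]" zs]
    by (rule similar_direct_sum[OF _ similar_jordan_matrix_refl])
  show ?case using similar_mat_trans[OF 1 2] ds by simp
qed

lemma skew_splittable_append:
  "skew_splittable (jordan_matrix cs) \<Longrightarrow> skew_splittable (jordan_matrix ds) \<Longrightarrow> skew_splittable (jordan_matrix (cs @ ds))"
  unfolding jordan_matrix_append by (rule skew_splittable_direct_sum)

lemma skew_splittable_groups:
  shows "skew_splittable (jordan_matrix [(k, l), (k, - l), (k, l), (k, - l :: 'a::field)])"
    and "skew_splittable (jordan_matrix [(k, 0 :: 'a), (k, 0)])"
    and "odd s \<Longrightarrow> skew_splittable (jordan_matrix [(s + 2, 0 :: 'a), (s, 0)])"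
    and "skew_splittable (jordan_matrix [(1, 0 :: 'a)])"
    and "skew_splittable (jordan_matrix ([] :: (nat \<times> 'a) list))"
proof -
  have two: "jordan_matrix [(k, l), (m, l')] = jordan_block k l \<oplus>\<^sub>m jordan_block m l'" for k m :: nat and l l' :: 'a
    using jordan_matrix_append[of "[(k, l)]" "[(m, l')]"] by (simp add: jordan_matrix_single)
  have "jordan_matrix [(k, l), (k, - l), (k, l), (k, - l)]
      = jordan_matrix [(k, l), (k, - l)] \<oplus>\<^sub>m jordan_matrix [(k, l), (k, - l)]"
    using jordan_matrix_append[of "[(k, l), (k, - l)]" "[(k, l), (k, - l)]"] by simp
  then show "skew_splittable (jordan_matrix [(k, l), (k, - l), (k, l), (k, - l)])"
    using skew_splittable_quadruple[of k l] unfolding two by (simp only:)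
  show "skew_splittable (jordan_matrix [(k, 0 :: 'a), (k, 0)])"
    unfolding two by (rule skew_splittable_zero_pair)
  show "odd s \<Longrightarrow> skew_splittable (jordan_matrix [(s + 2, 0 :: 'a), (s, 0)])"
    unfolding two by (rule skew_splittable_step_two)
  show "skew_splittable (jordan_matrix [(1, 0 :: 'a)])"
    unfolding jordan_matrix_single by (rule skew_splittable_single)
  show "skew_splittable (jordan_matrix ([] :: (nat \<times> 'a) list))"
    using skew_splittable_empty by (simp add: jordan_matrix_def)
qed

text \<open>The conditions of the theorem together with the two that hold for every skew map: cells for \<open>l\<close> and
  \<open>- l\<close> correspond to each other, and cells of even size for 0 are even in number. Stated in this form, the conditions
  survive the removal of a suitable group of cells.\<close>

definition admissible :: "(nat \<times> 'a::field) multiset \<Rightarrow> bool" where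
  "admissible M \<longleftrightarrow> (\<forall>l k. l \<noteq> 0 \<longrightarrow> even (count M (k, l)) \<and> count M (k, - l) = count M (k, l))
     \<and> (\<forall>k. even k \<longrightarrow> even (count M (k, 0)))
     \<and> (\<forall>k. odd (odd_tail M k) \<longrightarrow> count M (2 * k + 1, 0) > 0)"

lemma odd_tail_pos:
  assumes "odd (odd_tail N k)"
  obtains x where "x \<in># N" "snd x = 0" "fst x > 2 * k + 1"
proof -
  have "odd_tail N k \<noteq> 0" using assms by (metis even_zero)
  then have "{#x \<in># N. snd x = 0 \<and> odd (fst x) \<and> fst x > 2 * k + 1#} \<noteq> {#}"
    by (auto simp: odd_tail_def)
  then obtain x where "x \<in># {#x \<in># N. snd x = 0 \<and> odd (fst x) \<and> fst x > 2 * k + 1#}" by blast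
  then show ?thesis using that[of x] by auto
qed

text \<open>Cells for \<open>l \<noteq> 0\<close> and cells of even size are removed in the groups that their multiplicities allow. If only cells of odd
  size for 0 are left, let \<open>k = 2 m + 1\<close> be the largest size. Two cells of size \<open>k\<close> form a group. A single one of size 1 is a
  group by itself. A single one of larger size makes \<open>odd_tail M (m - 1)\<close> equal to 1, so the last condition provides a cell
  of size \<open>k - 2\<close> to go with it. In each case at most two of the largest cells disappear, which changes \<open>odd_tail\<close> by 2 wherever it
  can still be odd.\<close>

lemma admissible_decompose:
  assumes M: "admissible M" "M \<noteq> {#}" and char2: "(2 :: 'a::field) \<noteq> 0"
  shows "\<exists>ds N. ds \<noteq> [] \<and> M = mset ds + N \<and> admissible N \<and> skew_splittable (jordan_matrix (ds :: (nat \<times> 'a) list))"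
proof -
  have ev: "even (count M (k, l))" and sym: "count M (k, - l) = count M (k, l)" if "l \<noteq> 0" for l k
    using M(1) that by (simp_all add: admissible_def)
  have ev0: "even (count M (k, 0))" if "even k" for k using M(1) that by (simp add: admissible_def)
  have tail: "count M (2 * k + 1, 0) > 0" if "odd (odd_tail M k)" for k
    using M(1) that by (simp add: admissible_def)
  have two_le: "count M x \<ge> 2" if "x \<in># M" "even (count M x)" for x
    using that by (metis count_eq_zero_iff dvd_imp_le gr0I)
  consider (nonzero) k l where "(k, l) \<in># M" "l \<noteq> 0"
    | (even) k where "(k, 0) \<in># M" "even k" "\<forall>x\<in>#M. snd x = 0"
    | (odd) "\<forall>x\<in>#M. snd x = 0 \<and> odd (fst x)"
    by (metis prod.collapse)
  then show ?thesis
  proof cases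
    case nonzero
    let ?ds = "[(k, l), (k, - l), (k, l), (k, - l)]"
    have ll: "l \<noteq> - l"
    proof
      assume "l = - l"
      then have "2 * l = 0" by (metis add.right_inverse mult_2)
      then show False using nonzero(2) char2 by simp
    qed
    have "count (mset ?ds) x \<le> count M x" for x
      using two_le[OF nonzero(1) ev[OF nonzero(2)]] sym[OF nonzero(2), of k] ll by auto
    then obtain N where N: "M = mset ?ds + N"
      by (metis mset_subset_eqI mset_subset_eq_exists_conv)
    define e where "e x = (if x = (k, l) \<or> x = (k, - l) then 2 else 0 :: nat)" for x
    have c: "count M x = count N x + e x" for x
      unfolding N e_def using ll by auto
    have e: "even (e x)" "e (j, - l') = e (j, l')" "e (j, 0) = 0" for x j l'
      using nonzero(2) by (auto simp: e_def equation_minus_iff)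
    have "odd_tail M j = odd_tail N j" for j
      unfolding N using nonzero(2) by (simp add: odd_tail_def)
    then have "admissible N"
      using M(1) unfolding admissible_def c by (simp add: e)
    then show ?thesis using N skew_splittable_groups(1)[of k l] by blast
  next
    case even
    let ?ds = "[(k, 0), (k, 0)] :: (nat \<times> 'a) list"
    have "count (mset ?ds) x \<le> count M x" for x
      using two_le[OF even(1) ev0[OF even(2)]] by auto
    then obtain N where N: "M = mset ?ds + N"
      by (metis mset_subset_eqI mset_subset_eq_exists_conv)
    have c: "count M x = count N x + (if x = (k, 0) then 2 else 0)" for x
      unfolding N by auto
    have t: "odd_tail M j = odd_tail N j" for j
      unfolding N using even(2) by (simp add: odd_tail_def)
    have "2 * j + 1 \<noteq> k" for j using even(2) by auto
    then have "admissible N"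
      using M(1) unfolding admissible_def c t by auto
    then show ?thesis using N skew_splittable_groups(2)[of k] by blast
  next
    case odd
    define k where "k = Max (fst ` set_mset M)"
    have fin: "finite (fst ` set_mset M)" "fst ` set_mset M \<noteq> {}" using M(2) by auto
    have "k \<in> fst ` set_mset M" unfolding k_def by (rule Max_in[OF fin])
    then have k: "(k, 0) \<in># M" using odd by (metis imageE prod.collapse)
    have kmax: "fst x \<le> k" if "x \<in># M" for x
      unfolding k_def using that fin by (intro Max_ge) auto
    have "odd k" using odd k by force
    then obtain m where m: "k = 2 * m + 1" by (elim oddE)
    have nz: "count M (j, l) = 0" if "l \<noteq> 0 \<or> even j" for j l
      using odd that by (auto simp: count_eq_zero_iff)
    \<comment> \<open>Only odd cells for the eigenvalue 0 are left, so the parity conditions of \<open>admissible\<close> are vacuous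
      for every part of \<open>M\<close>.\<close>
    have adm: "admissible N"
      if N: "M = mset ds + N" and "\<And>j. odd (odd_tail N j) \<Longrightarrow> count N (2 * j + 1, 0) > 0" for ds N
    proof -
      have "count N (j, l) = 0" if "l \<noteq> 0 \<or> even j" for j l
        using nz[OF that] unfolding N by simp
      then show ?thesis using that(2) unfolding admissible_def by auto
    qed
    have Nsub: "x \<in># M" if "M = mset ds + N" "x \<in># N" for ds N x using that by simp
    consider (two) "count M (k, 0) \<ge> 2" | (one) "count M (k, 0) = 1" "m = 0" | (step) m' where "count M (k, 0) = 1" "m = Suc m'"
      using k by (metis One_nat_def Suc_1 count_greater_zero_iff le_neq_implies_less less_2_cases not_less not0_implies_Suc less_numeral_extra(3))
    then show ?thesis
    proof cases
      case two
      let ?ds = "[(k, 0), (k, 0)] :: (nat \<times> 'a) list"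
      have "count (mset ?ds) x \<le> count M x" for x using two by auto
      then obtain N where N: "M = mset ?ds + N"
        by (metis mset_subset_eqI mset_subset_eq_exists_conv)
      have "count N (2 * j + 1, 0) > 0" if j: "odd (odd_tail N j)" for j
      proof -
        obtain x where "x \<in># N" "fst x > 2 * j + 1" using odd_tail_pos[OF j] by blast
        then have jm: "j < m" using kmax[OF Nsub[OF N]] m by fastforce
        then have "odd_tail M j = 2 + odd_tail N j" unfolding N m by (simp add: odd_tail_def)
        then have "count M (2 * j + 1, 0) > 0" using tail[of j] j by simp
        then show ?thesis unfolding N using jm m by simp
      qed
      then have "admissible N" by (rule adm[OF N])
      then show ?thesis using N skew_splittable_groups(2)[of k] by blast
    next
      case one
      let ?ds = "[(1, 0)] :: (nat \<times> 'a) list"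
      have "count (mset ?ds) x \<le> count M x" for x using one m k by auto
      then obtain N where N: "M = mset ?ds + N"
        by (metis mset_subset_eqI mset_subset_eq_exists_conv)
      have "count N (2 * j + 1, 0) > 0" if j: "odd (odd_tail N j)" for j
      proof -
        obtain x where "x \<in># N" "fst x > 2 * j + 1" using odd_tail_pos[OF j] by blast
        then have False using kmax[OF Nsub[OF N]] m one by fastforce
        then show ?thesis ..
      qed
      then have "admissible N" by (rule adm[OF N])
      then show ?thesis using N skew_splittable_groups(4) by blast
    next
      case step
      define s where "s = 2 * m' + 1"
      have ks: "k = s + 2" using m step by (simp add: s_def)
      let ?ds = "[(s + 2, 0), (s, 0)] :: (nat \<times> 'a) list"
      have "{#x \<in># M. snd x = 0 \<and> odd (fst x) \<and> fst x > 2 * m' + 1#} = replicate_mset (count M (k, 0)) (k, 0)"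
      proof (rule multiset_eqI)
        fix x :: "nat \<times> 'a"
        have "x = (k, 0)" if "x \<in># M" "fst x > 2 * m' + 1"
        proof -
          have "odd (fst x)" "fst x \<le> k" "snd x = 0" using odd that(1) kmax by auto
          moreover have "fst x \<ge> k" using that(2) \<open>odd (fst x)\<close> ks unfolding s_def by (auto elim!: oddE)
          ultimately show ?thesis by (simp add: prod_eq_iff)
        qed
        then show "count {#x \<in># M. snd x = 0 \<and> odd (fst x) \<and> fst x > 2 * m' + 1#} x
            = count (replicate_mset (count M (k, 0)) (k, 0)) x"
          using m step(2) by (auto simp: count_eq_zero_iff)
      qed
      then have "odd_tail M m' = 1" using step(1) by (simp add: odd_tail_def)
      then have "count M (s, 0) > 0" using tail[of m'] by (simp add: s_def)
      then have "count (mset ?ds) x \<le> count M x" for x using step(1) ks k by auto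
      then obtain N where N: "M = mset ?ds + N"
        by (metis mset_subset_eqI mset_subset_eq_exists_conv)
      have "count N (2 * j + 1, 0) > 0" if j: "odd (odd_tail N j)" for j
      proof -
        obtain x where x: "x \<in># N" "snd x = 0" "fst x > 2 * j + 1" using odd_tail_pos[OF j] by blast
        have "count N (k, 0) = 0" using step(1) N ks by simp
        then have "fst x \<noteq> k" using x by (metis count_greater_zero_iff less_numeral_extra(3) prod.collapse)
        moreover have "fst x \<le> k" "odd (fst x)" using kmax odd Nsub[OF N x(1)] by auto
        ultimately have "fst x \<le> s" using ks by (auto elim!: oddE simp: s_def)
        then have jm: "j < m'" using x(3) by (simp add: s_def)
        then have "odd_tail M j = 2 + odd_tail N j" unfolding N by (simp add: odd_tail_def s_def)
        then have "count M (2 * j + 1, 0) > 0" using tail[of j] j by simp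
        then show ?thesis unfolding N using jm by (simp add: s_def)
      qed
      then have "admissible N" by (rule adm[OF N])
      moreover have "odd s" by (simp add: s_def)
      ultimately show ?thesis using N skew_splittable_groups(3)[of s] by blast
    qed
  qed
qed

lemma admissible_imp_skew_splittable:
  assumes "admissible M" and char2: "(2 :: 'a::field) \<noteq> 0"
  shows "\<exists>cs. mset cs = M \<and> skew_splittable (jordan_matrix (cs :: (nat \<times> 'a) list))"
  using assms(1)
proof (induction "size M" arbitrary: M rule: less_induct)
  case less
  show ?case
  proof (cases "M = {#}")
    case True
    then show ?thesis using skew_splittable_groups(5) by (intro exI[of _ "[]"]) simp
  next
    case False
    obtain ds N where N: "ds \<noteq> []" "M = mset ds + N" "admissible N" "skew_splittable (jordan_matrix ds)"
      using admissible_decompose[OF less(2) False char2] by blast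
    then have "size N < size M" by simp
    then obtain cs where "mset cs = N" "skew_splittable (jordan_matrix cs)"
      using less(1) N(3) by blast
    then show ?thesis using N skew_splittable_append[of ds cs] by (intro exI[of _ "ds @ cs"]) simp
  qed
qed

section \<open>Two forms with the same skew map\<close>

text \<open>Newton lifting, one linear factor at a time. If \<open>s\<^sup>2 - X = q w\<close> and \<open>c\<close> is the next root, replace \<open>s\<close> by \<open>s + r q\<close> for a constant
  \<open>r\<close>; the new quotient by \<open>q\<close> is \<open>w + 2 r s + r\<^sup>2 q\<close>, and \<open>r\<close> has to make it vanish at \<open>c\<close>. This is a quadratic
  equation for \<open>r\<close> if \<open>q c \<noteq> 0\<close>; otherwise \<open>(s c)\<^sup>2 = c \<noteq> 0\<close>, and the equation is linear with leading coefficient \<open>2 s c\<close>.\<close>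

lemma poly_square_root_modulo:
  fixes B :: "'a::alg_closed_field multiset"
  assumes "0 \<notin># B" and char2: "(2 :: 'a) \<noteq> 0"
  shows "\<exists>s. (\<Prod>x\<in>#B. [:- x, 1:]) dvd s * s - [:0, 1:]"
  using assms(1)
proof (induction B)
  case empty
  then show ?case by simp
next
  case (add c B)
  let ?q = "\<Prod>x\<in>#B. [:- x, 1:]"
  obtain s w where sw: "s * s - [:0, 1:] = ?q * w" using add by (auto simp: dvd_def)
  have c: "c \<noteq> 0" using add.prems by auto
  define S W Q where "S = poly s c" and "W = poly w c" and "Q = poly ?q c"
  have SW: "S * S - c = Q * W"
    using arg_cong[OF sw, of "\<lambda>p. poly p c"] by (simp add: S_def W_def Q_def)
  obtain r where r: "W + 2 * S * r + Q * r * r = 0"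
  proof (cases "Q = 0")
    case True
    then have "S \<noteq> 0" using SW c by auto
    then have "W + 2 * S * (- W / (2 * S)) + Q * (- W / (2 * S)) * (- W / (2 * S)) = 0"
      using char2 True by (simp add: field_simps)
    then show ?thesis by (rule that)
  next
    case False
    then have "degree [:W, 2 * S, Q:] > 0" by simp
    then obtain r where "poly [:W, 2 * S, Q:] r = 0"
      using alg_closed_imp_poly_has_root by blast
    then have "W + 2 * S * r + Q * r * r = 0" by (simp add: algebra_simps)
    then show ?thesis by (rule that)
  qed
  let ?t = "s + [:r:] * ?q" and ?v = "w + 2 * s * [:r:] + ?q * [:r:] * [:r:]"
  have "poly ?v c = 0" using r by (simp add: S_def W_def Q_def ac_simps)
  then have "[:- c, 1:] dvd ?v" unfolding poly_eq_0_iff_dvd .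
  then have "?q * [:- c, 1:] dvd ?q * ?v" by (rule mult_dvd_mono[OF dvd_refl])
  moreover have "?t * ?t - [:0, 1:] = ?q * w + ?q * (2 * s * [:r:]) + ?q * (?q * [:r:] * [:r:])"
    unfolding sw[symmetric] by (simp only: algebra_simps mult_2)
  then have "?t * ?t - [:0, 1:] = ?q * ?v" by (simp only: distrib_left)
  ultimately have "(\<Prod>x\<in>#add_mset c B. [:- x, 1:]) dvd ?t * ?t - [:0, 1:]"
    by (simp only: image_mset_add_mset prod_mset.add_mset mult.commute[of "[:- c, 1:]"])
  then show ?case by blast
qed

context finite_dimensional_vector_space
begin

interpretation endo: finite_dimensional_vector_space_pair scale Basis scale Basis
  by unfold_locales

lemma eval_poly_commute:
  assumes "endomorphism g" "endomorphism f" "\<And>x. f (g x) = g (f x)"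
  shows "f (eval_poly g p x) = eval_poly g p (f x)"
  by (induction p) (use assms endo.linear_0[OF assms(2)] in \<open>simp_all add: eval_poly_pCons[OF assms(1)] endomorphism_iff\<close>)

lemma eval_poly_selfadjoint:
  assumes b: "bilinear_form scale b" and g: "endomorphism g" "\<And>x y. b (g x) y = b x (g y)"
  shows "b (eval_poly g p x) y = b x (eval_poly g p y)"
proof (induction p arbitrary: x y)
  case 0
  then show ?case by (simp add: bilinear_formD[OF b])
next
  case (pCons a p)
  have "b (g (eval_poly g p x)) y = b x (eval_poly g p (g y))"
    using g(2) pCons.IH by simp
  also have "eval_poly g p (g y) = g (eval_poly g p y)"
    by (rule eval_poly_commute[OF g(1) g(1), symmetric]) simp
  finally show ?case by (simp add: eval_poly_pCons[OF g(1)] bilinear_formD[OF b])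
qed

lemma nondegenerate_eqI:
  assumes b: "bilinear_form scale b" "nondegenerate_on b UNIV" "\<And>x y. b x y = b y x" and eq: "\<And>x. b x v = b x w"
  shows "v = w"
proof -
  have "b (v - w) x = 0" for x using eq[of x] b(3)[of x] by (simp add: bilinear_formD[OF b(1)])
  then have "v - w \<in> perp b UNIV UNIV" by (simp add: perp_def)
  then have "v - w = 0" using b(2) by (auto simp: nondegenerate_on_def)
  then show ?thesis by simp
qed

text \<open>A vector orthogonal to the kernel of \<open>f\<close> represents \<open>f\<close> up to a factor.\<close>

lemma form_represents_functional:
  assumes b: "bilinear_form scale b" "nondegenerate_on b UNIV" "\<And>x y. b x y = b y x"
    and f: "\<And>x y. f (x + y) = f x + f y" "\<And>c x. f (scale c x) = c * f x"
  shows "\<exists>w. \<forall>x. f x = b x w"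
proof (cases "\<forall>x. f x = 0")
  case True
  then show ?thesis by (intro exI[of _ 0]) (simp add: bilinear_formD[OF b(1)])
next
  case False
  then obtain v where v: "f v \<noteq> 0" by blast
  let ?H = "{x. f x = 0}"
  have f0: "f 0 = 0" using f(2)[of 0 0] by simp
  have H: "subspace ?H" by (auto simp: subspace_def f f0)
  have "dim ?H + 1 = dim (UNIV :: 'b set)"
    using dim_hyperplane_on[of UNIV f v, OF subspace_UNIV f UNIV_I v] by simp
  moreover have "dim (perp b UNIV ?H) + dim ?H = dim (UNIV :: 'b set)"
    by (rule dim_perp[OF b(1,2) subspace_UNIV H]) simp
  ultimately have "dim (perp b UNIV ?H) = 1" by linarith
  then have "\<not> perp b UNIV ?H \<subseteq> {0}" by (metis dim_eq_0 zero_neq_one)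
  then obtain w where w: "w \<in> perp b UNIV ?H" "w \<noteq> 0" by blast
  have dec: "b x w = f x / f v * b v w" for x
  proof -
    let ?y = "x - scale (f x / f v) v"
    have "f ?y + f (scale (f x / f v) v) = f x" using f(1)[of ?y "scale (f x / f v) v"] by simp
    then have "f ?y = 0" using v by (simp add: f)
    then have "b w ?y = 0" using w(1) by (auto simp: perp_def)
    then have "b ?y w = 0" using b(3) by metis
    then show ?thesis by (simp add: bilinear_formD[OF b(1)])
  qed
  have "b v w \<noteq> 0"
  proof
    assume "b v w = 0"
    then have "b x w = b x 0" for x using dec[of x] by (simp add: bilinear_formD[OF b(1)])
    then show False using nondegenerate_eqI[OF b] w(2) by blast
  qed
  then have "f x = b x (scale (f v / b v w) w)" for x
    using dec[of x] v by (simp add: bilinear_formD[OF b(1)] field_simps)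
  then show ?thesis by blast
qed

lemma form_operator:
  assumes b: "bilinear_form scale b" "nondegenerate_on b UNIV" "\<And>x y. b x y = b y x" and \<beta>: "bilinear_form scale \<beta>"
  shows "\<exists>g. endomorphism g \<and> (\<forall>x y. \<beta> x y = b x (g y))"
proof -
  have "\<exists>w. \<forall>x. \<beta> x y = b x w" for y
    by (rule form_represents_functional[OF b]) (simp_all add: bilinear_formD[OF \<beta>])
  then obtain g where g: "\<And>x y. \<beta> x y = b x (g y)" by metis
  have "g (x + y) = g x + g y" for x y
    by (rule nondegenerate_eqI[OF b]) (simp add: bilinear_formD[OF b(1)] g[symmetric] bilinear_formD[OF \<beta>])
  moreover have "g (scale c x) = scale c (g x)" for c x
    by (rule nondegenerate_eqI[OF b]) (simp add: bilinear_formD[OF b(1)] g[symmetric] bilinear_formD[OF \<beta>])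
  ultimately show ?thesis using g unfolding endomorphism_iff by blast
qed

end

context alg_closed_vector_space
begin

interpretation endo: finite_dimensional_vector_space_pair scale Basis scale Basis
  by unfold_locales

text \<open>An annihilating polynomial of \<open>g\<close> may be stripped of its factors \<open>X\<close> because \<open>g\<close> is injective; modulo what is left, \<open>X\<close>
  has a square root.\<close>

lemma exists_square_root:
  assumes g: "endomorphism g" "inj g" and char2: "(2 :: 'a) \<noteq> 0"
  shows "\<exists>s. \<forall>x. eval_poly g s (eval_poly g s x) = g x"
proof -
  obtain p where p: "p \<noteq> 0" "\<And>x. eval_poly g p x = 0"
    using exists_annihilating_poly[OF g(1)] by blast
  obtain A where A: "p = Polynomial.smult (lead_coeff p) (\<Prod>x\<in>#A. [:- x, 1:])"
    by (rule alg_closed_splits[OF p(1)])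
  have A0: "eval_poly g (\<Prod>x\<in>#A. [:- x, 1:]) x = 0" for x
  proof -
    have "scale (lead_coeff p) (eval_poly g (\<Prod>x\<in>#A. [:- x, 1:]) x) = 0"
      using p(2)[of x] A eval_poly_smult by metis
    then show ?thesis using p(1) by simp
  qed
  have g0: "g x = 0 \<Longrightarrow> x = 0" for x
    using g(2) endo.linear_0[OF g(1)] by (metis injD)
  let ?B = "filter_mset (\<lambda>x. x \<noteq> 0) A"
  have "eval_poly g (\<Prod>x\<in>#A. [:- x, 1:]) x = 0 \<Longrightarrow> eval_poly g (\<Prod>x\<in>#filter_mset (\<lambda>x. x \<noteq> 0) A. [:- x, 1:]) x = 0" for x A
  proof (induction A arbitrary: x)
    case (add c A)
    let ?q = "\<lambda>A. \<Prod>x\<in>#A. [:- x, 1:] :: 'a poly"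
    have split: "eval_poly g (?q (add_mset c D)) x = eval_poly g (?q D) (eval_poly g [:- c, 1:] x)" for D
      using eval_poly_mult[OF g(1), of "?q D" "[:- c, 1:]" x] by (simp only: image_mset_add_mset prod_mset.add_mset mult.commute[of "[:- c, 1:]"])
    show ?case
    proof (cases "c = 0")
      case True
      have "eval_poly g (?q (add_mset c A)) x = g (eval_poly g (?q A) x)"
        using eval_poly_mult[OF g(1), of "[:- c, 1:]" "?q A" x] True
        by (simp only: image_mset_add_mset prod_mset.add_mset eval_poly_linear_factor) simp
      then have "eval_poly g (?q A) x = 0" using add.prems g0 by simp
      then show ?thesis using add.IH[of x] True by simp
    next
      case False
      then show ?thesis using add.IH[of "eval_poly g [:- c, 1:] x"] add.prems split[of A] split[of "filter_mset (\<lambda>x. x \<noteq> 0) A"] by simp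
    qed
  qed simp
  then have B0: "eval_poly g (\<Prod>x\<in>#?B. [:- x, 1:]) x = 0" for x using A0 by blast
  obtain s w where s: "s * s - [:0, 1:] = (\<Prod>x\<in>#?B. [:- x, 1:]) * w"
    using poly_square_root_modulo[of ?B] char2 by (auto simp: dvd_def)
  have "eval_poly g (s * s) x = g x" for x
  proof -
    have "eval_poly g (s * s - [:0, 1:]) x = 0"
      unfolding s by (simp only: eval_poly_mult[OF g(1)] B0)
    then show ?thesis by (simp add: eval_poly_diff eval_poly_X)
  qed
  then show ?thesis unfolding eval_poly_mult[OF g(1)] by blast
qed

text \<open>The operator \<open>g\<close> with \<open>\<beta> x y = b x (g y)\<close> is selfadjoint for \<open>b\<close> and commutes with \<open>u\<close>, because \<open>u\<close> is skew for both forms.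
  A square root \<open>h\<close> of \<open>g\<close> that is a polynomial in \<open>g\<close> inherits both properties.\<close>

lemma transport_skew:
  assumes b: "bilinear_form scale b" "nondegenerate_on b UNIV" "\<And>x y. b x y = b y x"
    and \<beta>: "bilinear_form scale \<beta>" "nondegenerate_on \<beta> UNIV" "\<And>x y. \<beta> x y = \<beta> y x"
    and u: "endomorphism u" "\<And>x y. b (u x) y = - b x (u y)" "\<And>x y. \<beta> (u x) y = - \<beta> x (u y)"
    and char2: "(2 :: 'a) \<noteq> 0"
  shows "\<exists>h. endomorphism h \<and> inj h \<and> (\<forall>x. h (u x) = u (h x)) \<and> (\<forall>x y. \<beta> x y = b (h x) (h y))"
proof -
  obtain g where g: "endomorphism g" "\<And>x y. \<beta> x y = b x (g y)"
    using form_operator[OF b \<beta>(1)] by blast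
  have gself: "b (g x) y = b x (g y)" for x y
    using g(2) b(3) \<beta>(3) by metis
  have gu: "g (u y) = u (g y)" for y
  proof (rule nondegenerate_eqI[OF b])
    fix x
    have "b x (g (u y)) = - \<beta> (u x) y" using g(2)[of x "u y"] u(3) by simp
    also have "\<dots> = b x (u (g y))" using g(2)[of "u x" y] u(2)[of x "g y"] by simp
    finally show "b x (g (u y)) = b x (u (g y))" .
  qed
  have "x = 0" if "g x = 0" for x
  proof -
    have "\<beta> x y = 0" for y using that g(2)[of y x] \<beta>(3)[of x y] by (simp add: bilinear_formD[OF b(1)])
    then show ?thesis using \<beta>(2) by (auto simp: nondegenerate_on_def perp_def)
  qed
  then have ginj: "inj g" using endo.linear_inj_iff_eq_0[OF g(1)] by blast
  obtain s where s: "\<And>x. eval_poly g s (eval_poly g s x) = g x"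
    using exists_square_root[OF g(1) ginj char2] by blast
  define h where "h = eval_poly g s"
  have he: "endomorphism h" unfolding h_def by (rule endomorphism_eval_poly[OF g(1)])
  have hh: "h (h x) = g x" for x using s by (simp add: h_def)
  have hinj: "inj h" using ginj hh by (metis injD injI)
  have "h (u x) = u (h x)" for x
    unfolding h_def using eval_poly_commute[OF g(1) u(1)] gu by simp
  moreover have "\<beta> x y = b (h x) (h y)" for x y
    using eval_poly_selfadjoint[of b g s x "h y", OF b(1) g(1) gself] g(2)[of x y] hh[of y] by (simp add: h_def)
  ultimately show ?thesis using he hinj by blast
qed

text \<open>The matrices from \<open>skew_splittable\<close> are pulled back along coordinates \<open>f\<close> in which \<open>u\<close> acts as the Jordan matrix; these
  arise from the coordinates with respect to a basis by a change of basis \<open>Q\<close>.\<close>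

lemma split_form_of_cells:
  assumes u: "endomorphism u" and cs: "jordan_cells scale u cs"
    and good: "mset ds = mset cs" "skew_splittable (jordan_matrix ds)"
  shows "\<exists>\<beta> z. bilinear_form scale \<beta> \<and> endomorphism z \<and> nondegenerate_on \<beta> UNIV \<and> (\<forall>x y. \<beta> x y = \<beta> y x)
    \<and> (\<forall>x y. \<beta> (u x) y = - \<beta> x (u y)) \<and> (\<forall>x y. \<beta> (z x) y = - \<beta> x (z y))
    \<and> (\<forall>x. z (z x) = - u (u x)) \<and> (\<forall>x. u (z x) = - z (u x))"
proof -
  obtain bs where bs: "ordered_basis scale bs" "jordan_nf (matrix_of_endo scale bs u) cs"
    using cs by (auto simp: jordan_cells_def)
  define n where "n = length bs"
  let ?A = "matrix_of_endo scale bs u" and ?J = "jordan_matrix ds" and ?co = "coordinates bs"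
  have A: "?A \<in> carrier_mat n n" unfolding n_def by (rule matrix_of_endo_carrier[OF bs(1)])
  have co: "?co x \<in> carrier_vec n" for x unfolding n_def by (rule coordinates_carrier[OF bs(1)])
  have "similar_mat ?A ?J"
    using bs(2) similar_jordan_matrix_mset[OF good(1)[symmetric]] similar_mat_trans unfolding jordan_nf_def by blast
  then obtain P Q where wit: "similar_mat_wit ?A ?J P Q" unfolding similar_mat_def by blast
  note w = similar_mat_witD2[OF A wit]
  have J: "?J \<in> carrier_mat n n" and P: "P \<in> carrier_mat n n" and Q: "Q \<in> carrier_mat n n"
    and PQ: "P * Q = 1\<^sub>m n" and QP: "Q * P = 1\<^sub>m n" and AJ: "?A = P * ?J * Q"
    using w by auto
  obtain m S T Z where "{?J, S, T, Z} \<subseteq> carrier_mat m m" and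
    S: "transpose_mat S = S" "T * S = 1\<^sub>m m" "S * ?J + transpose_mat ?J * S = 0\<^sub>m m m"
    "S * Z + transpose_mat Z * S = 0\<^sub>m m m" "Z * Z + ?J * ?J = 0\<^sub>m m m" "?J * Z + Z * ?J = 0\<^sub>m m m"
    using good(2) unfolding skew_splittable_def by blast
  then have mn: "m = n" and C: "S \<in> carrier_mat n n" "T \<in> carrier_mat n n" "Z \<in> carrier_mat n n"
    using J by auto
  note S = S[unfolded mn]
  define f where "f x = Q *\<^sub>v ?co x" for x
  define finv where "finv v = of_coordinates bs (P *\<^sub>v v)" for v
  have fc [simp]: "f x \<in> carrier_vec n" for x unfolding f_def using Q co by simp
  have f_add: "f (x + y) = f x + f y" and f_scale: "f (scale c x) = c \<cdot>\<^sub>v f x" for x y c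
    unfolding f_def using coordinates_add[OF bs(1)] coordinates_scale[OF bs(1)] co Q
    by (simp_all add: mult_add_distrib_mat_vec[of _ n n] mult_mat_vec[of _ n n])
  have f_finv: "f (finv v) = v" if "v \<in> carrier_vec n" for v
  proof -
    have "f (finv v) = Q *\<^sub>v (P *\<^sub>v v)"
      unfolding f_def finv_def using that P by (subst coordinates_of_coordinates[OF bs(1)]) (auto simp: n_def)
    also have "\<dots> = (Q * P) *\<^sub>v v" using that P Q by (simp add: assoc_mult_mat_vec[of _ n n _ n])
    finally show ?thesis using that QP by simp
  qed
  have finv_f: "finv (f x) = x" for x
  proof -
    have "P *\<^sub>v (Q *\<^sub>v ?co x) = (P * Q) *\<^sub>v ?co x" using co P Q by (simp add: assoc_mult_mat_vec[of _ n n _ n])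
    then show ?thesis unfolding f_def finv_def using PQ co of_coordinates_coordinates[OF bs(1)] by simp
  qed
  have f_inject: "f x = f y \<Longrightarrow> x = y" for x y using finv_f by metis
  have f_u: "f (u x) = ?J *\<^sub>v f x" for x
  proof -
    have "f (u x) = Q *\<^sub>v (P * ?J * Q *\<^sub>v ?co x)"
      unfolding f_def coordinates_endo[OF bs(1) u] AJ[symmetric] ..
    also have "\<dots> = (Q * P) *\<^sub>v (?J *\<^sub>v (Q *\<^sub>v ?co x))"
      using P Q J co by (simp add: assoc_mult_mat_vec[of _ n n _ n] mult_mat_vec_carrier[of _ n n] mult_carrier_mat[where n = n])
    also have "\<dots> = ?J *\<^sub>v f x" using QP J by (simp add: f_def mult_mat_vec_carrier[of _ n n] Q co)
    finally show ?thesis .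
  qed
  define z where "z x = finv (Z *\<^sub>v f x)" for x
  have f_z: "f (z x) = Z *\<^sub>v f x" for x
    unfolding z_def using C(3) by (intro f_finv) (rule mult_mat_vec_carrier[of _ n n], auto)
  have f_neg: "f (- x) = - f x" for x
  proof -
    have "f (- x) = (- 1) \<cdot>\<^sub>v f x" using f_scale[of "- 1" x] by simp
    then show ?thesis using fc[of x] by auto
  qed
  define \<beta> where "\<beta> x y = f x \<bullet> (S *\<^sub>v f y)" for x y
  have Sc [simp]: "X *\<^sub>v v \<in> carrier_vec n" if "X \<in> carrier_mat n n" "v \<in> carrier_vec n" for X :: "'a mat" and v
    using that by simp
  have sum0: "X *\<^sub>v v + Y *\<^sub>v v = 0\<^sub>v n" if "X + Y = 0\<^sub>m n n" "X \<in> carrier_mat n n" "Y \<in> carrier_mat n n" "v \<in> carrier_vec n"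
    for X Y :: "'a mat" and v
  proof -
    have "(X + Y) *\<^sub>v v = X *\<^sub>v v + Y *\<^sub>v v" by (rule add_mult_distrib_mat_vec[OF that(2-4)])
    moreover have "0\<^sub>m n n *\<^sub>v v = 0\<^sub>v n" using that(4) by (intro eq_vecI) auto
    ultimately show ?thesis using that(1) by simp
  qed
  have adj: "(X *\<^sub>v v) \<bullet> w = v \<bullet> (transpose_mat X *\<^sub>v w)"
    if "X \<in> carrier_mat n n" "v \<in> carrier_vec n" "w \<in> carrier_vec n" for X :: "'a mat" and v w
    using transpose_vec_mult_scalar[of "transpose_mat X" n n w v] that by simp
  have skew: "(X *\<^sub>v f x) \<bullet> (S *\<^sub>v f y) = - (f x \<bullet> (S *\<^sub>v (X *\<^sub>v f y)))"
    if X: "X \<in> carrier_mat n n" "S * X + transpose_mat X * S = 0\<^sub>m n n" for X x y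
  proof -
    have XT: "transpose_mat X \<in> carrier_mat n n" using X by simp
    have "(X *\<^sub>v f x) \<bullet> (S *\<^sub>v f y) = f x \<bullet> ((transpose_mat X * S) *\<^sub>v f y)"
      using X C by (simp add: adj assoc_mult_mat_vec[of _ n n _ n])
    moreover have "f x \<bullet> (S *\<^sub>v (X *\<^sub>v f y)) = f x \<bullet> ((S * X) *\<^sub>v f y)"
      using X C by (simp add: assoc_mult_mat_vec[of _ n n _ n])
    moreover have "f x \<bullet> ((S * X) *\<^sub>v f y) + f x \<bullet> ((transpose_mat X * S) *\<^sub>v f y)
        = f x \<bullet> ((S * X) *\<^sub>v f y + (transpose_mat X * S) *\<^sub>v f y)"
      by (rule scalar_prod_add_distrib[symmetric, of _ n])
         (use mult_carrier_mat[OF C(1) X(1)] mult_carrier_mat[OF XT C(1)] in simp_all)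
    moreover have "(S * X) *\<^sub>v f y + (transpose_mat X * S) *\<^sub>v f y = 0\<^sub>v n"
      by (rule sum0[OF X(2) mult_carrier_mat[OF C(1) X(1)] mult_carrier_mat[OF XT C(1)] fc])
    ultimately have "f x \<bullet> (S *\<^sub>v (X *\<^sub>v f y)) + (X *\<^sub>v f x) \<bullet> (S *\<^sub>v f y) = 0" by simp
    then show ?thesis by (metis add.commute add_eq_0_iff)
  qed
  have \<beta>: "bilinear_form scale \<beta>"
    unfolding bilinear_form_iff \<beta>_def f_add f_scale using C(1)
    by (simp add: add_scalar_prod_distrib[of _ n] scalar_prod_add_distrib[of _ n]
        mult_add_distrib_mat_vec[of _ n n] mult_mat_vec[of _ n n])
  have sym: "\<beta> x y = \<beta> y x" for x y
  proof -
    have "\<beta> x y = (S *\<^sub>v f x) \<bullet> f y" unfolding \<beta>_def using adj[OF C(1), of "f x" "f y"] S(1) by simp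
    also have "\<dots> = \<beta> y x" unfolding \<beta>_def by (rule comm_scalar_prod[of _ n]) (use C in simp_all)
    finally show ?thesis .
  qed
  have nd: "x = 0" if "\<forall>y. \<beta> x y = 0" for x
  proof -
    have "S *\<^sub>v f x = 0\<^sub>v n"
    proof (rule eq_vecI)
      fix i assume "i < dim_vec (0\<^sub>v n :: 'a vec)"
      then have i: "i < n" by simp
      have "\<beta> (finv (unit_vec n i)) x = 0" using that sym by metis
      then have "unit_vec n i \<bullet> (S *\<^sub>v f x) = 0" unfolding \<beta>_def by (simp add: f_finv)
      then show "(S *\<^sub>v f x) $ i = 0\<^sub>v n $ i" using i C(1) scalar_prod_left_unit[of "S *\<^sub>v f x" n i] by simp
    qed (use C in simp)
    then have "T *\<^sub>v (S *\<^sub>v f x) = 0\<^sub>v n" using C(2) by auto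
    moreover have "T *\<^sub>v (S *\<^sub>v f x) = (T * S) *\<^sub>v f x" using C by (simp add: assoc_mult_mat_vec[of _ n n _ n])
    ultimately have fx: "f x = 0\<^sub>v n" using S(2) by simp
    have "f 0 = 0 \<cdot>\<^sub>v f 0" using f_scale[of 0 0] by simp
    also have "\<dots> = 0\<^sub>v n" by (rule eq_vecI) (simp_all add: carrier_vecD[OF fc])
    finally have "f 0 = 0\<^sub>v n" .
    then show ?thesis using fx f_inject by simp
  qed
  show ?thesis
  proof (rule exI[of _ \<beta>], rule exI[of _ z], intro conjI allI)
    show "bilinear_form scale \<beta>" by (rule \<beta>)
    show "nondegenerate_on \<beta> UNIV" using nd by (auto simp: nondegenerate_on_def perp_def)
    show "\<beta> x y = \<beta> y x" for x y by (rule sym)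
    show "\<beta> (u x) y = - \<beta> x (u y)" for x y
      unfolding \<beta>_def f_u by (rule skew[OF J S(3)])
    show "\<beta> (z x) y = - \<beta> x (z y)" for x y
      unfolding \<beta>_def f_z by (rule skew[OF C(3) S(4)])
    have "z (x + y) = z x + z y" for x y
      by (rule f_inject) (simp add: f_z f_add mult_add_distrib_mat_vec[OF C(3)])
    moreover have "z (scale c x) = scale c (z x)" for c x
      by (rule f_inject) (simp add: f_z f_scale mult_mat_vec[OF C(3)])
    ultimately show "endomorphism z" by (simp add: endomorphism_iff)
    have neg: "v = - w" if "v + w = 0\<^sub>v n" "v \<in> carrier_vec n" "w \<in> carrier_vec n" for v w :: "'a vec"
    proof (rule eq_vecI)
      fix i assume i: "i < dim_vec (- w)"
      then have "(v + w) $ i = 0" unfolding that(1) using that(3) by simp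
      moreover have "(v + w) $ i = v $ i + w $ i" using i by simp
      ultimately show "v $ i = (- w) $ i" using i by (simp add: eq_neg_iff_add_eq_0)
    qed (use that in auto)
    have comp: "X *\<^sub>v (Y *\<^sub>v f x) = - (X' *\<^sub>v (Y' *\<^sub>v f x))"
      if "X * Y + X' * Y' = 0\<^sub>m n n" "X \<in> carrier_mat n n" "Y \<in> carrier_mat n n" "X' \<in> carrier_mat n n" "Y' \<in> carrier_mat n n"
      for X Y X' Y' x
    proof (rule neg)
      have "(X * Y) *\<^sub>v f x + (X' * Y') *\<^sub>v f x = 0\<^sub>v n"
        by (rule sum0[OF that(1) mult_carrier_mat[OF that(2,3)] mult_carrier_mat[OF that(4,5)] fc])
      then show "X *\<^sub>v (Y *\<^sub>v f x) + X' *\<^sub>v (Y' *\<^sub>v f x) = 0\<^sub>v n"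
        using that by (simp add: assoc_mult_mat_vec[of _ n n _ n])
    qed (use that in simp_all)
    show "z (z x) = - u (u x)" for x
      by (rule f_inject) (simp add: f_z f_neg f_u comp[OF S(5) C(3) C(3) J J])
    show "u (z x) = - z (u x)" for x
      by (rule f_inject) (simp add: f_z f_neg f_u comp[OF S(6) J C(3) C(3) J])
  qed
qed

text \<open>The summands for \<open>\<beta>\<close> are \<open>(u + z) / 2\<close> and \<open>(u - z) / 2\<close>. Conjugating them by \<open>h\<close> makes them skew for \<open>b\<close> and keeps
  their sum, because \<open>h\<close> commutes with \<open>u\<close>.\<close>

lemma split_if_skew_splittable:
  assumes b: "bilinear_form scale b" "nondegenerate_on b UNIV" "\<And>x y. b x y = b y x"
    and u: "endomorphism u" "\<And>x y. b (u x) y = - b x (u y)"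
    and cs: "jordan_cells scale u cs"
    and good: "mset ds = mset cs" "skew_splittable (jordan_matrix ds)"
    and char2: "(2 :: 'a) \<noteq> 0"
  shows "\<exists>a1 a2. endomorphism a1 \<and> endomorphism a2 \<and> (\<forall>x y. b (a1 x) y = - b x (a1 y)) \<and> (\<forall>x y. b (a2 x) y = - b x (a2 y))
    \<and> (\<forall>x. a1 (a1 x) = 0) \<and> (\<forall>x. a2 (a2 x) = 0) \<and> (\<forall>x. u x = a1 x + a2 x)"
proof -
  obtain \<beta> z where H: "bilinear_form scale \<beta> \<and> endomorphism z \<and> nondegenerate_on \<beta> UNIV \<and> (\<forall>x y. \<beta> x y = \<beta> y x)
    \<and> (\<forall>x y. \<beta> (u x) y = - \<beta> x (u y)) \<and> (\<forall>x y. \<beta> (z x) y = - \<beta> x (z y))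
    \<and> (\<forall>x. z (z x) = - u (u x)) \<and> (\<forall>x. u (z x) = - z (u x))"
    using split_form_of_cells[OF u(1) cs good] by (elim exE) (rule that)
  then have \<beta>: "bilinear_form scale \<beta>" "nondegenerate_on \<beta> UNIV" "\<And>x y. \<beta> x y = \<beta> y x"
    and \<beta>u: "\<And>x y. \<beta> (u x) y = - \<beta> x (u y)" and z: "endomorphism z" "\<And>x y. \<beta> (z x) y = - \<beta> x (z y)"
      "\<And>x. z (z x) = - u (u x)" "\<And>x. u (z x) = - z (u x)"
    by blast+
  obtain h where H: "endomorphism h \<and> inj h \<and> (\<forall>x. h (u x) = u (h x)) \<and> (\<forall>x y. \<beta> x y = b (h x) (h y))"
    using transport_skew[of b \<beta> u, OF b \<beta> u \<beta>u char2] by (elim exE) (rule that)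
  then obtain k where k: "endomorphism k" "\<And>x. k (h x) = x" "\<And>x. h (k x) = x"
    using endo.linear_injective_isomorphism[of h] by blast
  have h: "endomorphism h" "endomorphism k" "\<And>x. h (k x) = x" "\<And>x. k (h x) = x"
    "\<And>x. h (u x) = u (h x)" "\<And>x y. \<beta> x y = b (h x) (h y)"
    using H k by simp_all
  have ul: "u (x + y) = u x + u y" "u (scale c x) = scale c (u x)" "u (- x) = - u x" "u (x - y) = u x - u y" for x y c
    using u(1) endo.linear_neg[OF u(1)] endo.linear_diff[OF u(1)] by (simp_all add: endomorphism_iff)
  have zl: "z (x + y) = z x + z y" "z (scale c x) = scale c (z x)" "z (- x) = - z x" "z (x - y) = z x - z y" for x y c
    using z(1) endo.linear_neg[OF z(1)] endo.linear_diff[OF z(1)] by (simp_all add: endomorphism_iff)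
  \<comment> \<open>Both summands at once, for \<open>\<epsilon> = 1\<close> and \<open>\<epsilon> = - 1\<close>.\<close>
  define a where "a \<epsilon> x = h (scale (1 / 2) (u (k x) + scale \<epsilon> (z (k x))))" for \<epsilon> x
  have half: "scale (1 / 2) (x + x) = x" for x
  proof -
    have "scale (1 / 2) (x + x) = scale (1 / 2 + 1 / 2) x"
      by (simp only: scale_right_distrib scale_left_distrib)
    also have "(1 / 2 + 1 / 2 :: 'a) = 1" using char2 by (simp add: field_simps)
    finally show ?thesis by simp
  qed
  have endo_a: "endomorphism (a \<epsilon>)" for \<epsilon>
    using h(1,2) unfolding endomorphism_iff a_def
    by (simp add: ul zl scale_right_distrib ac_simps)
  have skew_a: "b (a \<epsilon> x) y = - b x (a \<epsilon> y)" for \<epsilon> x y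
  proof -
    have "b (a \<epsilon> x) y = \<beta> (scale (1 / 2) (u (k x) + scale \<epsilon> (z (k x)))) (k y)"
      unfolding a_def h(6) h(3) ..
    also have "\<dots> = - \<beta> (k x) (scale (1 / 2) (u (k y) + scale \<epsilon> (z (k y))))"
      by (simp add: bilinear_formD[OF \<beta>(1)] \<beta>u z(2) algebra_simps)
    also have "\<dots> = - b x (a \<epsilon> y)" unfolding a_def h(6) h(3) ..
    finally show ?thesis .
  qed
  have sq_a: "a \<epsilon> (a \<epsilon> x) = 0" if "\<epsilon> * \<epsilon> = 1" for \<epsilon> x
  proof -
    define q where "q v = u v + scale \<epsilon> (z v)" for v
    have "q (q v) = u (u v) + scale (\<epsilon> * \<epsilon>) (z (z v))" for v
      unfolding q_def by (simp add: ul zl z(4) scale_right_distrib)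
    then have qq: "q (q v) = 0" for v using that z(3) by simp
    have qs: "q (scale c v) = scale c (q v)" for c v
      unfolding q_def by (simp add: ul zl scale_right_distrib mult.commute)
    have "a \<epsilon> (a \<epsilon> x) = h (scale (1 / 2) (q (scale (1 / 2) (q (k x)))))"
      unfolding a_def q_def h(4) ..
    then show ?thesis unfolding qs qq using endo.linear_0[OF h(1)] by simp
  qed
  have sum: "u x = a 1 x + a (- 1) x" for x
  proof -
    have "a 1 x = h (scale (1 / 2) (u (k x) + z (k x)))" "a (- 1) x = h (scale (1 / 2) (u (k x) - z (k x)))"
      unfolding a_def by simp_all
    then have "a 1 x + a (- 1) x = h (scale (1 / 2) ((u (k x) + z (k x)) + (u (k x) - z (k x))))"
      unfolding scale_right_distrib using h(1) by (simp only: endomorphism_iff)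
    also have "(u (k x) + z (k x)) + (u (k x) - z (k x)) = u (k x) + u (k x)" by simp
    finally show ?thesis unfolding half using h(5)[of "k x"] h(3) by simp
  qed
  show ?thesis
    by (rule exI[of _ "a 1"], rule exI[of _ "a (- 1)"]) (use endo_a skew_a sq_a sum in simp)
qed

end

section \<open>Sums of two square-zero skew-selfadjoint endomorphisms\<close>

theorem theorem1p18:
  fixes scale :: "'a::alg_closed_field \<Rightarrow> 'v::ab_group_add \<Rightarrow> 'v"
    and Basis :: "'v set"
    and b :: "'v \<Rightarrow> 'v \<Rightarrow> 'a"
    and u :: "'v \<Rightarrow> 'v"
  assumes "CHAR('a) \<noteq> 2"
    and "finite_dimensional_vector_space scale Basis"
    and "bilinear_form scale b"
    and "symmetric_form b"
    and "nondegenerate_form b"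
    and "skew_selfadjoint scale b u"
  shows "(\<exists>a1 a2. skew_selfadjoint scale b a1 \<and> skew_selfadjoint scale b a2 \<and>
            (\<forall>x. a1 (a1 x) = 0) \<and> (\<forall>x. a2 (a2 x) = 0) \<and> (\<forall>x. u x = a1 x + a2 x))
     \<longleftrightarrow>
       (\<forall>l k. l \<noteq> 0 \<and> k \<ge> 1 \<longrightarrow> even (jordan_number scale u l k)) \<and>
       (\<forall>k. odd (\<Sum>i | i > k \<and> jordan_number scale u 0 (2 * i + 1) \<noteq> 0.
                   jordan_number scale u 0 (2 * i + 1))
            \<longrightarrow> jordan_number scale u 0 (2 * k + 1) > 0)"
proof -
  interpret V: alg_closed_vector_space scale Basis
    by (rule alg_closed_vector_space.intro[OF assms(2)])
  have char2: "(2 :: 'a) \<noteq> 0"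
  proof
    assume "(2 :: 'a) = 0"
    then have "of_nat 2 = (0 :: 'a)" by simp
    then have dvd: "CHAR('a) dvd 2" by (simp only: of_nat_eq_0_iff_char_dvd)
    then have "CHAR('a) \<le> 2" by (rule dvd_imp_le) simp
    moreover have "CHAR('a) \<noteq> 0" using dvd by (intro notI) simp
    moreover have "CHAR('a) \<noteq> Suc 0" by simp
    ultimately show False using assms(1) by linarith
  qed
  note b = assms(3)
  have sym: "b x y = b y x" for x y using assms(4) by (simp add: symmetric_form_def)
  have nd: "V.nondegenerate_on b UNIV"
    using assms(5) by (auto simp: nondegenerate_form_def V.nondegenerate_on_def V.perp_def)
  have u: "V.endomorphism u" and skew: "b (u x) y = - b x (u y)" for x y
    using assms(6) by (simp_all add: skew_selfadjoint_def)
  \<comment> \<open>the enumeration of the cells from which \<open>jordan_number\<close> is computed\<close>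
  define cs where "cs = (SOME cs. jordan_cells scale u cs)"
  have cs: "jordan_cells scale u cs"
    unfolding cs_def using V.jordan_cells_exist[OF u] by (rule someI_ex)
  have number: "jordan_number scale u l k = count (mset cs) (k, l)" for l k
    by (simp add: jordan_number_def cs_def count_mset)
  have size0: "count (mset cs) (0, l) = 0" for l
    using cs by (force simp: jordan_cells_def jordan_nf_def count_eq_zero_iff)
  show ?thesis
    unfolding number odd_tail_eq_sum
  proof (rule iffI)
    assume "\<exists>a1 a2. skew_selfadjoint scale b a1 \<and> skew_selfadjoint scale b a2 \<and>
            (\<forall>x. a1 (a1 x) = 0) \<and> (\<forall>x. a2 (a2 x) = 0) \<and> (\<forall>x. u x = a1 x + a2 x)"
    then obtain a1 a2 where a: "skew_selfadjoint scale b a1 \<and> skew_selfadjoint scale b a2 \<and>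
            (\<forall>x. a1 (a1 x) = 0) \<and> (\<forall>x. a2 (a2 x) = 0) \<and> (\<forall>x. u x = a1 x + a2 x)"
      by (elim exE) (rule that)
    interpret square_zero_sum scale Basis b u a1 a2
    proof
      show "b x y = b y x" for x y by (rule sym)
    qed (use a b nd char2 in \<open>simp_all add: skew_selfadjoint_def V.endomorphism_iff\<close>)
    show "(\<forall>l k. l \<noteq> 0 \<and> k \<ge> 1 \<longrightarrow> even (count (mset cs) (k, l)))
      \<and> (\<forall>k. odd (odd_tail (mset cs) k) \<longrightarrow> count (mset cs) (2 * k + 1, 0) > 0)"
    proof (intro conjI allI impI)
      show "even (count (mset cs) (k, l))" if "l \<noteq> 0 \<and> k \<ge> 1" for k l
        using even_nonzero_cells[OF cs, of l k] that by simp
      show "count (mset cs) (2 * k + 1, 0) > 0" if "odd (odd_tail (mset cs) k)" for k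
        by (rule odd_tail_imp_cell[OF cs that])
    qed
  next
    assume c: "(\<forall>l k. l \<noteq> 0 \<and> k \<ge> 1 \<longrightarrow> even (count (mset cs) (k, l)))
      \<and> (\<forall>k. odd (odd_tail (mset cs) k) \<longrightarrow> count (mset cs) (2 * k + 1, 0) > 0)"
    have "even (count (mset cs) (k, l))" if l: "l \<noteq> 0" for k l
    proof (cases "k = 0")
      case True
      then show ?thesis by (simp add: size0)
    next
      case False
      then have "l \<noteq> 0 \<and> k \<ge> 1" using l by simp
      with c show ?thesis by blast
    qed
    moreover have "count (mset cs) (k, - l) = count (mset cs) (k, l)" for k l
    proof (cases "k = 0")
      case True
      then show ?thesis by (simp only: size0)
    next
      case False
      then have "k \<ge> 1" by simp
      then show ?thesis
        by (rule V.count_cells_uminus[where b = b and u = u and cs = cs, OF u cs b nd sym skew char2])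
    qed
    moreover have "even (count (mset cs) (k, 0))" if k: "even k" for k
    proof -
      obtain i where i: "k = 2 * i" using k by (elim evenE)
      show ?thesis
      proof (cases "i = 0")
        case True
        then show ?thesis using size0[of 0] by (simp only: i mult_0_right even_zero)
      next
        case False
        then have "i \<ge> 1" by simp
        then show ?thesis unfolding i
          by (rule V.even_count_even_cells[where b = b and u = u and cs = cs, OF u cs b nd sym skew char2])
      qed
    qed
    ultimately have "admissible (mset cs)" using c unfolding admissible_def by blast
    then obtain ds where ds: "mset ds = mset cs" "skew_splittable (jordan_matrix ds)"
      using admissible_imp_skew_splittable[OF _ char2] by blast
    obtain a1 a2 where "V.endomorphism a1 \<and> V.endomorphism a2
        \<and> (\<forall>x y. b (a1 x) y = - b x (a1 y)) \<and> (\<forall>x y. b (a2 x) y = - b x (a2 y))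
        \<and> (\<forall>x. a1 (a1 x) = 0) \<and> (\<forall>x. a2 (a2 x) = 0) \<and> (\<forall>x. u x = a1 x + a2 x)"
      using V.split_if_skew_splittable[of b u cs ds, OF b nd sym u skew cs ds char2] by (elim exE) (rule that)
    then show "\<exists>a1 a2. skew_selfadjoint scale b a1 \<and> skew_selfadjoint scale b a2 \<and>
            (\<forall>x. a1 (a1 x) = 0) \<and> (\<forall>x. a2 (a2 x) = 0) \<and> (\<forall>x. u x = a1 x + a2 x)"
      unfolding skew_selfadjoint_def by (intro exI[of _ a1] exI[of _ a2]) simp
  qed
qed

end
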